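(* Let $N,L,K,R$ be positive integers and $M>0$. Suppose that: (A1') for each $i\in[N]$, $\Xi_i=[0,B_i]\subset\mathbb{R}$ is a finite interval; (A2') for each $l\in[L]$, $f_l:\prod_{i\in[N]}\Xi_i\to\mathbb{R}$ is a submodular function that is $M$-Lipschitz with respect to the infinity norm and has a polynomial time evaluation oracle, and $\gamma_l\in\mathbb{R}$; (A3') the ambiguity set $$\mathcal{P}_{\mathrm{sub}}:=\Big\{\mathbb{P}\in\mathcal{P}\big(\textstyle\prod_{i\in[N]}\Xi_i\big)\ \Big|\ \mathbb{E}_{\mathbb{P}}[f_l(\tilde{\boldsymbol{\xi}})]\le\gamma_l,\ \forall l\in[L]\Big\}$$ is nonempty with $\sum_{r\in[R]}p_r\delta_{\boldsymbol{\xi}_r}\in\mathcal{P}_{\mathrm{sub}}$; (A4') the cost function is $g(\boldsymbol{\xi}):=\max_{k\in[K]}g_k(\boldsymbol{\xi})$, where for each $k\in[K]$ the function $g_k:\prod_{i\in[N]}\Xi_i\to\mathbb{R}$ is a supermodular function that is $M$-Lipschitz with respect to the infinity norm and has a polynomial time evaluation oracle. Let $\rho^*:=\sup_{\mathbb{P}\in\mathcal{P}_{\mathrm{sub}}}\mathbb{E}_{\mathbb{P}}[g(\tilde{\boldsymbol{\xi}})]$. Then for every $\epsilon>0$, one can find a value $\rho^*_\epsilon\ge\rho^*-\epsilon$ in time polynomial in $N$, $L$, $K$, $\max_{i\in[N]}B_i$, $R$, $M$, $\frac{1}{\epsilon}$ and the evaluation time of the oracles such that there exists a distribution $\mathbb{P}^*_\epsilon\in\mathcal{P}(\prod_{i\in[N]}\Xi_i)$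 with $\rho^*_\epsilon=\mathbb{E}_{\mathbb{P}^*_\epsilon}[g(\tilde{\boldsymbol{\xi}})]$ and $\mathbb{E}_{\mathbb{P}^*_\epsilon}[f_l(\tilde{\boldsymbol{\xi}})]\le\gamma_l+\epsilon$ for all $l\in[L]$.
   Context: $[N]=\{1,\ldots,N\}$. $\mathcal{P}(\Xi)$ denotes the set of all probability distributions with support contained in $\Xi$; $\tilde{\boldsymbol{\xi}}$ is a random vector with distribution $\mathbb{P}$; $\delta_{\boldsymbol{\xi}}$ is the Dirac measure at $\boldsymbol{\xi}$. In (A3'), $\boldsymbol{\xi}_1,\ldots,\boldsymbol{\xi}_R\in\prod_{i\in[N]}\Xi_i$, $p_r\ge0$ and $\sum_{r\in[R]}p_r=1$, so the condition specifies a finitely supported distribution belonging to $\mathcal{P}_{\mathrm{sub}}$. A function $f:\prod_{i\in[N]}\Xi_i\to\mathbb{R}$ is submodular if $f(\boldsymbol{\xi})+f(\boldsymbol{\chi})\ge f(\boldsymbol{\xi}\wedge\boldsymbol{\chi})+f(\boldsymbol{\xi}\vee\boldsymbol{\chi})$ for all $\boldsymbol{\xi},\boldsymbol{\chi}\in\prod_{i\in[N]}\Xi_i$, where $\wedge$ and $\vee$ are the componentwise minimum and maximum. It is supermodular if $-f$ is submodular. It is $M$-Lipschitz with respect to the infinity norm if $|f(\boldsymbol{\xi})-f(\boldsymbol{\chi})|\le M\max_{i\in[N]}|\xi_i-\chi_i|$ for all $\boldsymbol{\xi},\boldsymbol{\chi}$. A polynomial time evaluation oracle returns the function value at a given point in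 polynomial time (exactly for rational valued functions; for real valued functions it returns a rational value with relative error $\epsilon>0$ in time polynomial in the input size and $\log(1/\epsilon)$). Running times are stated with the usual conventions for input size and for the ellipsoid method. *)

theory Defs
  imports "HOL-Probability.Probability" "HOL-Library.Log_Nat"
    "HOL-Computational_Algebra.Polynomial"
begin

section \<open>Submodularity and distributions on a box\<close>

text \<open>A vector indexed by \<open>{1..N}\<close> is an extensional function on that set, so that the
  dimension can be an ordinary natural number over which a single algorithm is uniform.\<close>

definition cuboid :: "nat \<Rightarrow> (nat \<Rightarrow> real) \<Rightarrow> (nat \<Rightarrow> real) set" where
  "cuboid N B = (\<Pi>\<^sub>E i\<in>{1..N}. {0..B i})"

definition submodular :: "(nat \<Rightarrow> real) set \<Rightarrow> ((nat \<Rightarrow> real) \<Rightarrow> real) \<Rightarrow> bool" where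
  "submodular X f \<longleftrightarrow> (\<forall>x\<in>X. \<forall>y\<in>X.
     f x + f y \<ge> f (\<lambda>i. min (x i) (y i)) + f (\<lambda>i. max (x i) (y i)))"

definition supermodular :: "(nat \<Rightarrow> real) set \<Rightarrow> ((nat \<Rightarrow> real) \<Rightarrow> real) \<Rightarrow> bool" where
  "supermodular X f \<longleftrightarrow> submodular X (\<lambda>x. - f x)"

definition lipschitz_infnorm ::
    "nat \<Rightarrow> real \<Rightarrow> (nat \<Rightarrow> real) set \<Rightarrow> ((nat \<Rightarrow> real) \<Rightarrow> real) \<Rightarrow> bool" where
  "lipschitz_infnorm N M X f \<longleftrightarrow>
     (\<forall>x\<in>X. \<forall>y\<in>X. \<bar>f x - f y\<bar> \<le> M * Max ((\<lambda>i. \<bar>x i - y i\<bar>) ` {1..N}))"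

text \<open>Distributions live on the subspace \<open>X\<close> itself: a function on \<open>X\<close> is represented by a
  total function, whose values outside \<open>X\<close> must not affect integrability.\<close>

definition borel_on :: "nat \<Rightarrow> (nat \<Rightarrow> real) set \<Rightarrow> (nat \<Rightarrow> real) measure" where
  "borel_on N X = restrict_space (\<Pi>\<^sub>M i\<in>{1..N}. borel) X"

definition distributions :: "nat \<Rightarrow> (nat \<Rightarrow> real) set \<Rightarrow> (nat \<Rightarrow> real) measure set" where
  "distributions N X = {P. prob_space P \<and> sets P = sets (borel_on N X)}"

definition ambiguity_set :: "nat \<Rightarrow> (nat \<Rightarrow> real) set \<Rightarrow> nat \<Rightarrow>
    (nat \<Rightarrow> (nat \<Rightarrow> real) \<Rightarrow> real) \<Rightarrow> (nat \<Rightarrow> real) \<Rightarrow> (nat \<Rightarrow> real) measure set" where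
  "ambiguity_set N X L f \<gamma> =
     {P \<in> distributions N X. \<forall>l\<in>{1..L}. (\<integral>x. f l x \<partial>P) \<le> \<gamma> l}"

text \<open>The measure \<open>\<Sum>r=1..R. p r * \<delta>(\<xi> r)\<close>; the points \<open>\<xi> r\<close> may coincide.\<close>

definition dirac_mixture :: "nat \<Rightarrow> (nat \<Rightarrow> real) set \<Rightarrow> nat \<Rightarrow> (nat \<Rightarrow> real) \<Rightarrow>
    (nat \<Rightarrow> nat \<Rightarrow> real) \<Rightarrow> (nat \<Rightarrow> real) measure" where
  "dirac_mixture N X R p \<xi> =
     distr (point_measure {1..R} (\<lambda>r. ennreal (p r))) (borel_on N X) \<xi>"


section \<open>Programs with bit-length cost and oracle calls\<close>

text \<open>A while language over binary trees with rational leaves. Every operation costs at least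
  the number of bits of its result and is computable in time polynomial in the bit-lengths of
  its arguments, and the cost of an oracle call is the time used by the oracle. Hence running
  time agrees with that of deterministic oracle Turing machines up to a polynomial.\<close>

datatype val = Num rat | Pair val val

fun bits :: "val \<Rightarrow> nat" where
  "bits (Num q) =
     1 + floorlog 2 (nat \<bar>fst (quotient_of q)\<bar>) + floorlog 2 (nat (snd (quotient_of q)))"
| "bits (Pair u v) = 1 + bits u + bits v"

fun num_of :: "val \<Rightarrow> rat" where
  "num_of (Num q) = q"
| "num_of (Pair u v) = 0"

fun left_of :: "val \<Rightarrow> val" where
  "left_of (Num q) = Num 0"
| "left_of (Pair u v) = u"

fun right_of :: "val \<Rightarrow> val" where
  "right_of (Num q) = Num 0"
| "right_of (Pair u v) = v"

type_synonym store = "nat \<Rightarrow> val"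

datatype expr =
    Const rat | Reg nat
  | Add expr expr | Sub expr expr | Mul expr expr | Div expr expr
  | Floor expr | Leq expr expr
  | MkPair expr expr | Fst expr | Snd expr | IsPair expr

fun denote :: "expr \<Rightarrow> store \<Rightarrow> val" where
  "denote (Const q) s = Num q"
| "denote (Reg n) s = s n"
| "denote (Add a b) s = Num (num_of (denote a s) + num_of (denote b s))"
| "denote (Sub a b) s = Num (num_of (denote a s) - num_of (denote b s))"
| "denote (Mul a b) s = Num (num_of (denote a s) * num_of (denote b s))"
| "denote (Div a b) s = Num (num_of (denote a s) / num_of (denote b s))"
| "denote (Floor a) s = Num (of_int \<lfloor>num_of (denote a s)\<rfloor>)"
| "denote (Leq a b) s = Num (if num_of (denote a s) \<le> num_of (denote b s) then 1 else 0)"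
| "denote (MkPair a b) s = Pair (denote a s) (denote b s)"
| "denote (Fst a) s = left_of (denote a s)"
| "denote (Snd a) s = right_of (denote a s)"
| "denote (IsPair a) s = Num (case denote a s of Num q \<Rightarrow> 0 | Pair u v \<Rightarrow> 1)"

fun expr_cost :: "expr \<Rightarrow> store \<Rightarrow> nat" where
  "expr_cost (Const q) s = bits (denote (Const q) s)"
| "expr_cost (Reg n) s = bits (denote (Reg n) s)"
| "expr_cost (Add a b) s = bits (denote (Add a b) s) + expr_cost a s + expr_cost b s"
| "expr_cost (Sub a b) s = bits (denote (Sub a b) s) + expr_cost a s + expr_cost b s"
| "expr_cost (Mul a b) s = bits (denote (Mul a b) s) + expr_cost a s + expr_cost b s"
| "expr_cost (Div a b) s = bits (denote (Div a b) s) + expr_cost a s + expr_cost b s"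
| "expr_cost (Floor a) s = bits (denote (Floor a) s) + expr_cost a s"
| "expr_cost (Leq a b) s = bits (denote (Leq a b) s) + expr_cost a s + expr_cost b s"
| "expr_cost (MkPair a b) s = bits (denote (MkPair a b) s) + expr_cost a s + expr_cost b s"
| "expr_cost (Fst a) s = bits (denote (Fst a) s) + expr_cost a s"
| "expr_cost (Snd a) s = bits (denote (Snd a) s) + expr_cost a s"
| "expr_cost (IsPair a) s = bits (denote (IsPair a) s) + expr_cost a s"

datatype prog =
    Assign nat expr
  | Ask nat expr
  | Seq prog prog
  | Cond expr prog prog
  | Loop expr prog

text \<open>\<open>exec ans tm c s t s'\<close>: started in the store \<open>s\<close>, the program \<open>c\<close> halts after time \<open>t\<close> in
  the store \<open>s'\<close>, where a call \<open>w\<close> is answered by \<open>ans w\<close> after time \<open>tm w\<close>.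
  A test succeeds if its value is not \<open>Num 0\<close>.\<close>

inductive exec :: "(val \<Rightarrow> rat) \<Rightarrow> (val \<Rightarrow> nat) \<Rightarrow> prog \<Rightarrow> store \<Rightarrow> nat \<Rightarrow> store \<Rightarrow> bool"
  for ans :: "val \<Rightarrow> rat" and tm :: "val \<Rightarrow> nat" where
  exec_Assign: "exec ans tm (Assign x e) s (1 + expr_cost e s) (s(x := denote e s))"
| exec_Ask: "exec ans tm (Ask x e) s (1 + expr_cost e s + tm (denote e s))
      (s(x := Num (ans (denote e s))))"
| exec_Seq: "exec ans tm c1 s t1 s1 \<Longrightarrow> exec ans tm c2 s1 t2 s2 \<Longrightarrow>
      exec ans tm (Seq c1 c2) s (t1 + t2) s2"
| exec_CondT: "denote e s \<noteq> Num 0 \<Longrightarrow> exec ans tm c1 s t s' \<Longrightarrow>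
      exec ans tm (Cond e c1 c2) s (1 + expr_cost e s + t) s'"
| exec_CondF: "denote e s = Num 0 \<Longrightarrow> exec ans tm c2 s t s' \<Longrightarrow>
      exec ans tm (Cond e c1 c2) s (1 + expr_cost e s + t) s'"
| exec_LoopT: "denote e s \<noteq> Num 0 \<Longrightarrow> exec ans tm c s t1 s1 \<Longrightarrow>
      exec ans tm (Loop e c) s1 t2 s2 \<Longrightarrow>
      exec ans tm (Loop e c) s (1 + expr_cost e s + t1 + t2) s2"
| exec_LoopF: "denote e s = Num 0 \<Longrightarrow> exec ans tm (Loop e c) s (1 + expr_cost e s) s"

lemma exec_deterministic:
  "exec ans tm c s t s' \<Longrightarrow> exec ans tm c s u s'' \<Longrightarrow> t = u \<and> s' = s''"
proof (induction arbitrary: u s'' rule: exec.induct)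
  case (exec_Assign x e s)
  show ?case using exec_Assign.prems by cases simp
next
  case (exec_Ask x e s)
  show ?case using exec_Ask.prems by cases simp
next
  case (exec_Seq c1 s t1 s1 c2 t2 s2)
  show ?case using exec_Seq.prems
  proof cases
    case inner: (exec_Seq t1' s1' t2')
    then show ?thesis using exec_Seq.IH(1)[of t1' s1'] exec_Seq.IH(2)[of t2' s''] by simp
  qed
next
  case (exec_CondT e s c1 t s' c2)
  show ?case using exec_CondT.prems
  proof cases
    case inner: (exec_CondT t')
    then show ?thesis using exec_CondT.IH[of t' s''] by simp
  next
    case inner: (exec_CondF t')
    then show ?thesis using exec_CondT.hyps(1) by simp
  qed
next
  case (exec_CondF e s c2 t s' c1)
  show ?case using exec_CondF.prems
  proof cases
    case inner: (exec_CondT t')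
    then show ?thesis using exec_CondF.hyps(1) by simp
  next
    case inner: (exec_CondF t')
    then show ?thesis using exec_CondF.IH[of t' s''] by simp
  qed
next
  case (exec_LoopT e s c t1 s1 t2 s2)
  show ?case using exec_LoopT.prems
  proof cases
    case inner: (exec_LoopT t1' s1' t2')
    then show ?thesis using exec_LoopT.IH(1)[of t1' s1'] exec_LoopT.IH(2)[of t2' s''] by simp
  next
    case inner: exec_LoopF
    then show ?thesis using exec_LoopT.hyps(1) by simp
  qed
next
  case (exec_LoopF e s c)
  show ?case using exec_LoopF.prems
  proof cases
    case inner: (exec_LoopT t1' s1' t2')
    then show ?thesis using exec_LoopF.hyps by simp
  next
    case inner: exec_LoopF
    then show ?thesis by simp
  qed
qed


section \<open>Evaluation oracles\<close>

text \<open>The real quantities a program may ask for: the numbers \<open>M\<close>, \<open>\<epsilon>\<close>, \<open>B i\<close>, \<open>\<gamma> l\<close>, \<open>p r\<close>,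
  \<open>\<xi> r i\<close>, and the values of \<open>f l\<close> and \<open>g k\<close> at rational points.\<close>

datatype source =
    Src_M | Src_eps | Src_B nat | Src_gamma nat | Src_p nat | Src_xi nat nat
  | Src_f nat | Src_g nat

abbreviation nat_val :: "nat \<Rightarrow> val" where
  "nat_val n \<equiv> Num (of_nat n)"

fun source_val :: "source \<Rightarrow> val" where
  "source_val Src_M = Pair (nat_val 0) (nat_val 0)"
| "source_val Src_eps = Pair (nat_val 1) (nat_val 0)"
| "source_val (Src_B i) = Pair (nat_val 2) (nat_val i)"
| "source_val (Src_gamma l) = Pair (nat_val 3) (nat_val l)"
| "source_val (Src_p r) = Pair (nat_val 4) (nat_val r)"
| "source_val (Src_xi r i) = Pair (nat_val 5) (Pair (nat_val r) (nat_val i))"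
| "source_val (Src_f l) = Pair (nat_val 6) (nat_val l)"
| "source_val (Src_g k) = Pair (nat_val 7) (nat_val k)"

definition list_val :: "rat list \<Rightarrow> val" where
  "list_val xs = foldr (\<lambda>q v. Pair (Num q) v) xs (Num 0)"

text \<open>The call for the value of \<open>h\<close> at the rational point \<open>xs\<close> with relative error \<open>1 / 2 ^ n\<close>.\<close>

definition query :: "source \<Rightarrow> rat list \<Rightarrow> nat \<Rightarrow> val" where
  "query h xs n = Pair (source_val h) (Pair (list_val xs) (nat_val n))"

text \<open>\<open>poly_time_oracle ans tm T d h D v\<close>: the function \<open>v\<close> on the set \<open>D\<close> of rational points is
  evaluated with relative error \<open>1 / 2 ^ n\<close>, and exactly if it takes only rational values, within
  time \<open>T * (1 + n + size of the point) ^ d\<close>; this time includes writing down the answer.\<close>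

definition poly_time_oracle :: "(val \<Rightarrow> rat) \<Rightarrow> (val \<Rightarrow> nat) \<Rightarrow> nat \<Rightarrow> nat \<Rightarrow>
    source \<Rightarrow> rat list set \<Rightarrow> (rat list \<Rightarrow> real) \<Rightarrow> bool" where
  "poly_time_oracle ans tm T d h D v \<longleftrightarrow>
     (\<forall>xs\<in>D. \<forall>n.
        \<bar>of_rat (ans (query h xs n)) - v xs\<bar> \<le> \<bar>v xs\<bar> / 2 ^ n \<and>
        bits (Num (ans (query h xs n))) \<le> tm (query h xs n) \<and>
        tm (query h xs n) \<le> T * (1 + n + bits (list_val xs)) ^ d) \<and>
     ((\<forall>xs\<in>D. v xs \<in> \<rat>) \<longrightarrow> (\<forall>xs\<in>D. \<forall>n. of_rat (ans (query h xs n)) = v xs))"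

definition point :: "nat \<Rightarrow> rat list \<Rightarrow> nat \<Rightarrow> real" where
  "point N xs = (\<lambda>i\<in>{1..N}. of_rat (xs ! (i - 1)))"

definition rat_points :: "nat \<Rightarrow> (nat \<Rightarrow> real) set \<Rightarrow> rat list set" where
  "rat_points N X = {xs. length xs = N \<and> point N xs \<in> X}"

definition function_oracle :: "(val \<Rightarrow> rat) \<Rightarrow> (val \<Rightarrow> nat) \<Rightarrow> nat \<Rightarrow> nat \<Rightarrow>
    source \<Rightarrow> nat \<Rightarrow> (nat \<Rightarrow> real) set \<Rightarrow> ((nat \<Rightarrow> real) \<Rightarrow> real) \<Rightarrow> bool" where
  "function_oracle ans tm T d h N X f \<longleftrightarrow>
     poly_time_oracle ans tm T d h (rat_points N X) (\<lambda>xs. f (point N xs))"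

text \<open>A real number is accessed like a function without arguments. A rational number is then
  returned exactly, and \<open>T\<close> bounds its encoding length up to a constant depending on \<open>d\<close>.\<close>

definition number_oracle :: "(val \<Rightarrow> rat) \<Rightarrow> (val \<Rightarrow> nat) \<Rightarrow> nat \<Rightarrow> nat \<Rightarrow>
    source \<Rightarrow> real \<Rightarrow> bool" where
  "number_oracle ans tm T d h y \<longleftrightarrow> poly_time_oracle ans tm T d h {[]} (\<lambda>xs. y)"

text \<open>A nonconstant continuous function takes irrational values, so ``rational valued'' refers to
  the points that can be passed to an oracle.\<close>

definition rational_valued :: "nat \<Rightarrow> (nat \<Rightarrow> real) set \<Rightarrow> ((nat \<Rightarrow> real) \<Rightarrow> real) \<Rightarrow> bool" where
  "rational_valued N X f \<longleftrightarrow> (\<forall>xs\<in>rat_points N X. f (point N xs) \<in> \<rat>)"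

definition init_store :: "nat \<Rightarrow> nat \<Rightarrow> nat \<Rightarrow> nat \<Rightarrow> nat \<Rightarrow> store" where
  "init_store N L K R a =
     (\<lambda>_. Num 0)(0 := nat_val N, 1 := nat_val L, 2 := nat_val K, 3 := nat_val R, 4 := nat_val a)"

text \<open>\<open>finds_value \<dots> N L K R \<rho> exact \<tau>\<close>: the program outputs the number \<open>\<rho>\<close>, following the
  convention for oracles. If \<open>exact\<close> holds, the output is \<open>\<rho>\<close> itself. Otherwise \<open>\<rho>\<close> may be
  irrational, and the program, given \<open>a\<close>, outputs a rational number within \<open>1 / 2 ^ a\<close> of it; here
  \<open>\<rho>\<close> does not depend on \<open>a\<close>. The time is at most \<open>\<tau> a\<close>; in the exact case take \<open>a = 0\<close>.\<close>

definition finds_value :: "(val \<Rightarrow> rat) \<Rightarrow> (val \<Rightarrow> nat) \<Rightarrow> prog \<Rightarrow> nat \<Rightarrow> nat \<Rightarrow> nat \<Rightarrow> nat \<Rightarrow>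
    real \<Rightarrow> bool \<Rightarrow> (nat \<Rightarrow> real) \<Rightarrow> bool" where
  "finds_value ans tm c N L K R \<rho> exact \<tau> \<longleftrightarrow>
     (\<forall>a. \<exists>t s q. exec ans tm c (init_store N L K R a) t s \<and> s 0 = Num q \<and>
        \<bar>of_rat q - \<rho>\<bar> \<le> 1 / 2 ^ a \<and> (exact \<longrightarrow> of_rat q = \<rho>) \<and> real t \<le> \<tau> a)"

text \<open>Up to constants, a bound polynomial in several nonnegative quantities is the same as a bound
  by a univariate polynomial in their sum.\<close>

definition poly_in :: "real poly \<Rightarrow> real list \<Rightarrow> real" where
  "poly_in \<pi> xs = poly \<pi> (sum_list xs)"

end

theory Submission
  imports Defs
begin

text \<open>Time may be polynomial in \<open>M\<close>, \<open>max B i\<close> and \<open>1 / \<epsilon>\<close>, so first-order methods on a grid replace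
  the ellipsoid method. Multipliers \<open>\<lambda>\<close> in a box \<open>[0, \<Lambda>]\<close> follow online gradient ascent: in round \<open>t\<close>
  a pair \<open>(k, x)\<close> that nearly minimizes the submodular function \<open>\<Sum>l. \<lambda> l * f l - g k\<close> over a grid is
  chosen, and \<open>\<lambda> l\<close> moves by \<open>f l x - \<gamma> l\<close> and is clipped. The uniform distribution on the chosen
  points is the answer. Comparing its payoff with that of any \<open>P\<close> in the ambiguity set, the regret
  against \<open>\<lambda> = 0\<close> bounds the loss in value, and the regret against \<open>\<Lambda>\<close> times a unit vector bounds
  the violation of a constraint; no duality theorem is needed.

  The inner minimization is subgradient descent on the Lovasz extension. The grid coordinate \<open>i\<close> is
  a chain of elements labelled \<open>i\<close>, each with a weight in \<open>[0, Z]\<close>. A sweep visits the elements by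
  decreasing weight, raises the coordinate of the element visited, and lowers its weight by the
  increment of the objective. Sorting the weights again plays the role of the projection onto the
  monotone vectors.

  All numbers are rounded to integers of polynomial size, so that every register has polynomially
  many bits, and the run time is the number of elementary steps times the cost of one step.\<close>

section \<open>Bit lengths\<close>

text \<open>Rounded oracle answers need not be submodular. The descent therefore works with integers
  throughout and invokes submodularity only to bound the gains that count towards a competitor,
  where the exact function is substituted at a cost of \<open>2 * \<nu>\<close> per element. Sorting
  can replace a projection because exchanging two neighbours that are out of order never increases
  the distance to a vector that fills each chain from its start, and every grid point corresponds to
  such a vector. Both gradient methods take unit steps on integers: with weights up to
  \<open>Z\<close> and increments up to \<open>Wb\<close>, the choice \<open>Z = Wb\<^sup>2\<close>
  balances the initial distance against the sum of squared steps, and \<open>T = Lam\<^sup>2\<close>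
  reduces the initial distance of a multiplier to one unit per round. The number to be output may be
  irrational and has to be the same for every requested precision \<open>a\<close>. Hence all
  decisions rest on answers whose precision is independent of \<open>a\<close>, so that the chosen
  points are the same for all \<open>a\<close>, and only the values that are averaged are asked for
  with precision \<open>a\<close>.\<close>

declare bits.simps(1) [simp del]

text \<open>Magnitude and denominator are tracked separately: a sum of rationals adds magnitudes but
  multiplies denominators, and the two bounds together control the numerator.\<close>

definition dnm :: "rat \<Rightarrow> int" where "dnm q = snd (quotient_of q)"

lemma dnm_pos: "dnm q > 0"
  unfolding dnm_def by (metis prod.collapse quotient_of_denom_pos)

lemma quotient_of_eq: "q = of_int (fst (quotient_of q)) / of_int (dnm q)"
  unfolding dnm_def by (metis prod.collapse quotient_of_div)

lemma dnm_dvd: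
  assumes "q = of_int a / of_int d" "d > 0" shows "dnm q dvd d"
proof -
  define n where "n = fst (quotient_of q)"
  have "(of_int n / of_int (dnm q) :: rat) = of_int a / of_int d"
    using assms quotient_of_eq[of q] n_def by simp
  then have "(of_int (n * d) :: rat) = of_int (a * dnm q)"
    using assms(2) dnm_pos[of q] by (simp add: frac_eq_eq)
  then have "n * d = a * dnm q" using of_int_eq_iff by blast
  then have "dnm q dvd n * d" by simp
  moreover have "coprime n (dnm q)"
    unfolding n_def dnm_def by (metis prod.collapse quotient_of_coprime)
  ultimately show ?thesis by (simp add: coprime_commute coprime_dvd_mult_right_iff)
qed

lemma dnm_le: "q = of_int a / of_int d \<Longrightarrow> d > 0 \<Longrightarrow> dnm q \<le> d"
  using dnm_dvd zdvd_imp_le by blast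

lemma dnm_of_int [simp]: "dnm (of_int k) = 1"
  using dnm_le[of "of_int k" k 1] dnm_pos[of "of_int k"] by simp

lemma dnm_add: "dnm (p + q) \<le> dnm p * dnm q"
proof (rule dnm_le)
  show "p + q = of_int (fst (quotient_of p) * dnm q + fst (quotient_of q) * dnm p) /
      of_int (dnm p * dnm q)"
    using quotient_of_eq[of p] quotient_of_eq[of q] dnm_pos[of p] dnm_pos[of q]
    by (metis (no_types, lifting) add_frac_eq of_int_0_eq_iff of_int_add of_int_mult order_less_irrefl)
qed (simp add: dnm_pos)

lemma dnm_uminus [simp]: "dnm (- q) = dnm q"
  unfolding dnm_def by (simp add: rat_uminus_code Let_def split: prod.splits)

lemma dnm_diff: "dnm (p - q) \<le> dnm p * dnm q"
  using dnm_add[of p "- q"] by simp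

lemma dnm_mult: "dnm (p * q) \<le> dnm p * dnm q"
proof (rule dnm_le)
  show "p * q = of_int (fst (quotient_of p) * fst (quotient_of q)) / of_int (dnm p * dnm q)"
    using quotient_of_eq[of p] quotient_of_eq[of q]
    by (metis of_int_mult times_divide_times_eq)
qed (simp add: dnm_pos)

text \<open>The numerator is the value times the denominator and contributes about
  \<open>m + D\<close> bits; the denominator contributes another \<open>D\<close>.\<close>

lemma bits_Num_le:
  assumes "\<bar>q\<bar> \<le> 2 ^ m" "dnm q \<le> 2 ^ D" shows "bits (Num q) \<le> m + 2 * D + 3"
proof -
  define n where "n = fst (quotient_of q)"
  have dp: "dnm q > 0" by (rule dnm_pos)
  have "(of_int n :: rat) = q * of_int (dnm q)"
    using quotient_of_eq[of q] dp n_def by (simp add: field_simps)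
  then have "(of_int \<bar>n\<bar> :: rat) = \<bar>q\<bar> * of_int (dnm q)" using dp by (simp add: abs_mult)
  also have "\<dots> \<le> 2 ^ m * of_int (2 ^ D)"
    using assms dp by (intro mult_mono) (auto simp del: of_int_power)
  finally have "(of_int \<bar>n\<bar> :: rat) \<le> of_int (2 ^ (m + D))" by (simp add: power_add)
  then have "\<bar>n\<bar> \<le> 2 ^ (m + D)" using of_int_le_iff by blast
  then have "\<bar>n\<bar> < 2 ^ (m + D + 1)"
    using power_strict_increasing[of "m + D" "m + D + 1" "2::int"] by linarith
  then have "nat \<bar>n\<bar> < 2 ^ (m + D + 1)"
    by (metis abs_ge_zero nat_less_numeral_power_cancel_iff)
  then have 1: "floorlog 2 (nat \<bar>n\<bar>) \<le> m + D + 1" by (intro floorlog_leI) auto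
  have "dnm q < 2 ^ (D + 1)"
    using assms(2) power_strict_increasing[of D "D + 1" "2::int"] by linarith
  then have "nat (dnm q) < 2 ^ (D + 1)" by (metis nat_less_numeral_power_cancel_iff)
  then have 2: "floorlog 2 (nat (dnm q)) \<le> D + 1" by (intro floorlog_leI) auto
  show ?thesis using 1 2 unfolding n_def dnm_def by (simp add: bits.simps)
qed

lemma bits_NumD:
  assumes "bits (Num q) \<le> m" shows "\<bar>q\<bar> \<le> 2 ^ m" "dnm q \<le> 2 ^ m"
proof -
  define n where "n = fst (quotient_of q)"
  have dp: "dnm q > 0" by (rule dnm_pos)
  have f: "floorlog 2 (nat \<bar>n\<bar>) \<le> m" "floorlog 2 (nat (dnm q)) \<le> m"
    using assms unfolding n_def dnm_def by (simp_all add: bits.simps)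
  have "nat \<bar>n\<bar> < 2 ^ m" "nat (dnm q) < 2 ^ m" using floorlog_leD[OF f(1)] floorlog_leD[OF f(2)] by auto
  then have n: "\<bar>n\<bar> < 2 ^ m" and d: "dnm q < 2 ^ m" by (simp_all add: nat_less_iff)
  show "dnm q \<le> 2 ^ m" using d by simp
  have "\<bar>q\<bar> = of_int \<bar>n\<bar> / of_int (dnm q)"
    using quotient_of_eq[of q] dp n_def by (metis abs_divide abs_of_pos of_int_0_less_iff of_int_abs)
  also have "\<dots> \<le> of_int \<bar>n\<bar>" using dp by (simp add: divide_le_eq mult_le_cancel_left1)
  also have "\<dots> \<le> of_int (2 ^ m)" using n of_int_le_iff less_imp_le by blast
  finally show "\<bar>q\<bar> \<le> 2 ^ m" by simp
qed

lemma bits_of_int_le: "\<bar>k\<bar> \<le> 2 ^ m \<Longrightarrow> bits (Num (of_int k)) \<le> m + 3"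
  using bits_Num_le[of "of_int k" m 0] 
  by (metis add.right_neutral dnm_of_int mult_0_right of_int_abs of_int_le_iff of_int_numeral
      of_int_power order_refl power_0)

lemma bits_of_nat_le: "k \<le> 2 ^ m \<Longrightarrow> bits (nat_val k) \<le> m + 3"
  using bits_of_int_le[of "int k" m] by simp 
   
lemma bits_nat_val: "bits (nat_val k) \<le> k + 3"
  by (rule bits_of_nat_le) (simp add: less_imp_le)

lemma bits_numerals [simp]: "bits (Num 0) = 2" "bits (Num 1) = 3" "bits (Num 2) = 4"
  "bits (Num 3) = 4" "bits (Num 4) = 5" "bits (Num 6) = 5" "bits (Num 7) = 5" "bits (Num 8) = 6"
  "bits (Num 12) = 6" "bits (Num 20) = 7"
  by code_simp+

lemma bits_ge2: "2 \<le> bits v"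
proof (induction v)
  case (Num q)
  have "floorlog 2 (nat (dnm q)) \<ge> 1" using dnm_pos[of q]
    by (metis One_nat_def Suc_leI floorlog_eq_zero_iff gr0I nat_0_iff nat_code(2) not_less numeral_2_eq_2 one_less_numeral_iff semiring_norm(76) zero_less_nat_eq)
  then show ?case unfolding dnm_def by (simp add: bits.simps)
qed simp

lemma bits_num_of: "bits (Num (num_of v)) \<le> bits v"
proof (cases v)
  case (Pair u w)
  then show ?thesis using bits_ge2[of u] by simp
qed simp

lemma bits_left_of: "bits (left_of v) \<le> bits v"
  using bits_ge2[of v] by (cases v) auto

lemma bits_right_of: "bits (right_of v) \<le> bits v"
  using bits_ge2[of v] by (cases v) auto

text \<open>A binary operation yields at most \<open>3 * (m + n) + 4\<close> bits. Bit lengths are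
  at least 2, which absorbs the constant and gives the uniform factor 4.\<close>

lemma bits_op:
  fixes p q :: rat
  defines "m \<equiv> bits (Num p)" and "n \<equiv> bits (Num q)"
  shows "bits (Num (p + q)) \<le> 4 * (m + n)" "bits (Num (p - q)) \<le> 4 * (m + n)"
    "bits (Num (p * q)) \<le> 4 * (m + n)" "bits (Num (p / q)) \<le> 4 * (m + n)"
    "bits (Num (of_int \<lfloor>p\<rfloor>)) \<le> 4 * m"
proof -
  have p: "\<bar>p\<bar> \<le> 2 ^ m" "dnm p \<le> 2 ^ m" and q: "\<bar>q\<bar> \<le> 2 ^ n" "dnm q \<le> 2 ^ n"
    unfolding m_def n_def by (auto intro: bits_NumD)
  have mn: "m \<ge> 2" "n \<ge> 2" unfolding m_def n_def by (rule bits_ge2)+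
  have le: "(2::rat) ^ m + 2 ^ n \<le> 2 ^ (m + n + 1)"
  proof -
    have "(2::rat) ^ m \<le> 2 ^ (m + n)" "(2::rat) ^ n \<le> 2 ^ (m + n)"
      by (rule power_increasing; simp)+
    then show ?thesis by (simp only: power_add power_one_right)
  qed
  have dd: "dnm p * dnm q \<le> 2 ^ (m + n)"
    using mult_mono[OF p(2) q(2)] dnm_pos[of q] by (simp add: power_add)
  have "bits (Num (p + q)) \<le> (m + n + 1) + 2 * (m + n) + 3"
    by (rule bits_Num_le) (use le p q dd dnm_add[of p q] abs_triangle_ineq[of p q] in linarith)+
  then show "bits (Num (p + q)) \<le> 4 * (m + n)" using mn by simp
  have "bits (Num (p - q)) \<le> (m + n + 1) + 2 * (m + n) + 3"
    by (rule bits_Num_le) (use le p q dd dnm_diff[of p q] abs_triangle_ineq4[of p q] in linarith)+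
  then show "bits (Num (p - q)) \<le> 4 * (m + n)" using mn by simp
  have "bits (Num (p * q)) \<le> (m + n) + 2 * (m + n) + 3"
  proof (rule bits_Num_le)
    show "\<bar>p * q\<bar> \<le> 2 ^ (m + n)" using mult_mono[OF p(1) q(1)] by (simp add: abs_mult power_add)
  qed (use dd dnm_mult[of p q] in linarith)
  then show "bits (Num (p * q)) \<le> 4 * (m + n)" using mn by simp
  show "bits (Num (p / q)) \<le> 4 * (m + n)"
  proof (cases "q = 0")
    case False
    define a where "a = fst (quotient_of q)"
    have qa: "q = of_int a / of_int (dnm q)" unfolding a_def by (rule quotient_of_eq)
    have a0: "a \<noteq> 0" using False qa by auto
    have "floorlog 2 (nat \<bar>a\<bar>) \<le> n" unfolding n_def a_def by (simp add: bits.simps)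
    then have "nat \<bar>a\<bar> < 2 ^ n" by (auto dest: floorlog_leD)
    then have an: "\<bar>a\<bar> \<le> 2 ^ n" by (simp add: nat_less_iff)
    have dq: "dnm q > 0" "dnm p > 0" by (rule dnm_pos)+
    \<comment> \<open>Inverting exchanges numerator and denominator; the sign has to move to the new
      numerator because denominators are positive.\<close>
    have inv: "1 / q = of_int (sgn a * dnm q) / of_int \<bar>a\<bar>"
    proof -
      obtain d where d: "d = dnm q" by blast
      have "1 / q = of_int (dnm q) / of_int a" using qa unfolding d[symmetric] by simp
      then show ?thesis using a0 by (cases "a > 0") (auto simp: sgn_if)
    qed
    have d1: "dnm (1 / q) \<le> 2 ^ n" using dnm_le[OF inv] a0 an by linarith
    have "\<bar>1 / q\<bar> \<le> 2 ^ n"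
    proof -
      have "\<bar>1 / q\<bar> = of_int (dnm q) / of_int \<bar>a\<bar>" using inv a0 dq by (simp add: abs_mult sgn_if)
      also have "\<dots> \<le> of_int (dnm q)" using a0 dq by (simp add: divide_le_eq mult_le_cancel_left1)
      also have "\<dots> \<le> of_int (2 ^ n)" using q(2) of_int_le_iff by blast
      finally show ?thesis by simp
    qed
    have "bits (Num (p * (1 / q))) \<le> (m + n) + 2 * (m + n) + 3"
    proof (rule bits_Num_le)
      show "\<bar>p * (1 / q)\<bar> \<le> 2 ^ (m + n)"
        using mult_mono[OF p(1) \<open>\<bar>1 / q\<bar> \<le> 2 ^ n\<close>] by (simp only: abs_mult power_add) simp
      have "dnm p * dnm (1 / q) \<le> 2 ^ m * 2 ^ n"
        using mult_mono[OF p(2) d1] dnm_pos[of "1 / q"] by simp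
      then show "dnm (p * (1 / q)) \<le> 2 ^ (m + n)" using dnm_mult[of p "1 / q"] by (simp add: power_add)
    qed
    then show ?thesis using mn by simp
  qed (use mn in simp)
  have "bits (Num (of_int \<lfloor>p\<rfloor>)) \<le> (m + 1) + 3"
  proof (rule bits_of_int_le)
    have "\<bar>(of_int \<lfloor>p\<rfloor> :: rat)\<bar> \<le> \<bar>p\<bar> + 1" by linarith
    also have "\<dots> \<le> 2 ^ m + 2 ^ m" using p one_le_power[of "2::rat" m] by linarith
    finally have "of_int \<bar>\<lfloor>p\<rfloor>\<bar> \<le> (of_int (2 ^ (m + 1)) :: rat)" by simp
    then show "\<bar>\<lfloor>p\<rfloor>\<bar> \<le> 2 ^ (m + 1)" using of_int_le_iff by blast
  qed
  then show "bits (Num (of_int \<lfloor>p\<rfloor>)) \<le> 4 * m" using mn by simp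
qed

section \<open>Linear bounds for the value and the cost of a fixed expression\<close>

fun val_factor :: "expr \<Rightarrow> nat" where
  "val_factor (Const q) = bits (Num q)"
| "val_factor (Reg n) = 1"
| "val_factor (Add a b) = 4 * (val_factor a + val_factor b)"
| "val_factor (Sub a b) = 4 * (val_factor a + val_factor b)"
| "val_factor (Mul a b) = 4 * (val_factor a + val_factor b)"
| "val_factor (Div a b) = 4 * (val_factor a + val_factor b)"
| "val_factor (Floor a) = 4 * val_factor a"
| "val_factor (Leq a b) = 3"
| "val_factor (MkPair a b) = 1 + val_factor a + val_factor b"
| "val_factor (Fst a) = val_factor a"
| "val_factor (Snd a) = val_factor a"
| "val_factor (IsPair a) = 3"

fun cost_factor :: "expr \<Rightarrow> nat" where
  "cost_factor (Const q) = bits (Num q)"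
| "cost_factor (Reg n) = 1"
| "cost_factor (Add a b) = 4 * (val_factor a + val_factor b) + cost_factor a + cost_factor b"
| "cost_factor (Sub a b) = 4 * (val_factor a + val_factor b) + cost_factor a + cost_factor b"
| "cost_factor (Mul a b) = 4 * (val_factor a + val_factor b) + cost_factor a + cost_factor b"
| "cost_factor (Div a b) = 4 * (val_factor a + val_factor b) + cost_factor a + cost_factor b"
| "cost_factor (Floor a) = 4 * val_factor a + cost_factor a"
| "cost_factor (Leq a b) = 3 + cost_factor a + cost_factor b"
| "cost_factor (MkPair a b) = 1 + val_factor a + val_factor b + cost_factor a + cost_factor b"
| "cost_factor (Fst a) = val_factor a + cost_factor a"
| "cost_factor (Snd a) = val_factor a + cost_factor a"
| "cost_factor (IsPair a) = 3 + cost_factor a"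

text \<open>The factor is exponential in the depth of the expression but independent of the store.
  It controls a single evaluation only: iterated in a loop it would compound, which is why each
  assignment in the verified programs carries its own bound on the bits of the new value.\<close>

lemma bits_denote_le:
  assumes b: "\<And>r. bits (s r) \<le> b"
  shows "bits (denote e s) \<le> val_factor e * b"
proof -
  have b2: "2 \<le> b" using b[of 0] bits_ge2[of "s 0"] by linarith
  have binop: "w \<le> 4 * (va + vb) * b"
    if "bits v1 \<le> va * b" "bits v2 \<le> vb * b"
      "w \<le> 4 * (bits (Num (num_of v1)) + bits (Num (num_of v2)))" for w v1 v2 va vb
  proof -
    have "bits (Num (num_of v1)) \<le> va * b" "bits (Num (num_of v2)) \<le> vb * b"
      using that(1,2) bits_num_of order.trans by blast+
    then have "w \<le> 4 * (va * b + vb * b)"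
      using that(3) by (meson add_mono mult_le_mono2 order.trans)
    then show ?thesis by (simp add: algebra_simps)
  qed
  show ?thesis
  proof (induction e)
    case (Const q) then show ?case using b2 by simp
  next
    case (Reg n) then show ?case using b by simp
  next
    case (Add e1 e2) then show ?case using binop bits_op(1) by simp
  next
    case (Sub e1 e2) then show ?case using binop bits_op(2) by simp
  next
    case (Mul e1 e2) then show ?case using binop bits_op(3) by simp
  next
    case (Div e1 e2) then show ?case using binop bits_op(4) by simp
  next
    case (Floor e)
    have "bits (denote (Floor e) s) \<le> 4 * bits (Num (num_of (denote e s)))"
      using bits_op(5) by simp
    also have "\<dots> \<le> 4 * (val_factor e * b)" using Floor bits_num_of[of "denote e s"] by linarith
    finally show ?case by simp
  next
    case (MkPair e1 e2)
    then show ?case using b2 by (simp add: algebra_simps)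
  next
    case (Fst e)
    then show ?case using bits_left_of[of "denote e s"] by simp
  next
    case (Snd e)
    then show ?case using bits_right_of[of "denote e s"] by simp
  qed (use b2 in \<open>auto split: val.splits\<close>)
qed

lemma expr_cost_le:
  assumes b: "\<And>r. bits (s r) \<le> b"
  shows "expr_cost e s \<le> cost_factor e * b"
proof (induction e)
  case (Const q)
  then show ?case using bits_denote_le[of s b "Const q", OF b] by simp
next
  case (Add e1 e2) then show ?case using bits_denote_le[of s b "Add e1 e2", OF b]
    by (simp add: algebra_simps del: denote.simps)
next
  case (Sub e1 e2) then show ?case using bits_denote_le[of s b "Sub e1 e2", OF b]
    by (simp add: algebra_simps del: denote.simps)
next
  case (Mul e1 e2) then show ?case using bits_denote_le[of s b "Mul e1 e2", OF b]
    by (simp add: algebra_simps del: denote.simps)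
next
  case (Div e1 e2) then show ?case using bits_denote_le[of s b "Div e1 e2", OF b]
    by (simp add: algebra_simps del: denote.simps)
next
  case (Floor e) then show ?case using bits_denote_le[of s b "Floor e", OF b]
    by (simp add: algebra_simps del: denote.simps)
next
  case (Leq e1 e2) then show ?case using bits_denote_le[of s b "Leq e1 e2", OF b]
    by (simp add: algebra_simps del: denote.simps)
next
  case (MkPair e1 e2) then show ?case using bits_denote_le[of s b "MkPair e1 e2", OF b]
    by (simp add: algebra_simps del: denote.simps)
next
  case (Fst e) then show ?case using bits_denote_le[of s b "Fst e", OF b]
    by (simp add: algebra_simps del: denote.simps)
next
  case (Snd e) then show ?case using bits_denote_le[of s b "Snd e", OF b]
    by (simp add: algebra_simps del: denote.simps)
next
  case (IsPair e) then show ?case using bits_denote_le[of s b "IsPair e", OF b]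
    by (simp add: algebra_simps del: denote.simps)
qed (use b in auto)

section \<open>Programs with bounded registers\<close>

text \<open>The language has no empty statement; a self-assignment stands for it.\<close>

fun block :: "prog list \<Rightarrow> prog" where
  "block [] = Assign 0 (Reg 0)"
| "block [c] = c"
| "block (c # c' # cs) = Seq c (block (c' # cs))"

text \<open>With \<open>Num 0\<close> as the end of the list, \<open>IsPair\<close> tests for
  nonemptiness. In contrast to \<open>list_val\<close>, entries may be arbitrary values.\<close>

definition enc :: "val list \<Rightarrow> val" where
  "enc xs = foldr Pair xs (Num 0)"

lemma enc_simps [simp]: "enc [] = Num 0" "enc (x # xs) = Pair x (enc xs)"
  by (simp_all add: enc_def)

lemma list_val_enc: "list_val xs = enc (map Num xs)"
  unfolding list_val_def enc_def by (induction xs) auto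

lemma bits_enc: "bits (enc xs) = 2 + (\<Sum>x\<leftarrow>xs. 1 + bits x)"
  by (induction xs) auto

lemma bits_enc_le:
  assumes "\<And>x. x \<in> set xs \<Longrightarrow> bits x \<le> k" "length xs \<le> n"
  shows "bits (enc xs) \<le> 2 + n * (1 + k)"
proof -
  have "(\<Sum>x\<leftarrow>xs. 1 + bits x) \<le> (\<Sum>x\<leftarrow>xs. 1 + k)"
    using assms(1) by (intro sum_list_mono) simp
  also have "\<dots> = length xs * (1 + k)" by (simp add: sum_list_triv)
  also have "\<dots> \<le> n * (1 + k)" using assms(2) by (rule mult_le_mono1)
  finally show ?thesis unfolding bits_enc by simp
qed

definition for_loop :: "nat \<Rightarrow> nat \<Rightarrow> prog \<Rightarrow> prog" where
  "for_loop r n c = Seq (Assign r (Const 1))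
     (Loop (Leq (Reg r) (Reg n)) (Seq c (Assign r (Add (Reg r) (Const 1)))))"

definition for_each :: "nat \<Rightarrow> nat \<Rightarrow> prog \<Rightarrow> prog" where
  "for_each p h c = Loop (IsPair (Reg p))
     (Seq (Assign h (Fst (Reg p))) (Seq (Assign p (Snd (Reg p))) c))"

text \<open>A loop that consumes one list and builds another at its head reverses the order; this
  restores it.\<close>

definition move :: "nat \<Rightarrow> nat \<Rightarrow> prog" where
  "move x y = Loop (IsPair (Reg x))
     (Seq (Assign y (MkPair (Fst (Reg x)) (Reg y))) (Assign x (Snd (Reg x))))"

text \<open>\<open>W c n Q s\<close> is a weakest precondition with a budget of \<open>n\<close> elementary steps, for runs that end
  with at most \<open>b\<close> bits in each register. The time \<open>ot\<close> bounds the oracle calls, and the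
  factor \<open>1000000\<close> exceeds the cost factor of every expression that is used.\<close>

locale meter =
  fixes ans :: "val \<Rightarrow> rat" and tm :: "val \<Rightarrow> nat" and b :: nat and ot :: nat
begin

definition fits :: "store \<Rightarrow> bool" where
  "fits s \<longleftrightarrow> (\<forall>r. bits (s r) \<le> b)"

text \<open>Every step is charged for an oracle call as well, so that one unit covers assignments,
  tests and calls alike.\<close>

definition unit_cost :: nat where
  "unit_cost = 1000000 * b + ot"

definition W :: "prog \<Rightarrow> nat \<Rightarrow> (store \<Rightarrow> bool) \<Rightarrow> store \<Rightarrow> bool" where
  "W c n Q s \<longleftrightarrow> (\<exists>t s'. exec ans tm c s t s' \<and> t \<le> n * unit_cost \<and> fits s' \<and> Q s')"

lemma fitsD: "fits s \<Longrightarrow> bits (s r) \<le> b"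
  by (simp add: fits_def)

lemma fits_upd: "fits s \<Longrightarrow> bits v \<le> b \<Longrightarrow> fits (s(x := v))"
  by (simp add: fits_def)

lemma step_cost:
  assumes "fits s" "cost_factor e + 1 \<le> 1000000"
  shows "1 + expr_cost e s + ot \<le> unit_cost"
proof -
  have "1 \<le> b" using fitsD[OF assms(1), of 0] bits_ge2[of "s 0"] by linarith
  then have "1 + expr_cost e s \<le> (cost_factor e + 1) * b"
    using expr_cost_le[of s b e] fitsD[OF assms(1)] by simp
  also have "\<dots> \<le> 1000000 * b" using assms(2) by (rule mult_le_mono1)
  finally show ?thesis by (simp add: unit_cost_def)
qed

lemma W_mono: "W c n Q s \<Longrightarrow> n \<le> m \<Longrightarrow> (\<And>s'. fits s' \<Longrightarrow> Q s' \<Longrightarrow> Q' s') \<Longrightarrow> W c m Q' s"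
  unfolding W_def by (meson mult_le_mono1 order.trans)

lemma W_weaken: "W c n Q s \<Longrightarrow> n \<le> m \<Longrightarrow> W c m Q s"
  by (rule W_mono)

lemma W_assign:
  assumes "fits s" "cost_factor e + 1 \<le> 1000000" "bits (denote e s) \<le> b"
    "fits (s(x := denote e s)) \<Longrightarrow> Q (s(x := denote e s))"
  shows "W (Assign x e) 1 Q s"
proof -
  have "fits (s(x := denote e s))" using assms by (intro fits_upd)
  then show ?thesis unfolding W_def using assms step_cost[OF assms(1,2)] exec_Assign
    by (metis add_leD1 mult_1)
qed

lemma W_ask:
  assumes "fits s" "cost_factor e + 1 \<le> 1000000" "bits (Num (ans (denote e s))) \<le> b"
    "tm (denote e s) \<le> ot"
    "fits (s(x := Num (ans (denote e s)))) \<Longrightarrow> Q (s(x := Num (ans (denote e s))))"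
  shows "W (Ask x e) 1 Q s"
proof -
  have "fits (s(x := Num (ans (denote e s))))" using assms by (intro fits_upd)
  moreover have "1 + expr_cost e s + tm (denote e s) \<le> 1 * unit_cost"
    using step_cost[OF assms(1,2)] assms(4) by simp
  ultimately show ?thesis unfolding W_def using assms(5) exec_Ask[of ans tm x e s] by blast
qed

lemma W_seq:
  assumes "W c1 n1 (W c2 n2 Q) s"
  shows "W (Seq c1 c2) (n1 + n2) Q s"
  using assms unfolding W_def by (auto simp: add_mult_distrib intro: add_mono exec_Seq)

lemma W_block:
  assumes "W c n1 (W (block (c' # cs)) n2 Q) s" "n = n1 + n2"
  shows "W (block (c # c' # cs)) n Q s"
  using W_seq[OF assms(1)] assms(2) by simp

lemma W_cond:
  assumes "fits s" "cost_factor e + 1 \<le> 1000000"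
    "denote e s \<noteq> Num 0 \<Longrightarrow> W c1 n Q s" "denote e s = Num 0 \<Longrightarrow> W c2 n Q s"
  shows "W (Cond e c1 c2) (1 + n) Q s"
proof (cases "denote e s = Num 0")
  case True
  then obtain t s' where "exec ans tm c2 s t s'" "t \<le> n * unit_cost" "fits s'" "Q s'"
    using assms(4) unfolding W_def by blast
  then show ?thesis using exec_CondF[OF True] step_cost[OF assms(1,2)] unfolding W_def
    by (metis add_leD1 add_mono add_mult_distrib mult_1)
next
  case False
  then obtain t s' where "exec ans tm c1 s t s'" "t \<le> n * unit_cost" "fits s'" "Q s'"
    using assms(3) unfolding W_def by blast
  then show ?thesis using exec_CondT[OF False] step_cost[OF assms(1,2)] unfolding W_def
    by (metis add_leD1 add_mono add_mult_distrib mult_1)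
qed

lemma W_assign_then:
  assumes "fits s" "cost_factor e + 1 \<le> 1000000" "denote e s = v" "bits v \<le> b"
    "fits (s(x := v)) \<Longrightarrow> W (block (c' # cs)) n Q (s(x := v))"
  shows "W (block (Assign x e # c' # cs)) (Suc n) Q s"
proof (rule W_block)
  show "W (Assign x e) 1 (W (block (c' # cs)) n Q) s"
    by (rule W_assign[OF assms(1,2)]) (use assms in auto)
qed simp

lemma W_assign_last:
  assumes "fits s" "cost_factor e + 1 \<le> 1000000" "denote e s = v" "bits v \<le> b"
    "fits (s(x := v)) \<Longrightarrow> Q (s(x := v))"
  shows "W (block [Assign x e]) 1 Q s"
  using W_assign[OF assms(1,2), of x Q] assms by simp

lemma W_assign':
  assumes "fits s" "cost_factor e + 1 \<le> 1000000" "denote e s = v" "bits v \<le> b"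
    "fits (s(x := v)) \<Longrightarrow> Q (s(x := v))"
  shows "W (Assign x e) 1 Q s"
  using W_assign[OF assms(1,2), of x Q] assms by simp

lemma W_chain:
  assumes "W c n1 P s" "\<And>s'. fits s' \<Longrightarrow> P s' \<Longrightarrow> W (block (c' # cs)) n2 Q s'"
  shows "W (block (c # c' # cs)) (n1 + n2) Q s"
  by (rule W_block[OF W_mono[OF assms(1) order.refl] refl]) (use assms(2) in auto)

text \<open>Indexing \<open>J\<close> by the number of iterations still to come proves termination
  together with the budget. The extra unit per iteration pays for the test, the final unit for the
  failing test.\<close>

lemma W_loop:
  assumes step: "\<And>k s. J (Suc k) s \<Longrightarrow> fits s \<Longrightarrow> denote e s \<noteq> Num 0 \<and> W c n (J k) s"
    and fin: "\<And>s. J 0 s \<Longrightarrow> fits s \<Longrightarrow> denote e s = Num 0 \<and> Q s"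
    and e: "cost_factor e + 1 \<le> 1000000"
  shows "J k s \<Longrightarrow> fits s \<Longrightarrow> W (Loop e c) (k * (n + 1) + 1) Q s"
proof (induction k arbitrary: s)
  case 0
  then show ?case using fin[OF 0] step_cost[OF 0(2) e] exec_LoopF[of e s ans tm c]
    unfolding W_def by (metis add_leD1 mult_0 add_0 mult_1)
next
  case (Suc k)
  obtain t1 s1 where 1: "exec ans tm c s t1 s1" "t1 \<le> n * unit_cost" "fits s1" "J k s1"
    using step[OF Suc(2,3)] unfolding W_def by blast
  obtain t2 s2 where 2: "exec ans tm (Loop e c) s1 t2 s2" "t2 \<le> (k * (n + 1) + 1) * unit_cost"
    "fits s2" "Q s2"
    using Suc(1)[OF 1(4,3)] unfolding W_def by blast
  have "exec ans tm (Loop e c) s (1 + expr_cost e s + t1 + t2) s2"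
    using exec_LoopT step[OF Suc(2,3)] 1(1) 2(1) by blast
  moreover have "1 + expr_cost e s + t1 + t2 \<le> (Suc k * (n + 1) + 1) * unit_cost"
  proof -
    have "1 + expr_cost e s + t1 + t2 \<le> unit_cost + n * unit_cost + (k * (n + 1) + 1) * unit_cost"
      using step_cost[OF Suc(3) e] 1(2) 2(2) by linarith
    also have "\<dots> = (Suc k * (n + 1) + 1) * unit_cost" by (simp add: algebra_simps)
    finally show ?thesis .
  qed
  ultimately show ?case using 2(3,4) unfolding W_def by blast
qed

text \<open>The counter is \<open>Suc m\<close> when \<open>m\<close> iterations are complete. The
  body has to establish \<open>J (Suc m)\<close> for the store with the counter already incremented,
  because \<open>J\<close> may constrain the counter. The margin 5 leaves room for the final counter
  \<open>Suc n\<close>.\<close>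

lemma W_for:
  assumes s: "fits s" and rn: "r \<noteq> nr" and nr: "s nr = nat_val n"
    and bn: "n + 5 \<le> b"
    and start: "fits (s(r := nat_val 1)) \<Longrightarrow> J 0 (s(r := nat_val 1))"
    and body: "\<And>m s. m < n \<Longrightarrow> fits s \<Longrightarrow> J m s \<Longrightarrow> s r = nat_val (Suc m) \<Longrightarrow> s nr = nat_val n \<Longrightarrow>
       W c k (\<lambda>s'. s' r = nat_val (Suc m) \<and> s' nr = nat_val n \<and>
          J (Suc m) (s'(r := nat_val (Suc (Suc m))))) s"
    and fin: "\<And>s. fits s \<Longrightarrow> J n s \<Longrightarrow> s r = nat_val (Suc n) \<Longrightarrow> Q s"
  shows "W (for_loop r nr c) (n * (k + 2) + 2) Q s"
proof -
  have bv: "bits (nat_val m) \<le> b" if "m \<le> n + 2" for m using bits_nat_val[of m] that bn by linarith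
  define I where "I = (\<lambda>j s. \<exists>m. j + m = n \<and> J m s \<and> s r = nat_val (Suc m) \<and> s nr = nat_val n)"
  have loop: "W (Loop (Leq (Reg r) (Reg nr)) (Seq c (Assign r (Add (Reg r) (Const 1)))))
     (n * ((k + 1) + 1) + 1) Q s'" if "I n s'" "fits s'" for s'
  proof (rule W_loop[where J = I, OF _ _ _ that])
    fix j s assume "I (Suc j) s" and f: "fits s"
    then obtain m where m: "Suc j + m = n" "J m s" "s r = nat_val (Suc m)" "s nr = nat_val n"
      unfolding I_def by blast
    have "W c k (W (Assign r (Add (Reg r) (Const 1))) 1 (I j)) s"
    proof (rule W_mono[OF body[OF _ f m(2,3,4)] order.refl])
      show "m < n" using m by simp
      fix s' assume f': "fits s'"
        and *: "s' r = nat_val (Suc m) \<and> s' nr = nat_val n \<and> J (Suc m) (s'(r := nat_val (Suc (Suc m))))"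
      have d: "denote (Add (Reg r) (Const 1)) s' = nat_val (Suc (Suc m))" using * by simp
      show "W (Assign r (Add (Reg r) (Const 1))) 1 (I j) s'"
      proof (rule W_assign[OF f'])
        show "I j (s'(r := denote (Add (Reg r) (Const 1)) s'))"
          unfolding d I_def using * m(1) rn by (intro exI[of _ "Suc m"]) (simp del: of_nat_Suc)
      qed (use bv[of "Suc (Suc m)"] m(1) in \<open>simp_all only: d\<close>, simp_all)
    qed
    moreover have "denote (Leq (Reg r) (Reg nr)) s \<noteq> Num 0" using m by simp
    ultimately show "denote (Leq (Reg r) (Reg nr)) s \<noteq> Num 0 \<and>
        W (Seq c (Assign r (Add (Reg r) (Const 1)))) (k + 1) (I j) s"
      using W_seq by blast
  next
    fix s assume "I 0 s" "fits s"
    then show "denote (Leq (Reg r) (Reg nr)) s = Num 0 \<and> Q s"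
      unfolding I_def using fin by auto
  qed simp
  have "W (for_loop r nr c) (1 + (n * ((k + 1) + 1) + 1)) Q s"
    unfolding for_loop_def
  proof (rule W_seq, rule W_assign[OF s])
    assume "fits (s(r := denote (Const 1) s))"
    then show "W (Loop (Leq (Reg r) (Reg nr)) (Seq c (Assign r (Add (Reg r) (Const 1)))))
     (n * ((k + 1) + 1) + 1) Q (s(r := denote (Const 1) s))"
      using loop start nr rn unfolding I_def by simp
  qed (use bv[of 1] bn in simp_all)
  then show ?thesis by simp
qed

lemma W_for_each:
  assumes s: "fits s" and p: "s p = enc xs" and hp: "h \<noteq> p"
    and start: "J 0 s"
    and body: "\<And>m s. m < length xs \<Longrightarrow> fits s \<Longrightarrow> J m s \<Longrightarrow> s p = enc (drop m xs) \<Longrightarrow>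
       fits (s(h := xs ! m, p := enc (drop (Suc m) xs))) \<Longrightarrow>
       W c k (\<lambda>s'. s' p = enc (drop (Suc m) xs) \<and> J (Suc m) s')
         (s(h := xs ! m, p := enc (drop (Suc m) xs)))"
    and fin: "\<And>s. fits s \<Longrightarrow> J (length xs) s \<Longrightarrow> s p = Num 0 \<Longrightarrow> Q s"
  shows "W (for_each p h c) (length xs * (k + 3) + 1) Q s"
proof -
  define I where "I = (\<lambda>j s. \<exists>m. j + m = length xs \<and> J m s \<and> s p = enc (drop m xs))"
  have "W (for_each p h c) (length xs * ((1 + (1 + k)) + 1) + 1) Q s"
    unfolding for_each_def
  proof (rule W_loop[where J = I])
    fix j s assume "I (Suc j) s" and f: "fits s"
    then obtain m where m: "Suc j + m = length xs" "J m s" "s p = enc (drop m xs)"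
      unfolding I_def by blast
    have "drop m xs = xs ! m # drop (Suc m) xs" using m(1) by (simp add: Cons_nth_drop_Suc)
    then have sp: "s p = Pair (xs ! m) (enc (drop (Suc m) xs))" using m(3) by simp
    then have le: "bits (xs ! m) \<le> b" "bits (enc (drop (Suc m) xs)) \<le> b"
      using fitsD[OF f, of p] by simp_all
    have "W (Seq (Assign h (Fst (Reg p))) (Seq (Assign p (Snd (Reg p))) c)) (1 + (1 + k)) (I j) s"
    proof (rule W_seq, rule W_assign[OF f])
      assume f1: "fits (s(h := denote (Fst (Reg p)) s))"
      show "W (Seq (Assign p (Snd (Reg p))) c) (1 + k) (I j) (s(h := denote (Fst (Reg p)) s))"
      proof (rule W_seq, rule W_assign[OF f1])
        have e: "s(h := denote (Fst (Reg p)) s,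
            p := denote (Snd (Reg p)) (s(h := denote (Fst (Reg p)) s))) =
            s(h := xs ! m, p := enc (drop (Suc m) xs))"
          using sp hp by simp
        assume "fits (s(h := denote (Fst (Reg p)) s,
            p := denote (Snd (Reg p)) (s(h := denote (Fst (Reg p)) s))))"
        then have "W c k (\<lambda>s'. s' p = enc (drop (Suc m) xs) \<and> J (Suc m) s')
            (s(h := xs ! m, p := enc (drop (Suc m) xs)))"
          unfolding e using body[OF _ f m(2,3)] m(1) by simp
        then show "W c k (I j) (s(h := denote (Fst (Reg p)) s,
            p := denote (Snd (Reg p)) (s(h := denote (Fst (Reg p)) s))))"
          unfolding e by (rule W_mono) (use m(1) in \<open>auto simp: I_def intro!: exI[of _ "Suc m"]\<close>)
      qed (use sp hp le in simp_all)
    qed (use sp le in simp_all)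
    then show "denote (IsPair (Reg p)) s \<noteq> Num 0 \<and>
      W (Seq (Assign h (Fst (Reg p))) (Seq (Assign p (Snd (Reg p))) c)) (1 + (1 + k)) (I j) s"
      using sp by simp
  next
    fix s assume "I 0 s" "fits s"
    then show "denote (IsPair (Reg p)) s = Num 0 \<and> Q s"
      unfolding I_def using fin by auto
  qed (use s p start in \<open>auto simp: I_def\<close>)
  then show ?thesis by (rule W_weaken) (simp add: algebra_simps)
qed

lemma W_move:
  assumes s: "fits s" and x: "s x = enc xs" and y: "s y = enc ys" and xy: "x \<noteq> y"
    and le: "bits (enc (rev xs @ ys)) \<le> b"
    and Q: "fits (s(x := Num 0, y := enc (rev xs @ ys))) \<Longrightarrow> Q (s(x := Num 0, y := enc (rev xs @ ys)))"
  shows "W (move x y) (3 * length xs + 1) Q s"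
proof -
  define I where "I = (\<lambda>j s'. \<exists>m. j + m = length xs \<and>
    s' = s(x := enc (drop m xs), y := enc (rev (take m xs) @ ys)))"
  \<comment> \<open>Every intermediate list is a final segment of the finished one, so the bound on
    the latter suffices.\<close>
  have bl: "bits (enc (rev (take m xs) @ ys)) \<le> b" for m
  proof -
    have "bits (enc (rev xs @ ys)) = bits (enc (rev (take m xs) @ ys)) + (\<Sum>v\<leftarrow>rev (drop m xs). 1 + bits v)"
      unfolding bits_enc by (subst append_take_drop_id[symmetric, of xs m])
        (simp only: rev_append map_append sum_list_append append_assoc)
    then show ?thesis using le by simp
  qed
  have "W (move x y) (length xs * ((1 + 1) + 1) + 1) Q s"
    unfolding move_def
  proof (rule W_loop[where J = I])
    fix j s' assume "I (Suc j) s'" and f: "fits s'"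
    then obtain m where m: "Suc j + m = length xs"
      "s' = s(x := enc (drop m xs), y := enc (rev (take m xs) @ ys))"
      unfolding I_def by blast
    have dr: "drop m xs = xs ! m # drop (Suc m) xs" using m(1) by (simp add: Cons_nth_drop_Suc)
    have tk: "take (Suc m) xs = take m xs @ [xs ! m]" using m(1) by (simp add: take_Suc_conv_app_nth)
    have s'x: "s' x = Pair (xs ! m) (enc (drop (Suc m) xs))" using m(2) dr xy by simp
    have s'y: "s' y = enc (rev (take m xs) @ ys)" using m(2) by simp
    have d: "denote (MkPair (Fst (Reg x)) (Reg y)) s' = enc (rev (take (Suc m) xs) @ ys)"
      using s'x s'y tk by simp
    have "W (Seq (Assign y (MkPair (Fst (Reg x)) (Reg y))) (Assign x (Snd (Reg x)))) (1 + 1) (I j) s'"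
    proof (rule W_seq, rule W_assign[OF f])
      assume f1: "fits (s'(y := denote (MkPair (Fst (Reg x)) (Reg y)) s'))"
      have "s'(y := enc (rev (take (Suc m) xs) @ ys), x := enc (drop (Suc m) xs)) =
        s(x := enc (drop (Suc m) xs), y := enc (rev (take (Suc m) xs) @ ys))"
        using m(2) xy by (auto simp: fun_upd_def)
      then have "I j (s'(y := enc (rev (take (Suc m) xs) @ ys), x := enc (drop (Suc m) xs)))"
        unfolding I_def using m(1) by (intro exI[of _ "Suc m"]) simp
      moreover have "bits (enc (drop (Suc m) xs)) \<le> b" using fitsD[OF f, of x] s'x by simp
      ultimately show "W (Assign x (Snd (Reg x))) 1 (I j) (s'(y := denote (MkPair (Fst (Reg x)) (Reg y)) s'))"
        unfolding d using f1 unfolding d by (intro W_assign) (use s'x xy in simp_all)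
    next
      show "bits (denote (MkPair (Fst (Reg x)) (Reg y)) s') \<le> b" unfolding d by (rule bl)
    qed simp
    then show "denote (IsPair (Reg x)) s' \<noteq> Num 0 \<and>
       W (Seq (Assign y (MkPair (Fst (Reg x)) (Reg y))) (Assign x (Snd (Reg x)))) (1 + 1) (I j) s'"
      using s'x by simp
  next
    fix s' assume "I 0 s'" "fits s'"
    then show "denote (IsPair (Reg x)) s' = Num 0 \<and> Q s'"
      unfolding I_def using Q xy by auto
  next
    show "I (length xs) s" unfolding I_def using x y by (intro exI[of _ 0]) auto
  qed (use s in simp_all)
  then show ?thesis by (rule W_weaken) simp
qed

end

section \<open>Evaluation with absolute error\<close>

text \<open>The number of iterations of a doubling loop that starts at 1 and stops above the
  absolute value; the bit length of \<open>q\<close> bounds it.\<close>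

definition log_ceil :: "rat \<Rightarrow> nat" where
  "log_ceil q = (LEAST m. \<bar>q\<bar> \<le> 2 ^ m)"

lemma ex_pow2_ge: "\<exists>m. \<bar>q :: rat\<bar> \<le> 2 ^ m"
  using bits_NumD(1) order_refl by blast

lemma log_ceil: "\<bar>q\<bar> \<le> 2 ^ log_ceil q"
  unfolding log_ceil_def using ex_pow2_ge by (rule LeastI_ex)

lemma log_ceil_le: "\<bar>q\<bar> \<le> 2 ^ m \<Longrightarrow> log_ceil q \<le> m"
  unfolding log_ceil_def by (rule Least_le)

lemma less_log_ceil: "m < log_ceil q \<Longrightarrow> 2 ^ m < \<bar>q\<bar>"
  using log_ceil_le leI by (metis not_less)

text \<open>A query with relative error \<open>1 / 2\<close> yields \<open>m\<close> such that the value is at most \<open>2 ^ (m + 1)\<close>, and a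
  second query with \<open>n + m + 1\<close> then has absolute error \<open>1 / 2 ^ n\<close>. Registers: 5 source, 6 point,
  7 \<open>n\<close>, 8 answer; 9 to 11 are auxiliary.\<close>

definition eval_prog :: prog where
  "eval_prog = block
    [Ask 8 (MkPair (Reg 5) (MkPair (Reg 6) (Const 1))),
     Cond (Leq (Const 0) (Reg 8)) (Assign 11 (Reg 8)) (Assign 11 (Sub (Const 0) (Reg 8))),
     Assign 9 (Const 1),
     Assign 10 (Add (Reg 7) (Const 1)),
     Loop (Sub (Const 1) (Leq (Reg 11) (Reg 9)))
       (Seq (Assign 9 (Add (Reg 9) (Reg 9))) (Assign 10 (Add (Reg 10) (Const 1)))),
     Ask 8 (MkPair (Reg 5) (MkPair (Reg 6) (Reg 10)))]"

lemma bits_uminus: "bits (Num (- q)) = bits (Num q)"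
  by (simp add: bits.simps rat_uminus_code Let_def split: prod.splits)

definition eval_abs :: "(val \<Rightarrow> rat) \<Rightarrow> source \<Rightarrow> rat list \<Rightarrow> nat \<Rightarrow> rat" where
  "eval_abs ans h xs n = ans (query h xs (n + log_ceil (ans (query h xs 1)) + 1))"

lemma abs_of_rat_le: "\<bar>q\<bar> \<le> 2 ^ m \<Longrightarrow> \<bar>of_rat q :: real\<bar> \<le> 2 ^ m"
proof -
  assume "\<bar>q\<bar> \<le> 2 ^ m"
  then have "(of_rat q :: real) \<le> of_rat (2 ^ m)" "(of_rat (- q) :: real) \<le> of_rat (2 ^ m)"
    unfolding of_rat_less_eq by auto
  then show ?thesis by (simp only: of_rat_power of_rat_minus of_rat_numeral_eq abs_le_iff)
qed

lemma eval_abs_error: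
  assumes "poly_time_oracle ans tm T d h D v" "xs \<in> D"
  shows "\<bar>of_rat (eval_abs ans h xs n) - v xs\<bar> \<le> 1 / 2 ^ n"
proof -
  define q where "q = ans (query h xs 1)"
  have 1: "\<bar>of_rat q - v xs\<bar> \<le> \<bar>v xs\<bar> / 2 ^ 1"
    using assms unfolding poly_time_oracle_def q_def by blast
  have "\<bar>of_rat q :: real\<bar> \<le> 2 ^ log_ceil q"
    using log_ceil[of q] by (rule abs_of_rat_le)
  then have v: "\<bar>v xs\<bar> \<le> 2 ^ (log_ceil q + 1)"
    using 1 unfolding power_add power_one_right by linarith
  have "\<bar>of_rat (eval_abs ans h xs n) - v xs\<bar> \<le> \<bar>v xs\<bar> / 2 ^ (n + log_ceil q + 1)"
    using assms unfolding poly_time_oracle_def eval_abs_def q_def by blast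
  also have "\<dots> \<le> 2 ^ (log_ceil q + 1) / 2 ^ (n + log_ceil q + 1)"
    using v by (intro divide_right_mono) auto
  also have "\<dots> = 1 / 2 ^ n" by (simp add: power_add field_simps)
  finally show ?thesis .
qed

lemma eval_abs_exact:
  assumes "poly_time_oracle ans tm T d h D v" "xs \<in> D" "\<forall>xs\<in>D. v xs \<in> \<rat>"
  shows "of_rat (eval_abs ans h xs n) = v xs"
  using assms unfolding poly_time_oracle_def eval_abs_def by blast

text \<open>\<open>pb\<close> bounds the bits of the points and \<open>pr\<close> the requested
  precision. The precision of the second query contains the size of the first answer, so
  \<open>first\<close> has to be fixed before \<open>ot\<close>. The offset 4 covers
  \<open>1 + n\<close> for every \<open>n\<close> up to \<open>pr + first + 3\<close>.\<close>

locale oracle_meter = meter ans tm b ot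
  for ans :: "val \<Rightarrow> rat" and tm :: "val \<Rightarrow> nat" and b :: nat and ot :: nat +
  fixes T d pb pr first :: nat
  assumes first: "T * (2 + pb) ^ d \<le> first"
    and ot: "T * (4 + pr + first + pb) ^ d \<le> ot"
    and b_ge: "first + ot + pr + 10 \<le> b"
begin

lemma query_bounds:
  assumes "poly_time_oracle ans tm T d h D v" "xs \<in> D" "bits (list_val xs) \<le> pb"
  shows "n \<le> pr + first + 3 \<Longrightarrow> tm (query h xs n) \<le> ot"
    and "n \<le> pr + first + 3 \<Longrightarrow> bits (Num (ans (query h xs n))) \<le> ot"
    and "bits (Num (ans (query h xs 1))) \<le> first"
proof -
  have *: "bits (Num (ans (query h xs n))) \<le> tm (query h xs n)"
    "tm (query h xs n) \<le> T * (1 + n + bits (list_val xs)) ^ d" for n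
    using assms unfolding poly_time_oracle_def by blast+
  have "bits (Num (ans (query h xs 1))) \<le> T * (1 + 1 + bits (list_val xs)) ^ d"
    using * order.trans by blast
  also have "\<dots> \<le> T * (2 + pb) ^ d" using assms(3) by (intro mult_le_mono2 power_mono) auto
  finally show "bits (Num (ans (query h xs 1))) \<le> first" using first by linarith
  assume n: "n \<le> pr + first + 3"
  have "T * (1 + n + bits (list_val xs)) ^ d \<le> T * (4 + pr + first + pb) ^ d"
    using assms(3) n by (intro mult_le_mono2 power_mono) auto
  then show "tm (query h xs n) \<le> ot" using *(2)[of n] ot by linarith
  then show "bits (Num (ans (query h xs n))) \<le> ot" using *(1)[of n] by linarith
qed

lemma log_ceil_first:
  assumes "poly_time_oracle ans tm T d h D v" "xs \<in> D" "bits (list_val xs) \<le> pb"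
  shows "log_ceil (ans (query h xs 1)) \<le> first"
  using log_ceil_le[OF bits_NumD(1)] query_bounds(3)[OF assms] by simp

lemma bits_eval_abs:
  assumes "poly_time_oracle ans tm T d h D v" "xs \<in> D" "bits (list_val xs) \<le> pb" "n \<le> pr"
  shows "bits (Num (eval_abs ans h xs n)) \<le> ot"
  unfolding eval_abs_def using query_bounds(2)[OF assms(1-3)] log_ceil_first[OF assms(1-3)] assms(4)
  by simp

lemma W_eval:
  assumes s: "fits s" and o: "poly_time_oracle ans tm T d h D v" "xs \<in> D" "bits (list_val xs) \<le> pb"
    and r: "s 5 = source_val h" "s 6 = list_val xs" "s 7 = nat_val n" "n \<le> pr"
    and Q: "\<And>s'. fits s' \<Longrightarrow> s' 8 = Num (eval_abs ans h xs n) \<Longrightarrow> \<forall>x. x \<notin> {8,9,10,11} \<longrightarrow> s' x = s x \<Longrightarrow> Q s'"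
  shows "W eval_prog (3 * first + 8) Q s"
proof -
  define q where "q = ans (query h xs 1)"
  have q: "bits (Num q) \<le> first" unfolding q_def using query_bounds(3)[OF o] .
  have lq: "log_ceil q \<le> first" unfolding q_def using log_ceil_first[OF o] .
  have d1: "denote (MkPair (Reg 5) (MkPair (Reg 6) (Const 1))) s = query h xs 1"
    using r by (simp add: query_def)
  define s1 where "s1 = s(8 := Num q)"
  define s2 where "s2 = s1(11 := Num \<bar>q\<bar>)"
  define s3 where "s3 = s2(9 := Num 1)"
  \<comment> \<open>The store after \<open>m\<close> doublings; after the last one, register 10
    holds the precision of the second query.\<close>
  define st where "st m = s3(9 := Num (2 ^ m), 10 := nat_val (n + m + 1))" for m
  have f1: "fits s1" unfolding s1_def using s q b_ge by (intro fits_upd) auto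
  have ba: "bits (Num \<bar>q\<bar>) \<le> b" using q b_ge bits_uminus[of q] by (simp add: abs_if)
  then have f2: "fits s2" unfolding s2_def using f1 by (intro fits_upd)
  then have f3: "fits s3" unfolding s3_def using b_ge by (intro fits_upd) auto
  have bp: "bits (Num (2 ^ m)) \<le> b" if "m \<le> first + 1" for m
    using bits_of_int_le[of "2 ^ m" m] that b_ge by simp
  have bn: "bits (nat_val (n + m + 1)) \<le> b" if "m \<le> first + 1" for m
    using bits_nat_val[of "n + m + 1"] that b_ge r(4) by linarith
  have fst: "fits (st m)" if "m \<le> first + 1" for m
    unfolding st_def using f3 bp[OF that] bn[OF that] by (intro fits_upd)
  have len: "n + log_ceil q + 1 \<le> pr + first + 3" using r(4) lq by linarith
  have lst: "W (Ask 8 (MkPair (Reg 5) (MkPair (Reg 6) (Reg 10)))) 1 Q (st (log_ceil q))"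
  proof -
    have d: "denote (MkPair (Reg 5) (MkPair (Reg 6) (Reg 10))) (st (log_ceil q)) =
        query h xs (n + log_ceil q + 1)"
      using r by (simp add: query_def st_def s3_def s2_def s1_def)
    show ?thesis
    proof (rule W_ask)
      assume "fits ((st (log_ceil q))(8 := Num (ans (denote (MkPair (Reg 5) (MkPair (Reg 6) (Reg 10))) (st (log_ceil q))))))"
      then show "Q ((st (log_ceil q))(8 := Num (ans (denote (MkPair (Reg 5) (MkPair (Reg 6) (Reg 10))) (st (log_ceil q))))))"
        unfolding d by (rule Q) (auto simp: eval_abs_def q_def st_def s3_def s2_def s1_def)
    qed (use d query_bounds(1,2)[OF o len] b_ge fst lq in auto)
  qed
  have lp: "W (Loop (Sub (Const 1) (Leq (Reg 11) (Reg 9)))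
       (Seq (Assign 9 (Add (Reg 9) (Reg 9))) (Assign 10 (Add (Reg 10) (Const 1)))))
     (log_ceil q * (2 + 1) + 1)
     (W (Ask 8 (MkPair (Reg 5) (MkPair (Reg 6) (Reg 10)))) 1 Q) (st 0)"
  proof (rule W_loop[where J = "\<lambda>j s'. \<exists>m. j + m = log_ceil q \<and> s' = st m"])
    fix j s' assume "\<exists>m. Suc j + m = log_ceil q \<and> s' = st m" and f: "fits s'"
    then obtain m where m: "Suc j + m = log_ceil q" and s': "s' = st m" by blast
    have c: "denote (Sub (Const 1) (Leq (Reg 11) (Reg 9))) s' \<noteq> Num 0"
      using less_log_ceil[of m q] m unfolding s' st_def s3_def s2_def by simp
    have d: "denote (Add (Reg 9) (Reg 9)) s' = Num (2 ^ Suc m)" unfolding s' st_def by simp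
    have "W (Seq (Assign 9 (Add (Reg 9) (Reg 9))) (Assign 10 (Add (Reg 10) (Const 1)))) (1 + 1)
       (\<lambda>s'. \<exists>m. j + m = log_ceil q \<and> s' = st m) s'"
    proof (rule W_seq, rule W_assign[OF f])
      assume f': "fits (s'(9 := denote (Add (Reg 9) (Reg 9)) s'))"
      have d2: "denote (Add (Reg 10) (Const 1)) (s'(9 := denote (Add (Reg 9) (Reg 9)) s')) =
         nat_val (n + Suc m + 1)"
        unfolding s' st_def by simp
      show "W (Assign 10 (Add (Reg 10) (Const 1))) 1
       (\<lambda>s'. \<exists>m. j + m = log_ceil q \<and> s' = st m) (s'(9 := denote (Add (Reg 9) (Reg 9)) s'))"
      proof (rule W_assign[OF f'])
        show "bits (denote (Add (Reg 10) (Const 1)) (s'(9 := denote (Add (Reg 9) (Reg 9)) s'))) \<le> b"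
          unfolding d2 by (rule bn) (use m lq in simp)
        show "\<exists>m. j + m = log_ceil q \<and>
         s'(9 := denote (Add (Reg 9) (Reg 9)) s',
            10 := denote (Add (Reg 10) (Const 1)) (s'(9 := denote (Add (Reg 9) (Reg 9)) s'))) = st m"
          unfolding d2 unfolding d unfolding s' st_def using m
          by (intro exI[of _ "Suc m"]) (auto simp: fun_eq_iff)
      qed simp
    next
      show "bits (denote (Add (Reg 9) (Reg 9)) s') \<le> b"
        unfolding d by (rule bp) (use m lq in simp)
    qed simp
    then show "denote (Sub (Const 1) (Leq (Reg 11) (Reg 9))) s' \<noteq> Num 0 \<and>
      W (Seq (Assign 9 (Add (Reg 9) (Reg 9))) (Assign 10 (Add (Reg 10) (Const 1)))) 2
       (\<lambda>s'. \<exists>m. j + m = log_ceil q \<and> s' = st m) s'"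
      using c unfolding one_add_one by blast
  next
    fix s' assume "\<exists>m. 0 + m = log_ceil q \<and> s' = st m"
    then have s': "s' = st (log_ceil q)" by simp
    show "denote (Sub (Const 1) (Leq (Reg 11) (Reg 9))) s' = Num 0 \<and>
      W (Ask 8 (MkPair (Reg 5) (MkPair (Reg 6) (Reg 10)))) 1 Q s'"
      using lst log_ceil[of q] unfolding s' by (simp add: st_def s3_def s2_def)
  qed (use fst[of 0] in auto)
  have upd: "W (Cond (Leq (Const 0) (Reg 8)) (Assign 11 (Reg 8)) (Assign 11 (Sub (Const 0) (Reg 8)))) (1 + 1)
     (\<lambda>s'. s' = s2) s1"
  proof (rule W_cond[OF f1])
    assume "denote (Leq (Const 0) (Reg 8)) s1 \<noteq> Num 0"
    then have d: "denote (Reg 8) s1 = Num \<bar>q\<bar>" by (simp add: s1_def split: if_splits)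
    show "W (Assign 11 (Reg 8)) 1 (\<lambda>s'. s' = s2) s1"
      by (rule W_assign'[OF f1 _ d ba]) (simp_all add: s2_def)
  next
    assume "denote (Leq (Const 0) (Reg 8)) s1 = Num 0"
    then have d: "denote (Sub (Const 0) (Reg 8)) s1 = Num \<bar>q\<bar>" by (simp add: s1_def split: if_splits)
    show "W (Assign 11 (Sub (Const 0) (Reg 8))) 1 (\<lambda>s'. s' = s2) s1"
      by (rule W_assign'[OF f1 _ d ba]) (simp_all add: s2_def)
  qed simp
  have st0: "s2(9 := Num 1, 10 := nat_val (n + 0 + 1)) = st 0"
    by (auto simp: st_def s3_def fun_eq_iff)
  have qo: "bits (Num (ans (query h xs 1))) \<le> b" "tm (query h xs 1) \<le> ot"
    using query_bounds(1)[OF o, of 1] q b_ge by (simp_all add: q_def)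
  show ?thesis unfolding eval_prog_def
    apply (rule W_weaken)
     apply (rule W_block[OF _ refl])
     apply (rule W_ask[OF s])
        apply simp
       apply (simp only: d1 qo)
      apply (simp only: d1 qo)
     apply (simp only: d1 flip: q_def s1_def)
     apply (rule W_chain[OF upd])
     apply (simp only:)
     apply (rule W_assign_then[where v = "Num 1"])
         apply assumption
        apply simp
       apply simp
      using b_ge apply simp
     apply (rule W_assign_then[where v = "nat_val (n + 0 + 1)"])
         apply assumption
        apply simp
       using r apply (simp add: s2_def s1_def)
      apply (rule bn) apply simp
     apply (simp only: st0)
     apply (rule W_block[OF _ refl])
     apply (simp only: block.simps(2))
     apply (rule lp)
    using lq apply simp
    done
qed

end

section \<open>Submodular minimization on a grid\<close>

definition clip :: "int \<Rightarrow> int \<Rightarrow> int" where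
  "clip b z = max 0 (min b z)"

lemma clip_bounds: "0 \<le> b \<Longrightarrow> 0 \<le> clip b z" "0 \<le> b \<Longrightarrow> clip b z \<le> b"
  by (auto simp: clip_def)

lemma square_mono_abs: "\<bar>x\<bar> \<le> \<bar>y\<bar> \<Longrightarrow> x\<^sup>2 \<le> (y :: int)\<^sup>2"
  using abs_le_square_iff by blast

text \<open>Projection onto an interval does not increase the distance to its points; this is the
  one-step inequality of projected gradient descent.\<close>

lemma clip_closer:
  assumes "0 \<le> c" "c \<le> b"
  shows "(clip b (z - w) - c)\<^sup>2 \<le> (z - c)\<^sup>2 - 2 * w * (z - c) + w\<^sup>2"
proof -
  have "\<bar>clip b (z - w) - c\<bar> \<le> \<bar>z - w - c\<bar>" using assms by (auto simp: clip_def)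
  then have "(clip b (z - w) - c)\<^sup>2 \<le> (z - w - c)\<^sup>2" by (rule square_mono_abs)
  then show ?thesis by (simp add: power2_eq_square algebra_simps)
qed

section \<open>Sorting and the distance to vectors that fill chains from the start\<close>

definition insert_desc :: "nat \<times> int \<Rightarrow> (nat \<times> int) list \<Rightarrow> (nat \<times> int) list" where
  "insert_desc e l = takeWhile (\<lambda>f. snd e < snd f) l @ e # dropWhile (\<lambda>f. snd e < snd f) l"

text \<open>Insertion sort, because an insertion is a chain of exchanges of neighbours, across which
  distances are easy to compare, and because a program can carry it out with two stacks.\<close>

definition sort_desc :: "(nat \<times> int) list \<Rightarrow> (nat \<times> int) list" where
  "sort_desc l = foldr insert_desc l []"

lemma insert_desc_simps:
  "insert_desc e [] = [e]"
  "insert_desc e (f # l) = (if snd e < snd f then f # insert_desc e l else e # f # l)"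
  by (simp_all add: insert_desc_def)

lemma sort_desc_simps [simp]:
  "sort_desc [] = []" "sort_desc (e # l) = insert_desc e (sort_desc l)"
  by (simp_all add: sort_desc_def)

lemma mset_insert_desc [simp]: "mset (insert_desc e l) = add_mset e (mset l)"
  by (induction l) (auto simp: insert_desc_simps)

lemma mset_sort_desc [simp]: "mset (sort_desc l) = mset l"
  by (induction l) auto

abbreviation descending :: "(nat \<times> int) list \<Rightarrow> bool" where
  "descending l \<equiv> sorted_wrt (\<lambda>e f. snd f \<le> snd e) l"

lemma set_insert_desc [simp]: "set (insert_desc e l) = insert e (set l)"
  by (metis mset_insert_desc set_mset_add_mset_insert set_mset_mset)

lemma descending_insert_desc: "descending l \<Longrightarrow> descending (insert_desc e l)"
proof (induction l)
  case (Cons f l)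
  then show ?case by (auto simp: insert_desc_simps)
qed (simp add: insert_desc_simps)

lemma descending_sort_desc: "descending (sort_desc l)"
  by (induction l) (auto intro: descending_insert_desc)

abbreviation count_fst :: "(nat \<times> int) list \<Rightarrow> nat \<Rightarrow> nat" where
  "count_fst l i \<equiv> count_list (map fst l) i"

text \<open>The squared distance to the vector that is \<open>b\<close> on the first \<open>c i\<close> entries labelled \<open>i\<close> and \<open>0\<close> on
  the others. This vector depends on the order of the list, which is why sorting helps.\<close>

definition quota_dist :: "int \<Rightarrow> (nat \<Rightarrow> nat) \<Rightarrow> (nat \<times> int) list \<Rightarrow> int" where
  "quota_dist b c l = (\<Sum>m<length l.
     (snd (l ! m) - (if count_fst (take m l) (fst (l ! m)) < c (fst (l ! m)) then b else 0))\<^sup>2)"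

lemma quota_dist_Nil [simp]: "quota_dist b c [] = 0"
  by (simp add: quota_dist_def)

text \<open>Passing the head uses up one unit of the quota of its label; truncated subtraction keeps
  an exhausted quota at 0.\<close>

lemma quota_dist_Cons:
  "quota_dist b c ((i, z) # l) =
     (z - (if 0 < c i then b else 0))\<^sup>2 + quota_dist b (c(i := c i - 1)) l"
proof -
  have "count_fst (take (Suc m) ((i, z) # l)) j < c j \<longleftrightarrow> count_fst (take m l) j < (c(i := c i - 1)) j"
    for m j by auto
  then show ?thesis
    unfolding quota_dist_def by (simp add: sum.lessThan_Suc_shift del: sum.lessThan_Suc)
qed

text \<open>Targets depend only on the order within a label. For equal labels the earlier position
  has the larger target and should receive the larger weight, as in the rearrangement inequality;
  for different labels nothing changes.\<close>

lemma quota_dist_swap: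
  assumes "z \<le> y" "0 \<le> b"
  shows "quota_dist b c ((j, y) # (i, z) # l) \<le> quota_dist b c ((i, z) # (j, y) # l)"
proof (cases "i = j")
  case True
  have "(y - b)\<^sup>2 + z\<^sup>2 \<le> (z - b)\<^sup>2 + y\<^sup>2"
    using mult_right_mono[OF assms] by (simp add: power2_eq_square algebra_simps)
  then show ?thesis using True by (auto simp: quota_dist_Cons)
next
  case False
  then show ?thesis by (auto simp: quota_dist_Cons fun_upd_twist)
qed

lemma quota_dist_insert: "0 \<le> b \<Longrightarrow> quota_dist b c (insert_desc e l) \<le> quota_dist b c (e # l)"
proof (induction l arbitrary: c)
  case (Cons f l)
  obtain i z j y where e: "e = (i, z)" and f: "f = (j, y)" by fastforce
  show ?case
  proof (cases "z < y")
    case True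
    have "quota_dist b c (f # l') = (y - (if 0 < c j then b else 0))\<^sup>2 + quota_dist b (c(j := c j - 1)) l'"
      for l' unfolding f by (rule quota_dist_Cons)
    note * = this
    have ins: "insert_desc e (f # l) = f # insert_desc e l"
      using True e f by (simp add: insert_desc_simps)
    have "quota_dist b c (insert_desc e (f # l)) \<le> quota_dist b c (f # e # l)"
      unfolding ins * by (rule add_left_mono[OF Cons.IH[OF Cons.prems]])
    also have "\<dots> \<le> quota_dist b c (e # f # l)"
      using quota_dist_swap[of z y b c j i l] True Cons.prems e f by simp
    finally show ?thesis .
  next
    case False
    then show ?thesis using e f by (simp add: insert_desc_simps)
  qed
qed (simp add: insert_desc_simps)

lemma quota_dist_sort: "0 \<le> b \<Longrightarrow> quota_dist b c (sort_desc l) \<le> quota_dist b c l"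
proof (induction l arbitrary: c)
  case (Cons e l)
  obtain i z where e: "e = (i, z)" by fastforce
  have "quota_dist b c (sort_desc (e # l)) \<le> quota_dist b c (e # sort_desc l)"
    using quota_dist_insert[OF Cons.prems] by simp
  also have "\<dots> \<le> quota_dist b c (e # l)" using Cons by (simp add: e quota_dist_Cons)
  finally show ?case .
qed simp

lemma quota_dist_nonneg: "0 \<le> quota_dist b c l"
  unfolding quota_dist_def by (intro sum_nonneg) simp

section \<open>Sweeps over the grid and the running minimum\<close>

definition grid_point :: "nat \<Rightarrow> nat \<Rightarrow> (nat \<Rightarrow> nat) \<Rightarrow> rat list" where
  "grid_point N H c = map (\<lambda>i. of_nat (c i) / of_nat H) [1..<Suc N]"

definition better :: "(rat list \<Rightarrow> int) \<Rightarrow> int \<times> rat list \<Rightarrow> rat list \<Rightarrow> int \<times> rat list" where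
  "better F a y = (if F y < fst a then (F y, y) else a)"

lemma foldl_better_le: "fst (foldl (better F) a ys) \<le> fst a"
proof (induction ys arbitrary: a)
  case (Cons x ys)
  have "fst (foldl (better F) (better F a x) ys) \<le> fst (better F a x)" by (rule Cons.IH)
  also have "\<dots> \<le> fst a" by (simp add: better_def)
  finally show ?case by simp
qed simp

lemma foldl_better_min: "y \<in> set ys \<Longrightarrow> fst (foldl (better F) a ys) \<le> F y"
proof (induction ys arbitrary: a)
  case (Cons x ys)
  show ?case
  proof (cases "y = x")
    case True
    have "fst (foldl (better F) (better F a x) ys) \<le> fst (better F a x)" by (rule foldl_better_le)
    also have "\<dots> \<le> F x" by (simp add: better_def)
    finally show ?thesis using True by simp
  qed (use Cons in auto)
qed simp

lemma foldl_better_mem: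
  "foldl (better F) a ys = a \<or> (\<exists>y\<in>set ys. foldl (better F) a ys = (F y, y))"
  by (induction ys arbitrary: a) (fastforce simp: better_def)+

locale grid =
  fixes N H :: nat and Z :: nat
begin

abbreviation prefix_point :: "(nat \<times> int) list \<Rightarrow> nat \<Rightarrow> rat list" where
  "prefix_point l m \<equiv> grid_point N H (count_fst (take m l))"

definition visited :: "(nat \<times> int) list \<Rightarrow> rat list list" where
  "visited l = map (prefix_point l) [0..<Suc (length l)]"

text \<open>For a submodular objective and a descending list, the increments along the prefixes form
  a subgradient of the Lovasz extension at the weights. All of them refer to the old order, so the
  weights can be changed simultaneously.\<close>

definition sweep :: "(rat list \<Rightarrow> int) \<Rightarrow> (nat \<times> int) list \<Rightarrow> (nat \<times> int) list" where
  "sweep F l = map (\<lambda>m. (fst (l ! m), clip (int Z)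
     (snd (l ! m) - (F (prefix_point l (Suc m)) - F (prefix_point l m))))) [0..<length l]"

definition descent_step ::
    "(rat list \<Rightarrow> int) \<Rightarrow> (nat \<times> int) list \<times> int \<times> rat list \<Rightarrow> (nat \<times> int) list \<times> int \<times> rat list" where
  "descent_step F s = (sort_desc (sweep F (fst s)), foldl (better F) (snd s) (visited (fst s)))"

lemma length_sweep [simp]: "length (sweep F l) = length l"
  by (simp add: sweep_def)

lemma map_fst_sweep [simp]: "map fst (sweep F l) = map fst l"
  by (rule nth_equalityI) (simp_all add: sweep_def)

lemma count_take_sweep: "count_fst (take m (sweep F l)) = count_fst (take m l)"
  by (simp add: take_map[symmetric])

text \<open>A sweep changes neither labels nor positions, hence no targets, and the one-step
  inequality can be summed over the elements.\<close>

lemma quota_dist_sweep: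
  fixes Wb :: int
  assumes w: "\<And>m. m < length l \<Longrightarrow> \<bar>F (prefix_point l (Suc m)) - F (prefix_point l m)\<bar> \<le> Wb"
  shows "quota_dist Z c (sweep F l) \<le> quota_dist Z c l
     - 2 * (\<Sum>m<length l. (F (prefix_point l (Suc m)) - F (prefix_point l m)) * (snd (l ! m) -
         (if count_fst (take m l) (fst (l ! m)) < c (fst (l ! m)) then int Z else 0)))
     + length l * Wb\<^sup>2"
proof -
  define w where "w = (\<lambda>m. F (prefix_point l (Suc m)) - F (prefix_point l m))"
  define t where "t = (\<lambda>m. if count_fst (take m l) (fst (l ! m)) < c (fst (l ! m)) then int Z else 0)"
  have "quota_dist Z c (sweep F l) = (\<Sum>m<length l. (clip Z (snd (l ! m) - w m) - t m)\<^sup>2)"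
    unfolding quota_dist_def t_def w_def
    by (intro sum.cong) (auto simp: count_take_sweep, auto simp: sweep_def)
  also have "\<dots> \<le> (\<Sum>m<length l. (snd (l ! m) - t m)\<^sup>2 - 2 * (w m * (snd (l ! m) - t m)) + Wb\<^sup>2)"
  proof (intro sum_mono)
    fix m assume "m \<in> {..<length l}"
    then have "(w m)\<^sup>2 \<le> Wb\<^sup>2" using w unfolding w_def by (force intro: square_mono_abs)
    moreover have "0 \<le> t m" "t m \<le> int Z" by (auto simp: t_def)
    ultimately show "(clip Z (snd (l ! m) - w m) - t m)\<^sup>2 \<le>
        (snd (l ! m) - t m)\<^sup>2 - 2 * (w m * (snd (l ! m) - t m)) + Wb\<^sup>2"
      using clip_closer[of "t m" "int Z" "snd (l ! m)" "w m"]
      unfolding mult.assoc by linarith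
  qed
  also have "\<dots> = quota_dist Z c l - 2 * (\<Sum>m<length l. w m * (snd (l ! m) - t m)) + length l * Wb\<^sup>2"
  proof -
    have "quota_dist Z c l = (\<Sum>m<length l. (snd (l ! m) - t m)\<^sup>2)"
      by (simp add: quota_dist_def t_def)
    then show ?thesis by (simp add: sum.distrib sum_subtractf sum_distrib_left)
  qed
  finally show ?thesis unfolding w_def t_def .
qed

end

text \<open>For \<open>y = 0\<close> this says that the Lovasz extension at the weights
  \<open>z\<close> is at least \<open>b\<close> times the minimum along the prefixes, both measured
  from the value at the origin. The induction replaces \<open>y\<close> by the last weight, which is
  why \<open>y\<close> is left arbitrary.\<close>

lemma abel_lower_bound:
  fixes a z :: "nat \<Rightarrow> 'a :: linordered_idom"
  assumes "\<And>m. m \<le> n \<Longrightarrow> lo \<le> a m" "\<And>m m'. m \<le> m' \<Longrightarrow> m' < n \<Longrightarrow> z m' \<le> z m"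
    "\<And>m. m < n \<Longrightarrow> z m \<le> b" "\<And>m. m < n \<Longrightarrow> y \<le> z m" "y \<le> b" "0 \<le> y"
  shows "b * (lo - a 0) + y * (a n - lo) \<le> (\<Sum>m<n. (a (Suc m) - a m) * z m)"
  using assms
proof (induction n arbitrary: y)
  case 0
  have "0 \<le> (b - y) * (a 0 - lo)" using 0 by (intro mult_nonneg_nonneg) auto
  then show ?case by (simp add: algebra_simps)
next
  case (Suc n)
  have "0 \<le> z n" using Suc.prems(4)[of n] Suc.prems(6) by simp
  have "b * (lo - a 0) + z n * (a n - lo) \<le> (\<Sum>m<n. (a (Suc m) - a m) * z m)"
    using Suc.prems \<open>0 \<le> z n\<close> by (intro Suc.IH) auto
  moreover have "y * (a (Suc n) - lo) \<le> z n * (a (Suc n) - lo)"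
    using Suc.prems(1)[of "Suc n"] Suc.prems(4)[of n] by (intro mult_right_mono) auto
  ultimately show ?case by (simp add: algebra_simps)
qed

definition submod_counts :: "(nat \<Rightarrow> nat) \<Rightarrow> ((nat \<Rightarrow> nat) \<Rightarrow> real) \<Rightarrow> bool" where
  "submod_counts u G \<longleftrightarrow> (\<forall>c d. c \<le> u \<longrightarrow> d \<le> u \<longrightarrow>
     G (\<lambda>i. min (c i) (d i)) + G (\<lambda>i. max (c i) (d i)) \<le> G c + G d)"

lemma count_take_Suc:
  "m < length l \<Longrightarrow> count_fst (take (Suc m) l) = (count_fst (take m l))(fst (l ! m) := Suc (count_fst (take m l) (fst (l ! m))))"
  by (auto simp: take_Suc_conv_app_nth)

lemma count_take_le: "count_fst (take m l) i \<le> count_fst l i"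
  by (metis append_take_drop_id count_list_append le_add1 map_append)

text \<open>Raising one coordinate gains at most as much as it does after meeting with \<open>c\<close>, so the
  gains that count towards \<open>c\<close> telescope.\<close>

lemma greedy_le:
  assumes G: "submod_counts u G" and u: "count_fst l = u" and c: "c \<le> u"
  shows "(\<Sum>m<length l. (if count_fst (take m l) (fst (l ! m)) < c (fst (l ! m))
      then G (count_fst (take (Suc m) l)) - G (count_fst (take m l)) else 0)) \<le> G c - G (\<lambda>_. 0)"
proof -
  define x where "x = (\<lambda>m. count_fst (take m l))"
  define y where "y = (\<lambda>m i. min (x m i) (c i))"
  have xu: "x m \<le> u" for m unfolding x_def u[symmetric] by (intro le_funI count_take_le)
  have step: "(if x m (fst (l ! m)) < c (fst (l ! m)) then G (x (Suc m)) - G (x m) else 0)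
      \<le> G (y (Suc m)) - G (y m)" if m: "m < length l" for m
  proof -
    define i where "i = fst (l ! m)"
    have xs: "x (Suc m) = (x m)(i := Suc (x m i))" unfolding x_def i_def using count_take_Suc[OF m] .
    show ?thesis
    proof (cases "x m i < c i")
      case True
      \<comment> \<open>Submodularity is applied to the current point \<open>x m\<close> and the
        next truncated point \<open>y (Suc m)\<close>: their meet is the old truncated point and
        their join is the raised point.\<close>
      have 1: "(\<lambda>j. min (x m j) (y (Suc m) j)) = y m"
        unfolding y_def xs using True by (auto simp: fun_eq_iff)
      have 2: "(\<lambda>j. max (x m j) (y (Suc m) j)) = x (Suc m)"
        unfolding y_def xs using True by (auto simp: fun_eq_iff)
      have "y (Suc m) \<le> u" using xu[of "Suc m"] unfolding y_def le_fun_def by (auto intro: min.coboundedI1)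
      then have "G (y m) + G (x (Suc m)) \<le> G (x m) + G (y (Suc m))"
        using G xu[of m] 1 2 unfolding submod_counts_def by metis
      then show ?thesis using True unfolding i_def by simp
    next
      case False
      then have "y (Suc m) = y m" unfolding y_def xs by (auto simp: fun_eq_iff)
      then show ?thesis using False unfolding i_def by simp
    qed
  qed
  have "(\<Sum>m<length l. (if x m (fst (l ! m)) < c (fst (l ! m)) then G (x (Suc m)) - G (x m) else 0))
     \<le> (\<Sum>m<length l. G (y (Suc m)) - G (y m))" by (intro sum_mono step) simp
  also have "\<dots> = G (y (length l)) - G (y 0)" by (rule sum_lessThan_telescope)
  also have "y (length l) = c" unfolding y_def x_def using c u by (auto simp: fun_eq_iff le_fun_def min_absorb2)
  also have "y 0 = (\<lambda>_. 0)" unfolding y_def x_def by auto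
  finally show ?thesis unfolding x_def .
qed

section \<open>Convergence of the descent for rounded values\<close>

locale grid_descent = grid N H Z for N H Z :: nat +
  fixes u :: "nat \<Rightarrow> nat" and F :: "rat list \<Rightarrow> int" and G :: "(nat \<Rightarrow> nat) \<Rightarrow> real"
    and \<nu> :: real and Wb :: nat and n :: nat
  assumes G: "submod_counts u G"
    and approx: "\<And>c. c \<le> u \<Longrightarrow> \<bar>F (grid_point N H c) - G c\<bar> \<le> \<nu>"
    and step_bound: "\<And>c i. c(i := Suc (c i)) \<le> u \<Longrightarrow>
       \<bar>F (grid_point N H (c(i := Suc (c i)))) - F (grid_point N H c)\<bar> \<le> int Wb"
    and Z: "Z = Wb\<^sup>2" "Z > 0"
begin

definition ok_list :: "(nat \<times> int) list \<Rightarrow> bool" where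
  "ok_list l \<longleftrightarrow> length l = n \<and> count_fst l = u \<and> descending l \<and> (\<forall>e\<in>set l. 0 \<le> snd e \<and> snd e \<le> int Z)"

lemma ok_list_step:
  assumes "ok_list l" shows "ok_list (sort_desc (sweep F l))"
proof -
  have m: "mset (map fst (sort_desc (sweep F l))) = mset (map fst l)"
    by (metis map_fst_sweep mset_map mset_sort_desc)
  then have "count_fst (sort_desc (sweep F l)) = count_fst l"
    by (metis count_mset)
  moreover have "length (sort_desc (sweep F l)) = length l"
    using m by (metis length_map size_mset)
  moreover have "set (sort_desc (sweep F l)) = set (sweep F l)"
    by (metis mset_sort_desc set_mset_mset)
  moreover have "\<forall>e\<in>set (sweep F l). 0 \<le> snd e \<and> snd e \<le> int Z"
    by (auto simp: sweep_def clip_bounds)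
  ultimately show ?thesis using assms descending_sort_desc unfolding ok_list_def by auto
qed

text \<open>The sum of increments times weight minus target is split. Abel summation bounds the part
  with the weights below by the best visited value, and \<open>greedy_le\<close> bounds the part
  with the targets above by the competitor \<open>c\<close>. Rounding costs \<open>2 * \<nu>\<close>
  per element since an increment involves two values.\<close>

lemma step_progress:
  assumes l: "ok_list l" and c: "c \<le> u" and a: "\<And>y. y \<in> set (visited l) \<Longrightarrow> lo \<le> F y"
  shows "2 * Z * (lo - F (grid_point N H (\<lambda>_. 0)) - (G c - G (\<lambda>_. 0)) - 2 * \<nu> * n)
     \<le> quota_dist Z c l - quota_dist Z c (sort_desc (sweep F l)) + n * Z"
proof -
  define x where "x = (\<lambda>m. count_fst (take m l))"
  define w where "w = (\<lambda>m. F (prefix_point l (Suc m)) - F (prefix_point l m))"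
  define A where "A = (\<lambda>m. x m (fst (l ! m)) < c (fst (l ! m)))"
  have len: "length l = n" and u: "count_fst l = u" using l unfolding ok_list_def by auto
  have xu: "x m \<le> u" for m unfolding x_def u[symmetric] by (intro le_funI count_take_le)
  have \<nu>: "0 \<le> \<nu>" using approx[OF xu[of 0]] by linarith
  have wb: "\<bar>w m\<bar> \<le> int Wb" if "m < length l" for m
    using step_bound[of "x m" "fst (l ! m)"] xu[of "Suc m"] count_take_Suc[OF that]
    unfolding w_def x_def by simp
  have 1: "quota_dist Z c (sort_desc (sweep F l)) \<le> quota_dist Z c l
     - 2 * (\<Sum>m<n. w m * (snd (l ! m) - (if A m then int Z else 0))) + n * Z"
    using quota_dist_sort[of "int Z" c "sweep F l"] quota_dist_sweep[of l F "int Wb" c] wb Z len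
    unfolding w_def A_def x_def by simp
  have lo: "lo \<le> F (prefix_point l m)" if "m \<le> n" for m
    using a that len unfolding visited_def by (simp del: upt_Suc)
  have "int Z * (lo - F (prefix_point l 0)) + 0 * (F (prefix_point l n) - lo) \<le> (\<Sum>m<n. w m * snd (l ! m))"
    unfolding w_def
  proof (rule abel_lower_bound)
    fix m m' assume "m \<le> m'" "m' < n"
    then show "snd (l ! m') \<le> snd (l ! m)"
      using l unfolding ok_list_def by (metis le_neq_implies_less order_refl sorted_wrt_nth_less)
  qed (use l lo in \<open>auto simp: ok_list_def\<close>)
  then have 2: "int Z * (lo - F (grid_point N H (\<lambda>_. 0))) \<le> (\<Sum>m<n. w m * snd (l ! m))" by simp
  have "real_of_int (\<Sum>m<n. if A m then w m else 0) =
      (\<Sum>m<n. if A m then real_of_int (w m) else 0)" by (simp add: if_distrib cong: if_cong)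
  also have "\<dots> \<le> (\<Sum>m<n. (if A m then G (x (Suc m)) - G (x m) else 0) + 2 * \<nu>)"
  proof (intro sum_mono)
    fix m
    show "(if A m then real_of_int (w m) else 0) \<le> (if A m then G (x (Suc m)) - G (x m) else 0) + 2 * \<nu>"
      using approx[OF xu[of m]] approx[OF xu[of "Suc m"]] \<nu> unfolding w_def x_def by auto
  qed
  also have "\<dots> = (\<Sum>m<n. (if A m then G (x (Suc m)) - G (x m) else 0)) + 2 * \<nu> * n"
    by (simp add: sum.distrib)
  also have "\<dots> \<le> G c - G (\<lambda>_. 0) + 2 * \<nu> * n"
    using greedy_le[OF G u c] len unfolding A_def x_def by simp
  finally have 3: "real_of_int (\<Sum>m<n. if A m then w m else 0) \<le> G c - G (\<lambda>_. 0) + 2 * \<nu> * n" .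
  have "(\<Sum>m<n. w m * (snd (l ! m) - (if A m then int Z else 0))) =
      (\<Sum>m<n. w m * snd (l ! m)) - int Z * (\<Sum>m<n. if A m then w m else 0)"
    by (simp add: sum_distrib_left sum_subtractf[symmetric] right_diff_distrib)
      (intro sum.cong, auto)
  then have "real_of_int (quota_dist Z c (sort_desc (sweep F l)))
     \<le> quota_dist Z c l - 2 * (\<Sum>m<n. w m * snd (l ! m)) + 2 * (Z * real_of_int (\<Sum>m<n. if A m then w m else 0)) + n * Z"
    using 1 by (simp only: of_int_le_iff[symmetric, where 'a = real]) simp
  moreover have "real Z * real_of_int (\<Sum>m<n. if A m then w m else 0) \<le> Z * (G c - G (\<lambda>_. 0) + 2 * \<nu> * n)"
    using 3 by (intro mult_left_mono) auto
  moreover have "real Z * (lo - F (grid_point N H (\<lambda>_. 0))) \<le> real_of_int (\<Sum>m<n. w m * snd (l ! m))"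
  proof -
    have "real_of_int (int Z * (lo - F (grid_point N H (\<lambda>_. 0)))) \<le> real_of_int (\<Sum>m<n. w m * snd (l ! m))"
      using 2 by (simp only: of_int_le_iff)
    then show ?thesis by simp
  qed
  ultimately show ?thesis by (simp add: algebra_simps)
qed

lemma descent:
  assumes l: "ok_list l" and r: "(l', a') = (descent_step F ^^ r) (l, a)" and c: "c \<le> u"
  shows "ok_list l'"
    and "a' = a \<or> (\<exists>c\<le>u. a' = (F (grid_point N H c), grid_point N H c))"
    and "fst a' \<le> fst a"
    and "2 * Z * r * (real_of_int (fst a') - F (grid_point N H (\<lambda>_. 0)) - (G c - G (\<lambda>_. 0)) - 2 * \<nu> * n)
     \<le> quota_dist Z c l - quota_dist Z c l' + r * n * Z"
  using r
proof (induction r arbitrary: l' a')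
  case 0
  { case 1 then show ?case using l by simp
  next case 2 then show ?case by simp
  next case 3 then show ?case by simp
  next case 4 then show ?case by simp }
next
  case (Suc r)
  obtain l1 a1 where la: "(l1, a1) = (descent_step F ^^ r) (l, a)" by (metis surj_pair)
  note ih = Suc.IH[OF la]
  have st: "(descent_step F ^^ Suc r) (l, a) = (sort_desc (sweep F l1), foldl (better F) a1 (visited l1))"
    by (simp add: la[symmetric] descent_step_def)
  { case 1 then show ?case using ih(1) ok_list_step st by simp }
  { case 2
    have "\<exists>c\<le>u. y = grid_point N H c" if y: "y \<in> set (visited l1)" for y
    proof -
      obtain m where "y = prefix_point l1 m" using y unfolding visited_def by (auto simp del: upt_Suc)
      moreover have "count_fst (take m l1) \<le> u"
        using ih(1) count_take_le[of m l1] unfolding ok_list_def le_fun_def by auto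
      ultimately show ?thesis by blast
    qed
    then show ?case using 2 st ih(2) foldl_better_mem[of F a1 "visited l1"] by auto }
  { case 3 then show ?case using ih(3) st foldl_better_le[of F a1 "visited l1"] by simp }
  { case 4
    then have a': "a' = foldl (better F) a1 (visited l1)" and l': "l' = sort_desc (sweep F l1)"
      using st by auto
    have le: "fst a' \<le> fst a1" unfolding a' by (rule foldl_better_le)
    define e where "e = F (grid_point N H (\<lambda>_. 0)) + (G c - G (\<lambda>_. 0)) + 2 * \<nu> * n"
    have p: "2 * Z * (real_of_int (fst a') - e) \<le> quota_dist Z c l1 - quota_dist Z c l' + n * Z"
      unfolding l' e_def using step_progress[OF ih(1) c, of "fst a'"] foldl_better_min[of _ "visited l1" F a1] a'
      by (simp add: algebra_simps)
    \<comment> \<open>The recorded value only decreases, so the progress of all earlier rounds may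
      be measured against the latest one.\<close>
    have "2 * Z * r * (real_of_int (fst a') - e) \<le> 2 * Z * r * (real_of_int (fst a1) - e)"
      using le by (intro mult_left_mono) auto
    also have "\<dots> \<le> quota_dist Z c l - quota_dist Z c l1 + r * n * Z"
      using ih(4) unfolding e_def by (simp add: algebra_simps)
    finally have "2 * Z * Suc r * (real_of_int (fst a') - e) \<le> quota_dist Z c l - quota_dist Z c l' + Suc r * n * Z"
      using p by (simp add: algebra_simps)
    then show ?case unfolding e_def by (simp add: algebra_simps) }
qed

text \<open>From zero weights the initial squared distance is at most \<open>n * Z * Z\<close>, and
  \<open>Z\<close> rounds with squared steps of at most \<open>n * Z\<close> add the same amount
  again. The progress is \<open>2 * Z * Z\<close> times the gap, so a gap of \<open>n\<close>
  remains; the rounded value at the origin costs one more \<nu>.\<close>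

lemma descent_optimal:
  assumes l: "ok_list l" and r: "(l', a') = (descent_step F ^^ Z) (l, a)" and c: "c \<le> u"
    and l0: "\<forall>e\<in>set l. snd e = 0"
  shows "real_of_int (fst a') \<le> G c + \<nu> * (2 * n + 1) + n"
proof -
  have "quota_dist Z c l \<le> (\<Sum>m<length l. (int Z)\<^sup>2)"
    unfolding quota_dist_def
  proof (intro sum_mono)
    fix m assume "m \<in> {..<length l}"
    then have "snd (l ! m) = 0" using l0 by simp
    then show "(snd (l ! m) - (if count_fst (take m l) (fst (l ! m)) < c (fst (l ! m)) then int Z else 0))\<^sup>2
      \<le> (int Z)\<^sup>2" by simp
  qed
  then have q: "quota_dist Z c l \<le> int n * (int Z)\<^sup>2" using l unfolding ok_list_def by simp
  have z: "\<bar>F (grid_point N H (\<lambda>_. 0)) - G (\<lambda>_. 0)\<bar> \<le> \<nu>" by (rule approx) (simp add: le_fun_def)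
  define e where "e = F (grid_point N H (\<lambda>_. 0)) + (G c - G (\<lambda>_. 0)) + 2 * \<nu> * n"
  have "2 * Z * Z * (real_of_int (fst a') - e) \<le>
      real_of_int (quota_dist Z c l) - real_of_int (quota_dist Z c l') + real Z * n * Z"
    using descent(4)[OF l r c] unfolding e_def by (simp add: algebra_simps)
  also have "\<dots> \<le> real_of_int (int n * (int Z)\<^sup>2) + real Z * n * Z"
  proof -
    have "real_of_int (quota_dist Z c l) \<le> real_of_int (int n * (int Z)\<^sup>2)"
      using q by (simp only: of_int_le_iff)
    moreover have "0 \<le> real_of_int (quota_dist Z c l')"
      using quota_dist_nonneg by simp
    ultimately show ?thesis by linarith
  qed
  also have "\<dots> = (2 * Z * Z) * real n" by (simp add: power2_eq_square)
  finally have "real_of_int (fst a') - e \<le> n" using Z(2) by (simp add: mult_le_cancel_left)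
  then show ?thesis using z unfolding e_def by (simp add: algebra_simps)
qed

end

section \<open>Distributions on a box\<close>

lemma lipschitz_infnormD:
  assumes "lipschitz_infnorm N M X f" "x \<in> X" "y \<in> X" "\<And>i. i \<in> {1..N} \<Longrightarrow> \<bar>x i - y i\<bar> \<le> e"
    "0 \<le> M" "1 \<le> N"
  shows "\<bar>f x - f y\<bar> \<le> M * e"
proof -
  have "\<bar>f x - f y\<bar> \<le> M * Max ((\<lambda>i. \<bar>x i - y i\<bar>) ` {1..N})"
    using assms unfolding lipschitz_infnorm_def by blast
  also have "\<dots> \<le> M * e" using assms by (intro mult_left_mono Max.boundedI) auto
  finally show ?thesis .
qed

lemma abs_Max_diff_le:
  fixes f h :: "'a \<Rightarrow> real"
  assumes "finite A" "A \<noteq> {}" and d: "\<And>x. x \<in> A \<Longrightarrow> \<bar>f x - h x\<bar> \<le> e"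
  shows "\<bar>Max (f ` A) - Max (h ` A)\<bar> \<le> e"
proof -
  have one: "Max (f ` A) \<le> Max (h ` A) + e" if d: "\<And>x. x \<in> A \<Longrightarrow> \<bar>f x - h x\<bar> \<le> e" for f h :: "'a \<Rightarrow> real"
  proof (rule Max.boundedI)
    fix y assume "y \<in> f ` A"
    then obtain x where x: "x \<in> A" "y = f x" by blast
    have "h x \<le> Max (h ` A)" using x assms(1) by (intro Max_ge) auto
    then show "y \<le> Max (h ` A) + e" using d[OF x(1)] x(2) by linarith
  qed (use assms in auto)
  show ?thesis using one[of f h, OF d] one[of h f] d by (smt (verit))
qed

locale box =
  fixes N :: nat and B :: "nat \<Rightarrow> real" and M :: real
  assumes N: "1 \<le> N" and B: "\<And>i. i \<in> {1..N} \<Longrightarrow> 0 \<le> B i" and M: "0 \<le> M"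
begin

abbreviation "X \<equiv> cuboid N B"

lemma space_borel_on: "space (borel_on N X) = X"
  by (auto simp: borel_on_def space_restrict_space space_PiM cuboid_def PiE_def extensional_def)

lemma cuboidI: "(\<And>i. i \<in> {1..N} \<Longrightarrow> 0 \<le> x i \<and> x i \<le> B i) \<Longrightarrow> x \<in> extensional {1..N} \<Longrightarrow> x \<in> X"
  by (auto simp: cuboid_def PiE_def)

lemma cuboidD: "x \<in> X \<Longrightarrow> i \<in> {1..N} \<Longrightarrow> 0 \<le> x i \<and> x i \<le> B i"
  by (auto simp: cuboid_def PiE_def Pi_def)

text \<open>A Lipschitz function on the box is a limit of functions with countable range, because rounding
  the coordinates down does not leave the box.\<close>

lemma measurable_lipschitz:
  assumes f: "lipschitz_infnorm N M X f"
  shows "f \<in> borel_measurable (borel_on N X)"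
proof (rule borel_measurable_LIMSEQ_real)
  define r where "r = (\<lambda>n x. \<lambda>i\<in>{1..N}. of_int \<lfloor>(x i :: real) * 2 ^ n\<rfloor> / 2 ^ n :: real)"
  have r: "r n x \<in> X" and rx: "i \<in> {1..N} \<Longrightarrow> \<bar>r n x i - x i\<bar> \<le> 1 / 2 ^ n" if x: "x \<in> X" for n x i
  proof -
    have *: "0 \<le> r n x i \<and> r n x i \<le> x i \<and> x i - r n x i \<le> 1 / 2 ^ n" if i: "i \<in> {1..N}" for i
    proof -
      have "0 \<le> x i" using cuboidD[OF x i] by simp
      moreover have "of_int \<lfloor>x i * 2 ^ n\<rfloor> / 2 ^ n \<le> x i" by (simp add: divide_le_eq)
      moreover have "x i - of_int \<lfloor>x i * 2 ^ n\<rfloor> / 2 ^ n \<le> 1 / 2 ^ n"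
      proof -
        have "x i * 2 ^ n - of_int \<lfloor>x i * 2 ^ n\<rfloor> \<le> 1" by linarith
        then have "(x i * 2 ^ n - of_int \<lfloor>x i * 2 ^ n\<rfloor>) / 2 ^ n \<le> 1 / 2 ^ n"
          by (rule divide_right_mono) simp
        then show ?thesis by (simp add: diff_divide_distrib)
      qed
      ultimately show ?thesis using i by (simp add: r_def)
    qed
    show "r n x \<in> X"
    proof (rule cuboidI)
      show "r n x \<in> extensional {1..N}" by (simp add: r_def)
      fix i assume i: "i \<in> {1..N}"
      show "0 \<le> r n x i \<and> r n x i \<le> B i" using *[OF i] cuboidD[OF x i] by linarith
    qed
    show "\<bar>r n x i - x i\<bar> \<le> 1 / 2 ^ n" if "i \<in> {1..N}" using *[OF that] by linarith
  qed
  show "(\<lambda>n. f (r n x)) \<longlonglongrightarrow> f x" if "x \<in> space (borel_on N X)" for x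
  proof -
    have x: "x \<in> X" using that space_borel_on by simp
    have "\<bar>f (r n x) - f x\<bar> \<le> M * (1 / 2 ^ n)" for n
      by (rule lipschitz_infnormD[OF f r[OF x] x rx[OF x] M N])
    moreover have "(\<lambda>n. M * (1 / 2 ^ n)) \<longlonglongrightarrow> 0"
      using LIMSEQ_divide_realpow_zero[of 2 M] by simp
    ultimately have "(\<lambda>n. f (r n x) - f x) \<longlonglongrightarrow> 0"
      by (intro Lim_null_comparison[of "\<lambda>n. f (r n x) - f x" "\<lambda>n. M * (1 / 2 ^ n)"]) auto
    then show ?thesis by (simp add: LIM_zero_iff)
  qed
  show "(\<lambda>x. f (r n x)) \<in> borel_measurable (borel_on N X)" for n
  proof -
    \<comment> \<open>\<open>f\<close> is not yet known to be measurable. The rounded point is a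
      function of a tuple of integers, and on the countable set of such tuples every function is
      measurable.\<close>
    define c where "c = (\<lambda>x. \<lambda>i\<in>{1..N}. \<lfloor>(x i :: real) * 2 ^ n\<rfloor>)"
    have cm: "c \<in> measurable (borel_on N X) (count_space (PiE {1..N} (\<lambda>_. UNIV)))"
    proof -
      have "c \<in> measurable (Pi\<^sub>M {1..N} (\<lambda>_. borel)) (Pi\<^sub>M {1..N} (\<lambda>_. count_space (UNIV :: int set)))"
        unfolding c_def by (intro measurable_restrict) measurable
      then have "c \<in> measurable (Pi\<^sub>M {1..N} (\<lambda>_. borel)) (count_space (PiE {1..N} (\<lambda>_. UNIV)))"
        by (subst (asm) count_space_PiM_finite) auto
      then show ?thesis unfolding borel_on_def by (rule measurable_restrict_space1)
    qed
    have "(\<lambda>z. f (\<lambda>i\<in>{1..N}. of_int (z i) / 2 ^ n)) \<in>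
        measurable (count_space (PiE {1..N} (\<lambda>_. UNIV))) borel"
      unfolding measurable_count_space_eq1 by simp
    from measurable_compose[OF cm this]
    have "(\<lambda>x. f (\<lambda>i\<in>{1..N}. of_int (c x i) / 2 ^ n)) \<in> borel_measurable (borel_on N X)" .
    moreover have "(\<lambda>i\<in>{1..N}. of_int (c x i) / 2 ^ n) = r n x" for x
      unfolding c_def r_def by (rule restrict_ext) (simp only: restrict_apply' )
    ultimately show ?thesis by (simp only:)
  qed
qed

lemma distributionsD:
  assumes "P \<in> distributions N X"
  shows "prob_space P" "space P = X" "f \<in> borel_measurable (borel_on N X) \<Longrightarrow> f \<in> borel_measurable P"
proof -
  show "prob_space P" using assms by (simp add: distributions_def)
  have s: "sets P = sets (borel_on N X)" using assms by (simp add: distributions_def)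
  then show "space P = X" using sets_eq_imp_space_eq space_borel_on by blast
  show "f \<in> borel_measurable (borel_on N X) \<Longrightarrow> f \<in> borel_measurable P"
    using measurable_cong_sets[OF s refl] by blast
qed

lemma integrable_bounded:
  fixes C :: real
  assumes P: "P \<in> distributions N X" and f: "f \<in> borel_measurable (borel_on N X)"
    and b: "\<And>x. x \<in> X \<Longrightarrow> \<bar>f x\<bar> \<le> C"
  shows "integrable P f"
proof -
  interpret prob_space P using distributionsD[OF P] by simp
  show ?thesis using distributionsD[OF P] f b by (intro integrable_const_bound[where B = C]) auto
qed

lemma oscillation:
  assumes "lipschitz_infnorm N M X f" "x \<in> X" "y \<in> X" "\<And>i. i \<in> {1..N} \<Longrightarrow> B i \<le> b"
  shows "\<bar>f x - f y\<bar> \<le> M * b"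
proof (rule lipschitz_infnormD[OF assms(1-3) _ M N])
  fix i assume i: "i \<in> {1..N}"
  show "\<bar>x i - y i\<bar> \<le> b" using cuboidD[OF assms(2) i] cuboidD[OF assms(3) i] assms(4)[OF i] by linarith
qed

lemma zero_in_cuboid: "(\<lambda>i\<in>{1..N}. 0) \<in> X"
  using B by (auto intro: cuboidI)

lemma integrable_lipschitz:
  assumes P: "P \<in> distributions N X" and f: "lipschitz_infnorm N M X f"
  shows "integrable P f"
proof (rule integrable_bounded[OF P measurable_lipschitz[OF f]])
  fix x assume x: "x \<in> X"
  have "\<bar>f x - f (\<lambda>i\<in>{1..N}. 0)\<bar> \<le> M * Max (B ` {1..N})"
    by (rule oscillation[OF f x zero_in_cuboid]) simp
  then show "\<bar>f x\<bar> \<le> \<bar>f (\<lambda>i\<in>{1..N}. 0)\<bar> + M * Max (B ` {1..N})" by linarith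
qed

lemma lipschitz_Max:
  assumes "\<And>k. k \<in> {1..K} \<Longrightarrow> lipschitz_infnorm N M X (gs k)" "1 \<le> K"
  shows "lipschitz_infnorm N M X (\<lambda>x. Max ((\<lambda>k. gs k x) ` {1..K::nat}))"
  unfolding lipschitz_infnorm_def
proof (intro ballI)
  fix x y assume x: "x \<in> X" and y: "y \<in> X"
  define D where "D = M * Max ((\<lambda>i. \<bar>x i - y i\<bar>) ` {1..N})"
  have D: "\<bar>gs k x - gs k y\<bar> \<le> D" if "k \<in> {1..K}" for k
    using assms(1)[OF that] x y unfolding lipschitz_infnorm_def D_def by blast
  show "\<bar>Max ((\<lambda>k. gs k x) ` {1..K}) - Max ((\<lambda>k. gs k y) ` {1..K})\<bar>
      \<le> M * Max ((\<lambda>i. \<bar>x i - y i\<bar>) ` {1..N})"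
    using D assms(2) unfolding D_def[symmetric] by (intro abs_Max_diff_le) auto
qed

lemma dirac_mixture_distribution:
  assumes \<xi>: "\<And>r. r \<in> {1..R} \<Longrightarrow> \<xi> r \<in> X" and p: "\<And>r. r \<in> {1..R} \<Longrightarrow> 0 \<le> p r" "(\<Sum>r\<in>{1..R}. p r) = 1"
  shows "dirac_mixture N X R p \<xi> \<in> distributions N X"
    and "f \<in> borel_measurable (borel_on N X) \<Longrightarrow>
      (\<integral>x. f x \<partial>dirac_mixture N X R p \<xi>) = (\<Sum>r\<in>{1..R}. p r * f (\<xi> r))"
proof -
  let ?m = "point_measure {1..R} (\<lambda>r. ennreal (p r))"
  have m: "\<xi> \<in> measurable ?m (borel_on N X)"
    using \<xi> space_borel_on by (auto simp: measurable_point_measure_eq1)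
  have "emeasure ?m {1..R} = 1"
    using p sum_ennreal[of "{1..R}" p] by (simp add: emeasure_point_measure_finite)
  then have "prob_space ?m" by (intro prob_spaceI) (simp add: space_point_measure)
  then have "prob_space (distr ?m (borel_on N X) \<xi>)" using m prob_space.prob_space_distr by blast
  then show "dirac_mixture N X R p \<xi> \<in> distributions N X"
    unfolding dirac_mixture_def distributions_def by simp
  assume f: "f \<in> borel_measurable (borel_on N X)"
  have "(\<integral>x. f x \<partial>dirac_mixture N X R p \<xi>) = (\<integral>r. f (\<xi> r) \<partial>?m)"
    unfolding dirac_mixture_def by (rule integral_distr[OF m f])
  also have "\<dots> = (\<Sum>r\<in>{1..R}. p r * f (\<xi> r))"
    using p by (subst lebesgue_integral_point_measure_finite) auto
  finally show "(\<integral>x. f x \<partial>dirac_mixture N X R p \<xi>) = (\<Sum>r\<in>{1..R}. p r * f (\<xi> r))" .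
qed

end

section \<open>Online gradient ascent on the multipliers\<close>

text \<open>The squared distance to \<open>c\<close> starts at \<open>c\<^sup>2\<close>, stays
  nonnegative, and changes in each round by a linear term and at most \<open>U\<^sup>2\<close>. This
  is projected gradient ascent with step size 1.\<close>

lemma ascent_regret:
  assumes z: "z 0 = 0" "\<And>t. z (Suc t) = clip b (z t + u t)" and c: "0 \<le> c" "c \<le> b"
    and u: "\<And>t. t < T \<Longrightarrow> \<bar>u t\<bar> \<le> U"
  shows "2 * (\<Sum>t<T. u t * (c - z t)) \<le> c\<^sup>2 + int T * U\<^sup>2"
proof -
  have "(z T - c)\<^sup>2 \<le> c\<^sup>2 - 2 * (\<Sum>t<T. u t * (c - z t)) + int T * U\<^sup>2"
    using u
  proof (induction T)
    case (Suc T)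
    have "(z (Suc T) - c)\<^sup>2 \<le> (z T - c)\<^sup>2 + 2 * u T * (z T - c) + (u T)\<^sup>2"
      using clip_closer[OF c, of "z T" "- u T"] unfolding z(2) by simp
    moreover have "(u T)\<^sup>2 \<le> U\<^sup>2" using Suc.prems[of T] by (intro square_mono_abs) auto
    moreover have "(z T - c)\<^sup>2 \<le> c\<^sup>2 - 2 * (\<Sum>t<T. u t * (c - z t)) + int T * U\<^sup>2" using Suc by simp
    ultimately show ?case by (simp add: algebra_simps)
  qed (simp add: z)
  then show ?thesis using zero_le_power2[of "z T - c"] by linarith
qed

lemma ascent_all_nonpos:
  assumes z: "z 0 = 0" "\<And>t. z (Suc t) = clip b (z t + u t)" and b: "0 \<le> b"
    and u: "\<And>t. t < T \<Longrightarrow> u t \<le> (0::int)"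
  shows "t \<le> T \<Longrightarrow> z t = 0"
proof (induction t)
  case (Suc t)
  then show ?case using u[of t] b z(2)[of t] by (simp add: clip_def)
qed (simp add: z)

text \<open>Multipliers are integers in units of \<open>1 / S\<close>, payoffs are integers in units
  of \<open>1 / V\<close>. \<open>S\<close> keeps the regret of all constraints together within a
  quarter of the budget \<open>1 / E\<close>, and \<open>Lr\<close> is so large that a persistent
  violation would outweigh any gain in cost, which is at most \<open>MB\<close>. \<open>opt\<close>
  compares the chosen point with a fixed competitor of value \<rho>.\<close>

locale dual_ascent =
  fixes L E V S Lam U MB Lr T :: nat and lam u :: "nat \<Rightarrow> nat \<Rightarrow> int"
    and fr :: "nat \<Rightarrow> nat \<Rightarrow> real" and \<gamma> :: "nat \<Rightarrow> real" and gr :: "nat \<Rightarrow> real" and \<rho> :: real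
  assumes E: "1 \<le> E" and L: "1 \<le> L"
    and Lr: "Lr = 2 * E * (MB + 1)" and V: "20 * E * (L * Lr + 1) \<le> V" and U: "U = V * MB + 8"
    and S: "S = 2 * E * L * (1 + U\<^sup>2)" and Lam: "Lam = S * Lr" and T: "T = Lam\<^sup>2"
    and lam0: "\<And>l. l < L \<Longrightarrow> lam 0 l = 0"
    and lam_Suc: "\<And>t l. l < L \<Longrightarrow> lam (Suc t) l = clip Lam (lam t l + u t l)"
    and u: "\<And>t l. l < L \<Longrightarrow> \<bar>u t l - V * (fr t l - \<gamma> l)\<bar> \<le> 4"
    and osc: "\<And>t t' l. l < L \<Longrightarrow> fr t l - fr t' l \<le> MB"
    and feas: "\<And>t l. l < L \<Longrightarrow> fr t l - \<gamma> l \<le> MB"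
    and cost: "\<And>t. gr t \<le> \<rho> + MB"
    and opt: "\<And>t. S * \<rho> + (\<Sum>l<L. lam t l * (fr t l - \<gamma> l)) - S / (2 * E) \<le> S * gr t"
begin

text \<open>One positive payoff puts \<open>V * (fr t0 l - \<gamma> l)\<close> above -4, and since
  this quantity varies by at most \<open>V * MB\<close>, it is bounded below in all rounds. The 8 in
  \<open>U\<close> stands for two rounding errors of 4.\<close>

lemma u_bounded:
  assumes l: "l < L" and t0: "0 < u t0 l"
  shows "\<bar>u t l\<bar> \<le> int U"
proof -
  have 1: "real V * (fr t l - \<gamma> l) \<le> real V * MB" using feas[OF l, of t] by (intro mult_left_mono) auto
  have "real V * (fr t0 l - fr t l) \<le> real V * MB" using osc[OF l, of t0 t] by (intro mult_left_mono) auto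
  then have 2: "real V * (fr t0 l - \<gamma> l) - real V * (fr t l - \<gamma> l) \<le> real V * MB"
    by (simp add: right_diff_distrib)
  have 3: "0 < real_of_int (u t0 l)" using t0 by simp
  have "real_of_int (u t l) \<le> real V * MB + 8" "- (real V * MB + 8) \<le> real_of_int (u t l)"
    using u[OF l, of t] u[OF l, of t0] 1 2 3 by linarith+
  then have "real_of_int \<bar>u t l\<bar> \<le> real_of_int (int U)" unfolding U by simp
  then show ?thesis by (simp only: of_int_le_iff)
qed

text \<open>A payoff may be far below zero only if it is never positive, and then the multiplier stays zero.
  In all other cases the payoffs are bounded by \<open>U\<close>.\<close>

lemma regret:
  assumes l: "l < L" and c: "0 \<le> c" "c \<le> int Lam"
  shows "2 * c * (\<Sum>t<T. u t l) - int T * (1 + (int U)\<^sup>2) \<le> 2 * (\<Sum>t<T. lam t l * u t l)"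
proof (cases "\<forall>t<T. u t l \<le> 0")
  case True
  have "lam t l = 0" if "t < T" for t
    by (rule ascent_all_nonpos[where z = "\<lambda>t. lam t l" and u = "\<lambda>t. u t l" and b = "int Lam" and T = T])
      (use lam0 lam_Suc l True that in auto)
  moreover have "c * (\<Sum>t<T. u t l) \<le> 0"
    using True c by (intro mult_nonneg_nonpos sum_nonpos) auto
  moreover have "0 \<le> int T * (1 + (int U)\<^sup>2)" by simp
  ultimately have "2 * (c * (\<Sum>t<T. u t l)) - int T * (1 + (int U)\<^sup>2) \<le> 0"
    "(\<Sum>t<T. lam t l * u t l) = 0" by (linarith, simp)
  then show ?thesis by (simp only: mult.assoc mult_zero_right)
next
  case False
  then obtain t0 where t0: "0 < u t0 l" by (meson not_le)
  have "2 * (\<Sum>t<T. u t l * (c - lam t l)) \<le> c\<^sup>2 + int T * (int U)\<^sup>2"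
    by (rule ascent_regret[where z = "\<lambda>t. lam t l" and u = "\<lambda>t. u t l" and b = "int Lam"])
      (use lam0 lam_Suc l c u_bounded[OF l t0] in auto)
  also have "\<dots> \<le> int T + int T * (int U)\<^sup>2"
    using square_mono_abs[of c "int Lam"] c T by simp
  finally show ?thesis
    by (simp add: sum_subtractf sum_distrib_left right_diff_distrib distrib_left mult.commute mult.left_commute)
qed

lemma lam_bounds: "l < L \<Longrightarrow> 0 \<le> lam t l \<and> lam t l \<le> int Lam"
  using lam0 lam_Suc by (cases t) (auto simp: clip_bounds)

lemma Lr_pos: "0 < Lr"
  unfolding Lr using E by (intro mult_pos_pos) auto

lemma S_pos: "0 < real S"
proof -
  have "0 < S" unfolding S using E L by (intro mult_pos_pos) auto
  then show ?thesis by simp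
qed

lemma V_pos: "1 \<le> real V"
proof -
  have "1 * 1 * 1 \<le> 20 * E * (L * Lr + 1)" using E by (intro mult_le_mono) auto
  then have "1 \<le> V" using V by linarith
  then show ?thesis by simp
qed

lemma T_pos: "0 < real T"
proof -
  have "0 < T" unfolding T Lam using S_pos Lr_pos by simp
  then show ?thesis by simp
qed

text \<open>\<open>opt\<close> is summed over the rounds, and the regret bound exchanges the
  multipliers in it for the constant \<open>c\<close> on the constraint \<open>l0\<close> and 0 on
  all others. In units of the budget the losses are at most 1/4 from regret, 1/5 from rounded
  payoffs and 1/2 from \<open>opt\<close>, together less than 1.\<close>

lemma sum_payoff:
  assumes l0: "l0 < L" and c: "c = 0 \<or> c = int Lam"
  shows "T * \<rho> - T / E + c * (\<Sum>t<T. u t l0) / (V * S) \<le> (\<Sum>t<T. gr t)"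
proof -
  define \<Sigma> where "\<Sigma> = (\<Sum>t<T. \<Sum>l<L. lam t l * u t l)"
  have E': "1 \<le> real E" using E by simp
  have "2 * c * (\<Sum>t<T. u t l0) - int L * (int T * (1 + (int U)\<^sup>2))
      = (\<Sum>l<L. (if l = l0 then 2 * c * (\<Sum>t<T. u t l0) else 0) - int T * (1 + (int U)\<^sup>2))"
    using l0 by (simp add: sum_subtractf)
  also have "\<dots> \<le> (\<Sum>l<L. 2 * (\<Sum>t<T. lam t l * u t l))"
  proof (intro sum_mono)
    fix l assume "l \<in> {..<L}"
    then have l: "l < L" by simp
    show "(if l = l0 then 2 * c * (\<Sum>t<T. u t l0) else 0) - int T * (1 + (int U)\<^sup>2)
        \<le> 2 * (\<Sum>t<T. lam t l * u t l)"
    proof (cases "l = l0")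
      case True
      have "0 \<le> c" "c \<le> int Lam" using c by auto
      then show ?thesis using regret[OF l, of c] True by simp
    next
      case False
      then show ?thesis using regret[OF l, of 0] by simp
    qed
  qed
  also have "\<dots> = 2 * \<Sigma>"
  proof -
    have "\<Sigma> = (\<Sum>l<L. \<Sum>t<T. lam t l * u t l)" unfolding \<Sigma>_def by (rule sum.swap)
    then show ?thesis by (simp only: sum_distrib_left)
  qed
  finally have 1: "2 * c * (\<Sum>t<T. u t l0) - int L * (int T * (1 + (int U)\<^sup>2)) \<le> 2 * \<Sigma>" .
  have 2: "real_of_int \<Sigma> - 4 * (L * T * Lam) \<le> V * (\<Sum>t<T. \<Sum>l<L. lam t l * (fr t l - \<gamma> l))"
  proof -
    have "real_of_int \<Sigma> - 4 * (L * T * Lam) = (\<Sum>t<T. \<Sum>l<L. lam t l * u t l - 4 * real Lam)"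
      unfolding \<Sigma>_def by (simp add: sum_subtractf)
    also have "\<dots> \<le> (\<Sum>t<T. \<Sum>l<L. V * (lam t l * (fr t l - \<gamma> l)))"
    proof (intro sum_mono)
      fix t l assume "l \<in> {..<L}"
      then have l: "l < L" by simp
      have "0 \<le> real_of_int (lam t l)" using lam_bounds[OF l, of t] by simp
      moreover have "real_of_int (lam t l) \<le> real_of_int (int Lam)"
        using lam_bounds[OF l, of t] by (simp only: of_int_le_iff)
      moreover have "real_of_int (lam t l) * (u t l - V * (fr t l - \<gamma> l)) \<le> real_of_int (lam t l) * 4"
        using calculation(1) u[OF l, of t] by (intro mult_left_mono) (simp_all add: abs_le_iff)
      ultimately show "real_of_int (lam t l * u t l) - 4 * real Lam \<le> V * (lam t l * (fr t l - \<gamma> l))"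
        by (simp add: algebra_simps)
    qed
    finally show ?thesis by (simp add: sum_distrib_left)
  qed
  have "(\<Sum>t<T. S * \<rho> + (\<Sum>l<L. lam t l * (fr t l - \<gamma> l)) - S / (2 * E)) \<le> (\<Sum>t<T. S * gr t)"
    by (intro sum_mono opt)
  then have 3: "T * (S * \<rho>) + (\<Sum>t<T. \<Sum>l<L. lam t l * (fr t l - \<gamma> l)) - T * (S / (2 * E)) \<le> S * (\<Sum>t<T. gr t)"
    by (simp add: sum.distrib sum_subtractf sum_distrib_left)
  \<comment> \<open>\<open>V * q\<close> is the whole error budget \<open>T / E\<close> after
    scaling by \<open>V * S\<close>.\<close>
  define q where "q = T * S / E"
  have q: "0 \<le> q" unfolding q_def by simp
  have 4: "real L * (T * (1 + (real U)\<^sup>2)) = q / 2"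
  proof -
    have "real S = 2 * real E * (real L * (1 + (real U)\<^sup>2))" by (simp add: S algebra_simps)
    then have "q = real T * (2 * (real L * (1 + (real U)\<^sup>2)))" unfolding q_def using E' by simp
    then show ?thesis by simp
  qed
  have 5: "4 * real (L * T * Lam) \<le> V * q / 5"
  proof -
    have "20 * real E * (real L * Lr) \<le> 20 * real E * (real L * Lr + 1)" using E' by simp
    also have "\<dots> = real (20 * E * (L * Lr + 1))" by (simp only: of_nat_mult of_nat_add of_nat_1 of_nat_numeral)
    also have "\<dots> \<le> V" using V of_nat_le_iff by blast
    finally have "q / 5 * (20 * real E * (real L * Lr)) \<le> q / 5 * V" using q by (intro mult_left_mono) auto
    moreover have "q / 5 * (20 * real E * (real L * Lr)) = 4 * real (L * T * Lam)"
    proof -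
      have qE: "q * real E = real T * real S" unfolding q_def using E' by simp
      have "q / 5 * (20 * real E * (real L * Lr)) = 4 * (q * real E) * (real L * Lr)" by simp
      then show ?thesis unfolding qE Lam by simp
    qed
    moreover have "q / 5 * V = V * q / 5" by simp
    ultimately show ?thesis by linarith
  qed
  have "real_of_int (2 * c * (\<Sum>t<T. u t l0) - int L * (int T * (1 + (int U)\<^sup>2))) \<le> real_of_int (2 * \<Sigma>)"
    using 1 by (simp only: of_int_le_iff)
  then have 6: "2 * (real_of_int c * real_of_int (\<Sum>t<T. u t l0)) - q / 2 \<le> 2 * real_of_int \<Sigma>"
    using 4 by simp
  have "real V * (T * (S * \<rho>) + (\<Sum>t<T. \<Sum>l<L. lam t l * (fr t l - \<gamma> l)) - T * (S / (2 * E))) \<le> V * (S * (\<Sum>t<T. gr t))"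
    using 3 by (intro mult_left_mono) auto
  note vmul = this
  have "V * (T * (S * \<rho>)) + V * (\<Sum>t<T. \<Sum>l<L. lam t l * (fr t l - \<gamma> l)) - V * q / 2 \<le> V * (S * (\<Sum>t<T. gr t))"
  proof -
    have "real V * (T * (S / (2 * E))) = V * q / 2" by (simp add: q_def)
    then show ?thesis using vmul by (simp only: distrib_left right_diff_distrib)
  qed
  moreover have "q / 4 \<le> V * q / 4" using V_pos q by (simp add: mult_le_cancel_right1)
  ultimately have "V * (T * (S * \<rho>)) + real_of_int c * real_of_int (\<Sum>t<T. u t l0) - V * q \<le> V * (S * (\<Sum>t<T. gr t))"
    using 2 5 6 by linarith
  moreover define x where "x = c * (\<Sum>t<T. u t l0) / (V * S)"
  have "real V * real S * x = real_of_int c * real_of_int (\<Sum>t<T. u t l0)"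
    unfolding x_def using S_pos V_pos by simp
  moreover have "real V * real S * (T / E) = V * q" unfolding q_def by simp
  moreover have "real V * real S * (T * \<rho> - T / E + x) =
      V * (T * (S * \<rho>)) - real V * real S * (T / E) + real V * real S * x"
    by (simp add: distrib_left right_diff_distrib)
  ultimately have "real V * real S * (T * \<rho> - T / E + x) \<le> real V * real S * (\<Sum>t<T. gr t)"
    by (simp only: mult.assoc)
  moreover have "0 < real V * real S" using S_pos V_pos by (intro mult_pos_pos) auto
  ultimately show ?thesis unfolding x_def by (simp only: mult_le_cancel_left_pos)
qed

lemma value_bound: "\<rho> - 1 / E \<le> (\<Sum>t<T. gr t) / T"
proof -
  have "T * \<rho> - T / E \<le> (\<Sum>t<T. gr t)" using sum_payoff[of 0 0] L by simp
  then have "T * (\<rho> - 1 / E) \<le> (\<Sum>t<T. gr t)" by (simp add: right_diff_distrib)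
  then show ?thesis using T_pos by (simp add: le_divide_eq mult.commute)
qed

text \<open>For \<open>c = Lam\<close> the value \<rho> cancels between \<open>sum_payoff\<close>
  and the bound on the cost, which limits \<open>Lr\<close> times the total violation to
  \<open>T * (MB + 1)\<close>. By the choice of \<open>Lr\<close> this is half of the permitted
  violation; the other half covers the rounding of payoffs.\<close>

lemma constraint_bound:
  assumes l: "l < L"
  shows "(\<Sum>t<T. fr t l) / T \<le> \<gamma> l + 1 / E"
proof -
  define r where "r = real_of_int (\<Sum>t<T. u t l)"
  have E': "1 \<le> real E" using E by simp
  have Lr': "real Lr = 2 * real E * (real MB + 1)" by (simp add: Lr algebra_simps)
  have Lrp: "0 < real Lr" unfolding Lr' using E' by simp
  have "(\<Sum>t<T. gr t) \<le> (\<Sum>t<T. \<rho> + MB)" by (intro sum_mono cost)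
  then have "(\<Sum>t<T. gr t) \<le> T * (\<rho> + MB)" by simp
  moreover have "T * \<rho> - T / E + int Lam * r / (V * S) \<le> (\<Sum>t<T. gr t)"
    using sum_payoff[OF l, of "int Lam"] unfolding r_def by simp
  moreover have "T / E \<le> real T" using E' T_pos by (simp add: divide_le_eq mult_le_cancel_left1)
  ultimately have "int Lam * r / (V * S) \<le> T * (real MB + 1)" by (simp add: distrib_left)
  moreover have "int Lam * r / (V * S) = Lr * (r / V)" unfolding Lam using S_pos by simp
  ultimately have "Lr * (r / V) \<le> T * (real MB + 1)" by simp
  also have "\<dots> = Lr * (T / (2 * E))" unfolding Lr' using E' by simp
  finally have 1: "r / V \<le> T / (2 * E)" using Lrp by (simp only: mult_le_cancel_left_pos)
  have 2: "4 * T / V \<le> T / (2 * E)"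
  proof -
    have "8 * real E \<le> 20 * real E * (real L * Lr + 1)"
    proof -
      have "20 * real E * 1 \<le> 20 * real E * (real L * Lr + 1)" by (intro mult_left_mono) auto
      then show ?thesis using E' by linarith
    qed
    also have "\<dots> = real (20 * E * (L * Lr + 1))" by (simp only: of_nat_mult of_nat_add of_nat_1 of_nat_numeral)
    also have "\<dots> \<le> V" using V of_nat_le_iff by blast
    finally have "T * (8 * real E) \<le> T * real V" by (intro mult_left_mono) auto
    then show ?thesis using E' V_pos by (simp add: field_simps)
  qed
  have "V * ((\<Sum>t<T. fr t l) - T * \<gamma> l) = (\<Sum>t<T. V * (fr t l - \<gamma> l))"
    by (simp add: sum_subtractf sum_distrib_left right_diff_distrib)
  also have "\<dots> \<le> (\<Sum>t<T. real_of_int (u t l) + 4)"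
  proof (intro sum_mono)
    fix t
    show "real V * (fr t l - \<gamma> l) \<le> real_of_int (u t l) + 4" using u[OF l, of t] by linarith
  qed
  also have "\<dots> = r + 4 * T" unfolding r_def by (simp add: sum.distrib)
  finally have "(\<Sum>t<T. fr t l) - T * \<gamma> l \<le> r / V + 4 * T / V"
    using V_pos by (simp add: field_simps)
  then have "(\<Sum>t<T. fr t l) \<le> T * (\<gamma> l + 1 / E)" using 1 2 by (simp add: distrib_left)
  then show ?thesis using T_pos by (simp add: divide_le_eq mult.commute)
qed

end

section \<open>The algorithm as a function\<close>

text \<open>\<open>Mi\<close>, \<open>Bi\<close>, \<open>E\<close> are integers above \<open>M\<close>, \<open>B i\<close>, \<open>1 / \<epsilon>\<close>; the grid has step \<open>1 / H\<close>, values are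
  scaled by \<open>V\<close> and multipliers by \<open>S\<close>. Rounding to the grid, inexact minimization and regret cost at
  most \<open>1 / (4 * E)\<close> each, and rounding of the payoffs costs \<open>1 / (5 * E)\<close>. Multipliers up to \<open>Lr\<close> force
  the violation below \<open>1 / E\<close> because all values vary by at most \<open>Mi * Bi\<close>. The numbers of rounds
  are \<open>T\<close> and \<open>Z\<close>.\<close>

locale params =
  fixes N L K Mi Bi E :: nat
begin

definition Lr :: nat where "Lr = 2 * E * (Mi * Bi + 1)"
text \<open>\<open>S * D\<close> is the total weight \<open>L * Lam + S\<close> of the functions
  that enter an objective.\<close>

definition D :: nat where "D = L * Lr + 1"
text \<open>A point of the box is within \<open>3 / H\<close> of the grid, which changes a payoff by
  at most \<open>S * D * Mi * (3 / H)\<close>; the factor 12 makes this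
  \<open>S / (4 * E)\<close>.\<close>

definition H :: nat where "H = 12 * E * D * Mi"
definition nb :: nat where "nb = N * Bi * H"
text \<open>The inner minimization errs by at most \<open>5 * S * D * (nb + 1)\<close> in units of
  \<open>1 / V\<close>, and 20 is 4 times 5.\<close>

definition V :: nat where "V = 20 * E * D * (nb + 1)"
definition U :: nat where "U = V * (Mi * Bi) + 8"
definition S :: nat where "S = 2 * E * L * (1 + U\<^sup>2)"
definition Lam :: nat where "Lam = S * Lr"
definition T :: nat where "T = Lam\<^sup>2"
text \<open>The total weight times the change of one scaled function in a grid step: at most
  \<open>V * Mi\<close>, because \<open>1 / H\<close> is at most 1, plus two rounding errors of
  2.\<close>

definition Wb :: nat where "Wb = (L * Lam + S) * (V * Mi + 4)"
definition Z :: nat where "Z = Wb\<^sup>2"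

end

text \<open>The rounded values are arbitrary here, which separates the analysis of accuracy from the
  verification of the program.\<close>

locale algo = params N L K Mi Bi E for N L K Mi Bi E :: nat +
  fixes l0 :: "(nat \<times> int) list" and fv gv :: "nat \<Rightarrow> rat list \<Rightarrow> int" and gam :: "nat \<Rightarrow> int"
begin

sublocale grid N H Z .

definition objective :: "int list \<Rightarrow> nat \<Rightarrow> rat list \<Rightarrow> int" where
  "objective lam k xs = (\<Sum>i<length lam. lam ! i * fv (Suc i) xs) - int S * gv k xs"

definition origin :: "rat list" where "origin = grid_point N H (\<lambda>_. 0)"

text \<open>The incumbent is carried over from one \<open>k\<close> to the next; all objectives for
  the same multipliers are comparable.\<close>

definition scan :: "int list \<Rightarrow> nat \<Rightarrow> int \<times> rat list \<Rightarrow> int \<times> rat list" where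
  "scan lam k a = snd ((descent_step (objective lam k) ^^ Z) (l0, a))"

definition best :: "int list \<Rightarrow> nat \<Rightarrow> int \<times> rat list" where
  "best lam m = fold (scan lam) [1..<Suc m] (objective lam 1 origin, origin)"

definition ascend :: "int list \<Rightarrow> int list" where
  "ascend lam = map (\<lambda>i. clip Lam (lam ! i +
     (fv (Suc i) (snd (best lam K)) - gam (Suc i)))) [0..<length lam]"

definition multipliers :: "nat \<Rightarrow> int list" where
  "multipliers t = (ascend ^^ t) (replicate L 0)"

definition choice :: "nat \<Rightarrow> rat list" where
  "choice t = snd (best (multipliers t) K)"

lemma length_multipliers [simp]: "length (multipliers t) = L"
  by (induction t) (simp_all add: multipliers_def ascend_def)

lemma multipliers_bounds:
  assumes "i < L" shows "0 \<le> multipliers t ! i" "multipliers t ! i \<le> Lam"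
proof -
  have "0 \<le> multipliers t ! i \<and> multipliers t ! i \<le> Lam"
  proof (cases t)
    case (Suc t')
    have "multipliers t = ascend (multipliers t')" unfolding Suc by (simp add: multipliers_def)
    then show ?thesis using assms by (simp add: ascend_def clip_bounds)
  qed (use assms in \<open>simp add: multipliers_def\<close>)
  then show "0 \<le> multipliers t ! i" "multipliers t ! i \<le> Lam" by auto
qed

definition good_multipliers :: "int list \<Rightarrow> bool" where
  "good_multipliers lam \<longleftrightarrow> length lam = L \<and> (\<forall>i<L. 0 \<le> lam ! i \<and> lam ! i \<le> int Lam)"

lemma good_multipliers_t: "good_multipliers (multipliers t)"
  using multipliers_bounds by (simp add: good_multipliers_def)

lemma best_Suc: "best lam (Suc m) = scan lam (Suc m) (best lam m)"
  by (simp add: best_def)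

end

lemma point_grid: "point N (grid_point N H c) = (\<lambda>i\<in>{1..N}. real (c i) / real H)"
proof -
  have "of_rat (grid_point N H c ! (i - 1)) = real (c i) / real H" if "i \<in> {1..N}" for i
    using that by (auto simp: grid_point_def of_rat_divide simp del: upt_Suc)
  then show ?thesis unfolding point_def by (intro restrict_ext) auto
qed

section \<open>Accuracy of the chosen points\<close>

locale game = algo N L K Mi Bi E l0 fv gv gam + box N B M
  for N L K Mi Bi E :: nat and l0 :: "(nat \<times> int) list" and fv gv :: "nat \<Rightarrow> rat list \<Rightarrow> int"
    and gam :: "nat \<Rightarrow> int" and B :: "nat \<Rightarrow> real" and M :: real +
  fixes f gs :: "nat \<Rightarrow> (nat \<Rightarrow> real) \<Rightarrow> real" and \<gamma> :: "nat \<Rightarrow> real"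
  assumes LK: "1 \<le> L" "1 \<le> K" and E: "1 \<le> E" and Mi: "M \<le> Mi" "1 \<le> Mi"
    and Bi: "\<And>i. i \<in> {1..N} \<Longrightarrow> B i \<le> Bi" "1 \<le> Bi"
    and f: "\<And>l. l \<in> {1..L} \<Longrightarrow> submodular X (f l)" "\<And>l. l \<in> {1..L} \<Longrightarrow> lipschitz_infnorm N M X (f l)"
    and gs: "\<And>k. k \<in> {1..K} \<Longrightarrow> supermodular X (gs k)" "\<And>k. k \<in> {1..K} \<Longrightarrow> lipschitz_infnorm N M X (gs k)"
    and l0: "\<forall>e\<in>set l0. snd e = 0 \<and> fst e \<in> {1..N}"
    and u: "\<And>i. i \<in> {1..N} \<Longrightarrow> count_fst l0 i \<le> B i * H" "\<And>i. i \<in> {1..N} \<Longrightarrow> B i * H \<le> count_fst l0 i + 3"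
    and fv: "\<And>l c. l \<in> {1..L} \<Longrightarrow> c \<le> count_fst l0 \<Longrightarrow>
       \<bar>fv l (grid_point N H c) - V * f l (point N (grid_point N H c))\<bar> \<le> 2"
    and gv: "\<And>k c. k \<in> {1..K} \<Longrightarrow> c \<le> count_fst l0 \<Longrightarrow>
       \<bar>gv k (grid_point N H c) - V * gs k (point N (grid_point N H c))\<bar> \<le> 2"
    and gam: "\<And>l. l \<in> {1..L} \<Longrightarrow> \<bar>gam l - V * \<gamma> l\<bar> \<le> 2"
begin

abbreviation "pt c \<equiv> point N (grid_point N H c)"

definition g :: "(nat \<Rightarrow> real) \<Rightarrow> real" where
  "g = (\<lambda>x. Max ((\<lambda>k. gs k x) ` {1..K}))"

lemma pos: "0 < Lr" "0 < D" "0 < H" "0 < V" "0 < S" "0 < Lam" "0 < T" "0 < Wb" "0 < Z"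
proof -
  show "0 < Lr" unfolding Lr_def using E by (intro mult_pos_pos) auto
  show "0 < D" by (simp add: D_def)
  then show "0 < H" unfolding H_def using E Mi by (intro mult_pos_pos) auto
  show "0 < V" unfolding V_def using E \<open>0 < D\<close> by (intro mult_pos_pos) auto
  show "0 < S" unfolding S_def using E LK by (intro mult_pos_pos) auto
  then show "0 < Lam" unfolding Lam_def using \<open>0 < Lr\<close> by simp
  then show "0 < T" by (simp add: T_def)
  show "0 < Wb" unfolding Wb_def using \<open>0 < S\<close> by (intro mult_pos_pos) auto
  then show "0 < Z" by (simp add: Z_def)
qed

lemma pt_apply: "i \<in> {1..N} \<Longrightarrow> pt c i = real (c i) / H"
  by (simp add: point_grid)

lemma pt_in_X: "c \<le> count_fst l0 \<Longrightarrow> pt c \<in> X"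
proof (rule cuboidI)
  assume c: "c \<le> count_fst l0"
  fix i assume i: "i \<in> {1..N}"
  have "real (c i) \<le> B i * H" using le_funD[OF c, of i] u(1)[OF i] by linarith
  then show "0 \<le> pt c i \<and> pt c i \<le> B i" using pos(3) pt_apply[OF i] by (simp add: divide_le_eq)
qed (simp add: point_def)

text \<open>Scaling by \<open>1 / H\<close> is monotone in each coordinate, so submodularity on the
  box carries over to counts.\<close>

lemma pt_min: "pt (\<lambda>i. min (c i) (d i)) = (\<lambda>i. min (pt c i) (pt d i))"
  and pt_max: "pt (\<lambda>i. max (c i) (d i)) = (\<lambda>i. max (pt c i) (pt d i))"
  using pos(3) by (auto simp: point_grid restrict_def fun_eq_iff min_def max_def divide_le_cancel)

text \<open>Rounding down loses at most one grid step. Near the upper end of the box the count is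
  capped, and the last grid value may be three steps away from \<open>B i\<close>.\<close>

lemma round_to_grid:
  assumes x: "x \<in> X"
  obtains c where "c \<le> count_fst l0" "\<And>i. i \<in> {1..N} \<Longrightarrow> \<bar>x i - pt c i\<bar> \<le> 3 / H"
proof
  define c where "c = (\<lambda>i. if i \<in> {1..N} then min (count_fst l0 i) (nat \<lfloor>x i * H\<rfloor>) else 0)"
  show "c \<le> count_fst l0" by (simp add: c_def le_fun_def)
  fix i assume i: "i \<in> {1..N}"
  have x0: "0 \<le> x i" and xB: "x i \<le> B i" using cuboidD[OF x i] by auto
  have "0 \<le> \<lfloor>x i * H\<rfloor>" using x0 by simp
  then have n: "real (nat \<lfloor>x i * H\<rfloor>) \<le> x i * H" "x i * H \<le> real (nat \<lfloor>x i * H\<rfloor>) + 1" by linarith+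
  have xBH: "x i * H \<le> B i * H" using xB by (intro mult_right_mono) auto
  have ci: "c i = min (count_fst l0 i) (nat \<lfloor>x i * H\<rfloor>)" using i by (simp add: c_def)
  have "real (c i) \<le> x i * H \<and> x i * H \<le> real (c i) + 3"
  proof (cases "count_fst l0 i \<le> nat \<lfloor>x i * H\<rfloor>")
    case True
    then have "c i = count_fst l0 i" using ci by simp
    moreover have "real (count_fst l0 i) \<le> real (nat \<lfloor>x i * H\<rfloor>)" using True by simp
    ultimately show ?thesis using n(1) xBH u(2)[OF i] by linarith
  next
    case False
    then have "c i = nat \<lfloor>x i * H\<rfloor>" using ci by simp
    then show ?thesis using n by linarith
  qed
  then have "\<bar>x i * H - real (c i)\<bar> \<le> 3" by linarith
  moreover have "x i - pt c i = (x i * H - real (c i)) / H"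
    using pos(3) unfolding pt_apply[OF i] by (simp add: diff_divide_distrib)
  then have "\<bar>x i - pt c i\<bar> = \<bar>x i * H - real (c i)\<bar> / H" by (simp add: abs_divide)
  ultimately show "\<bar>x i - pt c i\<bar> \<le> 3 / H" by (simp add: divide_right_mono)
qed

lemma length_l0: "length l0 \<le> nb"
proof -
  have "length l0 = (\<Sum>i\<in>{1..N}. count_fst l0 i)"
  proof -
    have "set (map fst l0) \<subseteq> {1..N}" using l0 by auto
    from sum_count_set[OF this] show ?thesis by simp
  qed
  also have "real \<dots> \<le> (\<Sum>i\<in>{1..N}. real Bi * H)"
    unfolding of_nat_sum
  proof (rule sum_mono)
    fix i assume i: "i \<in> {1..N}"
    have "B i * H \<le> real Bi * H" using Bi(1)[OF i] by (intro mult_right_mono) auto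
    then show "real (count_fst l0 i) \<le> real Bi * H" using u(1)[OF i] by linarith
  qed
  also have "\<dots> = real nb" by (simp add: nb_def)
  finally show ?thesis by simp
qed

text \<open>The Lagrangian scaled by \<open>S\<close>, without the constant terms in \<gamma>. The
  objective is a rounded version of its multiple by \<open>- V\<close>.\<close>

definition payoff :: "int list \<Rightarrow> nat \<Rightarrow> (nat \<Rightarrow> real) \<Rightarrow> real" where
  "payoff lam k x = S * gs k x - (\<Sum>i<L. real_of_int (lam ! i) * f (Suc i) x)"

text \<open>One estimate with three uses: the rounding of function values, the change in a grid
  step, and the distance of a point from the grid.\<close>

lemma weighted_le:
  fixes a :: "nat \<Rightarrow> real" and b e :: real
  assumes lam: "good_multipliers lam" and a: "\<And>i. i < L \<Longrightarrow> \<bar>a i\<bar> \<le> e" and b: "\<bar>b\<bar> \<le> e"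
  shows "\<bar>(\<Sum>i<L. real_of_int (lam ! i) * a i) - S * b\<bar> \<le> (L * Lam + S) * e"
proof -
  have e: "0 \<le> e" using b by linarith
  have "\<bar>\<Sum>i<L. real_of_int (lam ! i) * a i\<bar> \<le> (\<Sum>i<L. \<bar>real_of_int (lam ! i) * a i\<bar>)" by (rule sum_abs)
  also have "\<dots> \<le> (\<Sum>i<L. Lam * e)"
  proof (rule sum_mono)
    fix i assume "i \<in> {..<L}"
    then have i: "i < L" by simp
    have l: "0 \<le> lam ! i" "lam ! i \<le> int Lam" using lam i unfolding good_multipliers_def by auto
    have "\<bar>real_of_int (lam ! i)\<bar> \<le> real Lam" using l by linarith
    then show "\<bar>real_of_int (lam ! i) * a i\<bar> \<le> Lam * e"
      unfolding abs_mult using a[OF i] by (intro mult_mono) auto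
  qed
  finally have 1: "\<bar>\<Sum>i<L. real_of_int (lam ! i) * a i\<bar> \<le> real L * Lam * e" by simp
  have "\<bar>S * b\<bar> \<le> S * e" unfolding abs_mult using b by (simp add: mult_left_mono)
  then show ?thesis using 1 by (simp add: distrib_right)
qed

lemma objective_approx:
  assumes lam: "good_multipliers lam" and k: "k \<in> {1..K}" and c: "c \<le> count_fst l0"
  shows "\<bar>objective lam k (grid_point N H c) - - real V * payoff lam k (pt c)\<bar> \<le> (L * Lam + S) * 2"
proof -
  have len: "length lam = L" using lam by (simp add: good_multipliers_def)
  have "(\<Sum>i<L. real_of_int (lam ! i) * (fv (Suc i) (grid_point N H c) - V * f (Suc i) (pt c)))
      = (\<Sum>i<L. real_of_int (lam ! i) * fv (Suc i) (grid_point N H c))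
        - real V * (\<Sum>i<L. real_of_int (lam ! i) * f (Suc i) (pt c))"
    by (simp add: right_diff_distrib sum_subtractf sum_distrib_left mult.left_commute)
  moreover have "real_of_int (objective lam k (grid_point N H c)) =
      (\<Sum>i<L. real_of_int (lam ! i) * fv (Suc i) (grid_point N H c)) - S * gv k (grid_point N H c)"
    by (simp add: objective_def len)
  ultimately have "(\<Sum>i<L. real_of_int (lam ! i) * (fv (Suc i) (grid_point N H c) - V * f (Suc i) (pt c)))
      - S * (gv k (grid_point N H c) - V * gs k (pt c))
    = objective lam k (grid_point N H c) - - real V * payoff lam k (pt c)"
    unfolding payoff_def by (simp add: algebra_simps)
  then show ?thesis
    using weighted_le[OF lam, of "\<lambda>i. fv (Suc i) (grid_point N H c) - V * f (Suc i) (pt c)" 2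
      "gv k (grid_point N H c) - V * gs k (pt c)"] fv gv[OF k c] c by simp
qed

lemma fv_step:
  fixes h :: "rat list \<Rightarrow> int" and ff :: "(nat \<Rightarrow> real) \<Rightarrow> real"
  assumes h: "\<And>c. c \<le> count_fst l0 \<Longrightarrow> \<bar>h (grid_point N H c) - V * ff (pt c)\<bar> \<le> 2"
    and ff: "lipschitz_infnorm N M X ff" and c: "c(i := Suc (c i)) \<le> count_fst l0"
  shows "\<bar>real_of_int (h (grid_point N H (c(i := Suc (c i)))) - h (grid_point N H c))\<bar> \<le> V * Mi + 4"
proof -
  have c': "c \<le> count_fst l0"
    using c unfolding le_fun_def fun_upd_def by (metis Suc_leD)
  have "\<bar>ff (pt (c(i := Suc (c i)))) - ff (pt c)\<bar> \<le> M * 1"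
  proof (rule lipschitz_infnormD[OF ff pt_in_X[OF c] pt_in_X[OF c'] _ M N])
    fix j assume "j \<in> {1..N}"
    then show "\<bar>pt (c(i := Suc (c i))) j - pt c j\<bar> \<le> 1"
      using pos(3) by (auto simp: pt_apply add_divide_distrib)
  qed
  then have "\<bar>ff (pt (c(i := Suc (c i)))) - ff (pt c)\<bar> \<le> Mi" using Mi by simp
  then have "real V * \<bar>ff (pt (c(i := Suc (c i)))) - ff (pt c)\<bar> \<le> V * Mi" by (simp add: mult_left_mono)
  then have "\<bar>V * ff (pt (c(i := Suc (c i)))) - V * ff (pt c)\<bar> \<le> V * Mi"
    by (simp add: right_diff_distrib[symmetric] abs_mult)
  then show ?thesis using h[OF c] h[OF c'] by simp
qed

lemma objective_step:
  assumes lam: "good_multipliers lam" and k: "k \<in> {1..K}" and c: "c(i := Suc (c i)) \<le> count_fst l0"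
  shows "\<bar>objective lam k (grid_point N H (c(i := Suc (c i)))) - objective lam k (grid_point N H c)\<bar> \<le> int Wb"
proof -
  let ?x = "grid_point N H (c(i := Suc (c i)))" and ?y = "grid_point N H c"
  have len: "length lam = L" using lam by (simp add: good_multipliers_def)
  have f: "\<bar>real_of_int (fv (Suc i) ?x - fv (Suc i) ?y)\<bar> \<le> V * Mi + 4" if "i < L" for i
    by (rule fv_step[OF fv f(2) c]) (use that in auto)
  have g: "\<bar>real_of_int (gv k ?x - gv k ?y)\<bar> \<le> V * Mi + 4"
    by (rule fv_step[OF gv[OF k] gs(2)[OF k] c])
  have "real_of_int (objective lam k ?x - objective lam k ?y) =
      (\<Sum>i<L. real_of_int (lam ! i) * real_of_int (fv (Suc i) ?x - fv (Suc i) ?y)) - S * real_of_int (gv k ?x - gv k ?y)"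
    unfolding objective_def len by (simp add: right_diff_distrib sum_subtractf)
  then have "\<bar>real_of_int (objective lam k ?x - objective lam k ?y)\<bar> \<le> (L * Lam + S) * (V * Mi + 4)"
    using weighted_le[OF lam f g] by simp
  then have "real_of_int \<bar>objective lam k ?x - objective lam k ?y\<bar> \<le> real_of_int (int Wb)"
    unfolding Wb_def by simp
  then show ?thesis by (simp only: of_int_le_iff)
qed

text \<open>Nonnegative multipliers are essential here: in the objective they weight the submodular
  functions, while the supermodular \<open>gs k\<close> carries the negative weight
  \<open>- S\<close>.\<close>

lemma payoff_submod:
  assumes lam: "good_multipliers lam" and k: "k \<in> {1..K}"
  shows "submod_counts (count_fst l0) (\<lambda>c. - real V * payoff lam k (pt c))"
  unfolding submod_counts_def
proof (intro allI impI)
  fix c d assume c: "c \<le> count_fst l0" and d: "d \<le> count_fst l0"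
  let ?m = "\<lambda>i. min (c i) (d i)" and ?M = "\<lambda>i. max (c i) (d i)"
  note X = pt_in_X[OF c] pt_in_X[OF d]
  have 1: "gs k (pt c) + gs k (pt d) \<le> gs k (pt ?m) + gs k (pt ?M)"
    using gs(1)[OF k] X unfolding supermodular_def submodular_def pt_min pt_max by fastforce
  have "(\<Sum>i<L. real_of_int (lam ! i) * (f (Suc i) (pt ?m) + f (Suc i) (pt ?M)))
      \<le> (\<Sum>i<L. real_of_int (lam ! i) * (f (Suc i) (pt c) + f (Suc i) (pt d)))"
  proof (rule sum_mono)
    fix i assume "i \<in> {..<L}"
    then have i: "i < L" "Suc i \<in> {1..L}" by auto
    have "f (Suc i) (pt ?m) + f (Suc i) (pt ?M) \<le> f (Suc i) (pt c) + f (Suc i) (pt d)"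
      using f(1)[OF i(2)] X unfolding submodular_def pt_min pt_max by blast
    moreover have "0 \<le> lam ! i" using lam i unfolding good_multipliers_def by auto
    ultimately show "real_of_int (lam ! i) * (f (Suc i) (pt ?m) + f (Suc i) (pt ?M))
        \<le> real_of_int (lam ! i) * (f (Suc i) (pt c) + f (Suc i) (pt d))" by (intro mult_left_mono) auto
  qed
  moreover have "S * (gs k (pt c) + gs k (pt d)) \<le> S * (gs k (pt ?m) + gs k (pt ?M))"
    using 1 by (intro mult_left_mono) auto
  ultimately have "payoff lam k (pt c) + payoff lam k (pt d) \<le> payoff lam k (pt ?m) + payoff lam k (pt ?M)"
    unfolding payoff_def by (simp add: distrib_left sum.distrib)
  then have "real V * (payoff lam k (pt c) + payoff lam k (pt d)) \<le> real V * (payoff lam k (pt ?m) + payoff lam k (pt ?M))"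
    by (intro mult_left_mono) auto
  then show "- real V * payoff lam k (pt ?m) + - real V * payoff lam k (pt ?M) \<le> - real V * payoff lam k (pt c) + - real V * payoff lam k (pt d)"
    by (simp add: algebra_simps)
qed

abbreviation "\<nu> \<equiv> real ((L * Lam + S) * 2)"

lemma descent_locale:
  assumes "good_multipliers lam" "k \<in> {1..K}"
  shows "grid_descent N H Z (count_fst l0) (objective lam k) (\<lambda>c. - real V * payoff lam k (pt c)) \<nu> Wb"
proof
  show "Z = Wb\<^sup>2" "0 < Z" using pos Z_def by auto
qed (use assms payoff_submod objective_approx objective_step in auto)

lemma ok_l0:
  assumes "good_multipliers lam" "k \<in> {1..K}"
  shows "grid_descent.ok_list Z (count_fst l0) (length l0) l0"
proof -
  interpret grid_descent N H Z "count_fst l0" "objective lam k" "\<lambda>c. - real V * payoff lam k (pt c)" \<nu> Wb "length l0"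
    by (rule descent_locale[OF assms])
  have "descending l0" using l0 by (auto simp: sorted_wrt_iff_nth_less)
  then show ?thesis using l0 unfolding ok_list_def by auto
qed

text \<open>Ties the recorded value to the recorded point through some \<open>k\<close>, so that a
  small recorded value certifies a large payoff at that point.\<close>

definition grid_value :: "int list \<Rightarrow> int \<times> rat list \<Rightarrow> bool" where
  "grid_value lam a \<longleftrightarrow> (\<exists>k\<in>{1..K}. \<exists>c\<le>count_fst l0. a = (objective lam k (grid_point N H c), grid_point N H c))"

lemma scan:
  assumes lam: "good_multipliers lam" and k: "k \<in> {1..K}"
  shows "grid_value lam a \<Longrightarrow> grid_value lam (scan lam k a)"
    and "fst (scan lam k a) \<le> fst a"
    and "c \<le> count_fst l0 \<Longrightarrow> fst (scan lam k a) \<le> - real V * payoff lam k (pt c) + \<nu> * (2 * length l0 + 1) + length l0"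
proof -
  interpret grid_descent N H Z "count_fst l0" "objective lam k" "\<lambda>c. - real V * payoff lam k (pt c)" \<nu> Wb "length l0"
    by (rule descent_locale[OF lam k])
  obtain l' a' where r: "(l', a') = (descent_step (objective lam k) ^^ Z) (l0, a)" by (metis surj_pair)
  have s: "scan lam k a = a'" unfolding scan_def r[symmetric] by simp
  have ok: "ok_list l0" by (rule ok_l0[OF lam k])
  have z: "(\<lambda>_. 0) \<le> count_fst l0" by (simp add: le_fun_def)
  show "grid_value lam a \<Longrightarrow> grid_value lam (scan lam k a)"
    using descent(2)[OF ok r z] k unfolding s grid_value_def by blast
  show "fst (scan lam k a) \<le> fst a"
    using descent(3)[OF ok r z] unfolding s .
  assume c: "c \<le> count_fst l0"
  show "fst (scan lam k a) \<le> - real V * payoff lam k (pt c) + \<nu> * (2 * length l0 + 1) + length l0"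
    unfolding s using descent_optimal[OF ok r c] l0 by simp
qed

lemma best:
  assumes lam: "good_multipliers lam"
  shows "m \<le> K \<Longrightarrow> grid_value lam (best lam m)"
    and "m \<le> K \<Longrightarrow> k \<in> {1..m} \<Longrightarrow> c \<le> count_fst l0 \<Longrightarrow>
       fst (best lam m) \<le> - real V * payoff lam k (pt c) + \<nu> * (2 * length l0 + 1) + length l0"
proof -
  have "(m \<le> K \<longrightarrow> grid_value lam (best lam m)) \<and>
    (m \<le> K \<longrightarrow> k \<in> {1..m} \<longrightarrow> c \<le> count_fst l0 \<longrightarrow>
       fst (best lam m) \<le> - real V * payoff lam k (pt c) + \<nu> * (2 * length l0 + 1) + length l0)"
  proof (induction m)
    case 0
    have "grid_value lam (best lam 0)"
      using LK unfolding grid_value_def best_def origin_def by (auto simp: le_fun_def intro!: bexI[of _ 1])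
    then show ?case by simp
  next
    case (Suc m)
    show ?case
    proof (intro conjI impI)
      assume "Suc m \<le> K"
      then show "grid_value lam (best lam (Suc m))"
        unfolding best_Suc using Suc by (intro scan(1)[OF lam]) auto
    next
      assume m: "Suc m \<le> K" "k \<in> {1..Suc m}" "c \<le> count_fst l0"
      show "fst (best lam (Suc m)) \<le> - real V * payoff lam k (pt c) + \<nu> * (2 * length l0 + 1) + length l0"
      proof (cases "k = Suc m")
        case True
        then show ?thesis unfolding best_Suc using m scan(3)[OF lam, of "Suc m" c "best lam m"] by simp
      next
        case False
        have "fst (best lam (Suc m)) \<le> fst (best lam m)"
          unfolding best_Suc using m by (intro scan(2)[OF lam]) auto
        then show ?thesis using Suc m False by auto
      qed
    qed
  qed
  then show "m \<le> K \<Longrightarrow> grid_value lam (best lam m)"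
    and "m \<le> K \<Longrightarrow> k \<in> {1..m} \<Longrightarrow> c \<le> count_fst l0 \<Longrightarrow>
       fst (best lam m) \<le> - real V * payoff lam k (pt c) + \<nu> * (2 * length l0 + 1) + length l0"
    by auto
qed

lemma gs_le_g: "k \<in> {1..K} \<Longrightarrow> gs k x \<le> g x"
  unfolding g_def by (intro Max_ge) auto

text \<open>Passing from \<open>y\<close> to a nearby grid point costs \<open>S / (4 * E)\<close>,
  and passing from there to the recorded point costs the same again. The recorded payoff belongs to
  some \<open>k'\<close>, and \<open>gs k'\<close> is at most \<open>g\<close>, so the right-hand
  side serves every \<open>k\<close>.\<close>

lemma payoff_optimal:
  assumes lam: "good_multipliers lam" and y: "y \<in> X" and k: "k \<in> {1..K}"
  shows "payoff lam k y \<le> S * g (point N (snd (best lam K)))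
     - (\<Sum>i<L. real_of_int (lam ! i) * f (Suc i) (point N (snd (best lam K)))) + S / (2 * E)"
proof -
  obtain k' c' where k': "k' \<in> {1..K}" and c': "c' \<le> count_fst l0"
    and b: "best lam K = (objective lam k' (grid_point N H c'), grid_point N H c')"
    using best(1)[OF lam, of K] unfolding grid_value_def by auto
  obtain c where c: "c \<le> count_fst l0" and r: "\<And>i. i \<in> {1..N} \<Longrightarrow> \<bar>y i - pt c i\<bar> \<le> 3 / H"
    using round_to_grid[OF y] by blast
  have E': "1 \<le> real E" and Mi': "1 \<le> real Mi" using E Mi by auto
  have D': "real (L * Lam + S) = S * D" unfolding Lam_def D_def by (simp add: algebra_simps)
  have 1: "payoff lam k y - payoff lam k (pt c) \<le> S / (4 * E)"
  proof -
    have l: "\<bar>h (pt c) - h y\<bar> \<le> M * (3 / H)" if "lipschitz_infnorm N M X h" for h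
      by (rule lipschitz_infnormD[OF that pt_in_X[OF c] y _ M N]) (use r in \<open>simp add: abs_minus_commute\<close>)
    have "payoff lam k y - payoff lam k (pt c) =
        (\<Sum>i<L. real_of_int (lam ! i) * (f (Suc i) (pt c) - f (Suc i) y)) - S * (gs k (pt c) - gs k y)"
      unfolding payoff_def by (simp add: right_diff_distrib sum_subtractf)
    also have "\<dots> \<le> (L * Lam + S) * (M * (3 / H))"
      using weighted_le[OF lam, of "\<lambda>i. f (Suc i) (pt c) - f (Suc i) y" "M * (3 / H)" "gs k (pt c) - gs k y"]
        l f(2) gs(2)[OF k] by simp
    also have "\<dots> \<le> (L * Lam + S) * (Mi * (3 / H))"
      using Mi by (intro mult_left_mono mult_right_mono) auto
    also have "\<dots> = S / (4 * E)"
      unfolding D' using E' Mi' pos(2) by (simp add: H_def)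
    finally show ?thesis .
  qed
  \<comment> \<open>The descent accounts for \<open>2 * length l0 + 1\<close> errors \<nu>; one more
    arises when the payoff of the recorded point is read off its rounded objective.\<close>
  have "\<nu> * (2 * length l0 + 2) + length l0 \<le> \<nu> * (2 * nb + 2) + nb"
    using length_l0 by (intro add_mono mult_left_mono) auto
  also have "\<dots> \<le> S * D * (5 * (nb + 1))"
  proof -
    have "1 \<le> S * D" using pos by (simp add: Suc_le_eq)
    moreover have "2 * q * (2 * nb + 2) + nb \<le> q * (5 * (nb + 1))" if "1 \<le> q" for q
    proof -
      have "nb \<le> q * nb" using that by (cases q) auto
      moreover have "2 * q * (2 * nb + 2) = 4 * (q * nb) + 4 * q" "q * (5 * (nb + 1)) = 5 * (q * nb) + 5 * q"
        by (simp_all add: algebra_simps)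
      ultimately show ?thesis by linarith
    qed
    ultimately have "2 * (S * D) * (2 * nb + 2) + nb \<le> S * D * (5 * (nb + 1))" by blast
    then have "real (2 * (S * D) * (2 * nb + 2) + nb) \<le> real (S * D * (5 * (nb + 1)))"
      by (simp only: of_nat_le_iff)
    moreover have nu: "\<nu> = real (2 * (S * D))" using D' by simp
    have "\<nu> * (2 * nb + 2) + nb = real (2 * (S * D) * (2 * nb + 2) + nb)"
      unfolding nu by (simp only: of_nat_mult of_nat_add)
    ultimately show ?thesis by (simp only:)
  qed
  also have "real (S * D * (5 * (nb + 1))) = V * (S / (4 * E))"
  proof -
    have V': "real V = 4 * real E * (5 * (real D * (real nb + 1)))" by (simp add: V_def algebra_simps)
    have "V * (S / (4 * E)) = S * (5 * (real D * (real nb + 1)))" unfolding V' using E' by simp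
    then show ?thesis by (simp add: mult.assoc mult.left_commute)
  qed
  finally have r: "\<nu> * (2 * length l0 + 2) + length l0 \<le> V * (S / (4 * E))" .
  have "real V * payoff lam k (pt c) \<le> real V * payoff lam k' (pt c') + \<nu> * (2 * length l0 + 2) + length l0"
    using best(2)[OF lam order_refl k c] objective_approx[OF lam k' c'] b by (simp add: algebra_simps)
  then have "real V * payoff lam k (pt c) \<le> real V * (payoff lam k' (pt c') + S / (4 * E))"
    using r by (simp add: distrib_left)
  then have 2: "payoff lam k (pt c) \<le> payoff lam k' (pt c') + S / (4 * E)" using pos(4) by simp
  have "S * gs k' (pt c') \<le> S * g (pt c')" using gs_le_g[OF k'] by (intro mult_left_mono) auto
  then have "payoff lam k' (pt c') \<le> S * g (pt c') - (\<Sum>i<L. real_of_int (lam ! i) * f (Suc i) (pt c'))"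
    unfolding payoff_def by simp
  moreover have "S / (4 * E) + S / (4 * E) = S / (2 * E)" using E' by (simp add: field_simps)
  ultimately show ?thesis using 1 2 b by simp
qed

end

section \<open>The program\<close>

text \<open>Further registers: 0 \<open>N\<close> and the result, 1 \<open>L\<close>, 2 \<open>K\<close>, 4 the output precision, 12 \<open>H\<close>, 13 \<open>V\<close>, 14 \<open>S\<close>,
  15 \<open>Lam\<close>, 16 \<open>T\<close>, 17 \<open>Z\<close>, 18 the origin, 19 the initial list of elements, 20 the multipliers, 21 the
  sum of the values, 23 \<open>k\<close>, 24 the sorted list, 26 the current point, 27 its objective, 29 the
  updated list, 32 and 33 the best objective and point, 37 the objective just computed. Lists
  consumed by a loop, loop variables and counters are in the other registers.\<close>

definition objective_prog :: prog where
  "objective_prog = block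
    [Assign 7 (Reg 13),
     Assign 5 (MkPair (Const 7) (Reg 23)),
     eval_prog,
     Assign 37 (Sub (Const 0) (Mul (Reg 14) (Floor (Mul (Reg 13) (Reg 8))))),
     Assign 36 (Const 1),
     Assign 34 (Reg 20),
     for_each 34 35 (block
       [Assign 5 (MkPair (Const 6) (Reg 36)),
        eval_prog,
        Assign 37 (Add (Reg 37) (Mul (Reg 35) (Floor (Mul (Reg 13) (Reg 8))))),
        Assign 36 (Add (Reg 36) (Const 1))])]"

definition visit_prog :: prog where
  "visit_prog = block
    [Assign 6 (Reg 26),
     objective_prog,
     Cond (Leq (Reg 32) (Reg 37)) (Assign 37 (Reg 37))
       (block [Assign 32 (Reg 37), Assign 33 (Reg 6)])]"

text \<open>A product of two comparisons tests whether the counter equals the label. The new list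
  comes out reversed and is moved back.\<close>

definition bump_prog :: prog where
  "bump_prog = block
    [Assign 40 (Const 1),
     Assign 41 (Const 0),
     for_each 26 39 (block
       [Cond (Mul (Leq (Reg 40) (Fst (Reg 31))) (Leq (Fst (Reg 31)) (Reg 40)))
          (Assign 39 (Add (Reg 39) (Div (Const 1) (Reg 12)))) (Assign 39 (Reg 39)),
        Assign 41 (MkPair (Reg 39) (Reg 41)),
        Assign 40 (Add (Reg 40) (Const 1))]),
     move 41 26]"

section \<open>Sizes of the numbers in the program, and the evaluation of an objective\<close>

lemma bits_fraction:
  assumes "m \<le> n" "0 < h"
  shows "bits (Num (of_nat m / of_nat h)) \<le> n + 2 * h + 3"
proof (rule bits_Num_le)
  have h1: "(1 :: rat) \<le> of_nat h" using assms(2) by simp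
  have "\<bar>of_nat m / of_nat h :: rat\<bar> \<le> of_nat m"
    using h1 by (simp add: divide_le_eq mult_le_cancel_left1)
  also have "\<dots> \<le> of_nat n" using assms by simp
  also have "\<dots> \<le> 2 ^ n" by (simp add: of_nat_less_two_power less_imp_le)
  finally show "\<bar>of_nat m / of_nat h :: rat\<bar> \<le> 2 ^ n" .
  have "dnm (of_nat m / of_nat h) \<le> int h"
    using dnm_le[of _ "int m" "int h"] assms(2) by simp
  also have "\<dots> \<le> 2 ^ h" by (simp add: of_nat_less_two_power less_imp_le)
  finally show "dnm (of_nat m / of_nat h) \<le> 2 ^ h" .
qed

locale machine = oracle_meter ans tm b ot T\<^sub>0 d pb pr first + params N L K Mi Bi E
  for ans :: "val \<Rightarrow> rat" and tm :: "val \<Rightarrow> nat" and b ot T\<^sub>0 d pb pr first N L K Mi Bi E :: nat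
begin

definition callable :: "source \<Rightarrow> rat list \<Rightarrow> bool" where
  "callable h xs \<longleftrightarrow> (\<exists>D v. poly_time_oracle ans tm T\<^sub>0 d h D v \<and> xs \<in> D \<and> bits (list_val xs) \<le> pb)"

definition fv :: "nat \<Rightarrow> rat list \<Rightarrow> int" where "fv l xs = \<lfloor>of_nat V * eval_abs ans (Src_f l) xs V\<rfloor>"
definition gv :: "nat \<Rightarrow> rat list \<Rightarrow> int" where "gv k xs = \<lfloor>of_nat V * eval_abs ans (Src_g k) xs V\<rfloor>"
definition gam :: "nat \<Rightarrow> int" where "gam l = \<lfloor>of_nat V * eval_abs ans (Src_gamma l) [] V\<rfloor>"
text \<open>Subtracting 1 keeps the grid inside the box in spite of the error of the oracle.\<close>

definition nsteps :: "nat \<Rightarrow> int" where "nsteps i = \<lfloor>of_nat H * eval_abs ans (Src_B i) [] V\<rfloor> - 1"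

definition l0 :: "(nat \<times> int) list" where
  "l0 = fold (\<lambda>i l. replicate (nat (nsteps i)) (i, 0) @ l) [1..<Suc N] []"

sublocale algo N L K Mi Bi E l0 fv gv gam .

text \<open>An exponent: partial sums of objectives stay below \<open>2 ^ mag\<close> in absolute
  value.\<close>

definition mag :: nat where "mag = S + L * Lam + V + ot + 1"

lemma callable_bits: "callable h xs \<Longrightarrow> n \<le> pr \<Longrightarrow> bits (Num (eval_abs ans h xs n)) \<le> ot"
  unfolding callable_def using bits_eval_abs by blast

lemma W_eval':
  assumes "fits s" "callable h xs" "s 5 = source_val h" "s 6 = list_val xs" "s 7 = nat_val n" "n \<le> pr"
    "\<And>s'. fits s' \<Longrightarrow> s' 8 = Num (eval_abs ans h xs n) \<Longrightarrow> \<forall>x. x \<notin> {8,9,10,11} \<longrightarrow> s' x = s x \<Longrightarrow> Q s'"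
  shows "W eval_prog (3 * first + 8) Q s"
  using assms W_eval[OF assms(1)] unfolding callable_def by blast

lemma floor_scaled:
  assumes "bits (Num q) \<le> ot" shows "\<bar>\<lfloor>of_nat V * q\<rfloor>\<bar> \<le> 2 ^ (V + ot + 1)"
proof -
  have "\<bar>of_nat V * q\<bar> \<le> 2 ^ V * 2 ^ ot"
    unfolding abs_mult using bits_NumD(1)[OF assms] 
    by (intro mult_mono) (auto simp: of_nat_less_two_power less_imp_le)
  also have "\<dots> = 2 ^ (V + ot)" by (simp add: power_add)
  finally have "of_int \<bar>\<lfloor>of_nat V * q\<rfloor>\<bar> \<le> (2 :: rat) ^ (V + ot) + 1" by linarith
  also have "\<dots> \<le> 2 ^ (V + ot) + 2 ^ (V + ot)" by (intro add_left_mono one_le_power) simp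
  also have "\<dots> = of_int (2 ^ (V + ot + 1))" by simp
  finally show ?thesis by (simp only: of_int_le_iff)
qed

end

text \<open>All requirements on the register size are collected in \<open>b_big\<close>, so that
  each single bound reduces to linear arithmetic. The terms \<open>2 * (T * ot) + 3 * T + ot\<close>
  are for the average of the values, whose denominator may be a product of \<open>T\<close> oracle
  denominators and \<open>T\<close>.\<close>

locale machine_ctx = machine +
  assumes pr: "V \<le> pr"
    and b_big: "mag + Z + 2 * (T * ot) + 3 * T + ot + pb + nb * (N + Z + 8) + L * (Lam + 4) + Lam + K + L + N
       + H + V + S + Mi + Bi + E + Lr + D + pr + first + 100 \<le> b"
    and call_f: "\<And>l c. l \<in> {1..L} \<Longrightarrow> c \<le> count_fst l0 \<Longrightarrow> callable (Src_f l) (grid_point N H c)"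
    and call_g: "\<And>k c. k \<in> {1..K} \<Longrightarrow> c \<le> count_fst l0 \<Longrightarrow> callable (Src_g k) (grid_point N H c)"
    and call_gamma: "\<And>l. l \<in> {1..L} \<Longrightarrow> callable (Src_gamma l) []"
    and call_B: "\<And>i. i \<in> {1..N} \<Longrightarrow> callable (Src_B i) []"
    and length_l0: "length l0 \<le> nb"
    and fst_l0: "\<And>e. e \<in> set l0 \<Longrightarrow> fst e \<in> {1..N}"
    and pos: "1 \<le> N" "1 \<le> L" "1 \<le> K" "0 < H" "0 < T"
begin

lemma mag_le: "mag + Z + 50 \<le> b" using b_big by linarith

lemma bits_nat_le: "n + 5 \<le> b \<Longrightarrow> bits (nat_val n) \<le> b" using bits_nat_val[of n] by linarith

lemma scaled_bits:
  assumes "bits (Num q) \<le> ot" shows "bits (Num (of_int \<lfloor>of_nat V * q\<rfloor>)) \<le> b"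
  using bits_of_int_le[OF floor_scaled[OF assms]] mag_le by (simp add: mag_def)

text \<open>The content of register 37 after \<open>m\<close> constraints; the term of
  \<open>gv\<close> comes first because the loop only adds.\<close>

definition partial_objective :: "int list \<Rightarrow> nat \<Rightarrow> rat list \<Rightarrow> nat \<Rightarrow> int" where
  "partial_objective lam k xs m = - (int S * gv k xs) + (\<Sum>i<m. lam ! i * fv (Suc i) xs)"

lemma partial_objective_bound:
  assumes lam: "good_multipliers lam" and k: "k \<in> {1..K}" and c: "c \<le> count_fst l0" and m: "m \<le> L"
  shows "\<bar>partial_objective lam k (grid_point N H c) m\<bar> \<le> 2 ^ mag"
proof -
  let ?x = "grid_point N H c" and ?e = "2 ^ (V + ot + 1) :: int"
  have "\<bar>gv k ?x\<bar> \<le> ?e" unfolding gv_def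
    using floor_scaled callable_bits[OF call_g[OF k c] pr] by blast
  then have g: "\<bar>int S * gv k ?x\<bar> \<le> int S * ?e" unfolding abs_mult by (simp add: mult_left_mono)
  have "\<bar>\<Sum>i<m. lam ! i * fv (Suc i) ?x\<bar> \<le> (\<Sum>i<m. \<bar>lam ! i * fv (Suc i) ?x\<bar>)" by (rule sum_abs)
  also have "\<dots> \<le> (\<Sum>i<m. int Lam * ?e)"
  proof (rule sum_mono)
    fix i assume "i \<in> {..<m}"
    then have i: "i < L" "Suc i \<in> {1..L}" using m by auto
    have "\<bar>fv (Suc i) ?x\<bar> \<le> ?e" unfolding fv_def
      using floor_scaled callable_bits[OF call_f[OF i(2) c] pr] by blast
    moreover have "\<bar>lam ! i\<bar> \<le> int Lam" using lam i unfolding good_multipliers_def by auto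
    ultimately show "\<bar>lam ! i * fv (Suc i) ?x\<bar> \<le> int Lam * ?e" unfolding abs_mult by (intro mult_mono) auto
  qed
  also have "\<dots> = int m * (int Lam * ?e)" by simp
  also have "\<dots> \<le> int L * (int Lam * ?e)" using m by (intro mult_right_mono) auto
  finally have "\<bar>partial_objective lam k ?x m\<bar> \<le> int (S + L * Lam) * ?e"
    unfolding partial_objective_def using g by (simp add: distrib_right mult.assoc)
  also have "\<dots> \<le> 2 ^ (S + L * Lam) * ?e"
    by (intro mult_right_mono) (simp_all only: of_nat_le_numeral_power_cancel_iff less_imp_le[OF less_exp] zero_le_numeral zero_le_power)
  also have "\<dots> = 2 ^ mag" unfolding power_add[symmetric] mag_def by (simp only: add.assoc)
  finally show ?thesis .
qed

lemma partial_objective_bits: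
  assumes "good_multipliers lam" "k \<in> {1..K}" "c \<le> count_fst l0" "m \<le> L"
  shows "bits (Num (of_int (partial_objective lam k (grid_point N H c) m))) \<le> b"
  using bits_of_int_le[OF partial_objective_bound[OF assms]] mag_le by linarith

lemma objective_eq: "length lam = L \<Longrightarrow> objective lam k xs = partial_objective lam k xs L"
  by (simp add: objective_def partial_objective_def)

definition obj_cost :: nat where "obj_cost = L * (3 * first + 14) + 3 * first + 20"

abbreviation enc_ints :: "int list \<Rightarrow> val" where "enc_ints l \<equiv> enc (map (\<lambda>z. Num (of_int z)) l)"

text \<open>The continuation premise \<open>Q\<close> lists the registers that may have changed. The
  rules for the other subprograms follow this pattern, so that constants in the remaining registers
  survive.\<close>

lemma W_objective:
  assumes s: "fits s" and lam: "good_multipliers lam" and k: "k \<in> {1..K}" and c: "c \<le> count_fst l0"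
    and r: "s 6 = list_val (grid_point N H c)" "s 13 = nat_val V" "s 14 = nat_val S"
      "s 20 = enc_ints lam" "s 23 = nat_val k"
    and Q: "\<And>s'. fits s' \<Longrightarrow> s' 37 = Num (of_int (objective lam k (grid_point N H c))) \<Longrightarrow>
       \<forall>x. x \<notin> {5,7,8,9,10,11,34,35,36,37} \<longrightarrow> s' x = s x \<Longrightarrow> Q s'"
  shows "W objective_prog obj_cost Q s"
proof -
  let ?x = "grid_point N H c"
  let ?body = "block
       [Assign 5 (MkPair (Const 6) (Reg 36)),
        eval_prog,
        Assign 37 (Add (Reg 37) (Mul (Reg 35) (Floor (Mul (Reg 13) (Reg 8))))),
        Assign 36 (Add (Reg 36) (Const 1))]"
  let ?A = "{5,7,8,9,10,11,34,35,36,37} :: nat set"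
  have len: "length lam = L" using lam by (simp add: good_multipliers_def)
  define J where "J = (\<lambda>m s'. s' 37 = Num (of_int (partial_objective lam k ?x m)) \<and> s' 36 = nat_val (Suc m) \<and>
    s' 7 = nat_val V \<and> (\<forall>x. x \<notin> ?A \<longrightarrow> s' x = s x))"
  have body: "W ?body (3 * first + 11) (\<lambda>s'. s' 34 = enc (drop (Suc m) (map (\<lambda>z. Num (of_int z)) lam)) \<and> J (Suc m) s')
      (s1(35 := Num (of_int (lam ! m)), 34 := enc (drop (Suc m) (map (\<lambda>z. Num (of_int z)) lam))))"
    if m: "m < L" and J: "J m s1"
      and f: "fits (s1(35 := Num (of_int (lam ! m)), 34 := enc (drop (Suc m) (map (\<lambda>z. Num (of_int z)) lam))))"
      (is "fits ?s1") for m s1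
  proof -
    have l: "Suc m \<in> {1..L}" using m by auto
    have bs: "bits (val.Pair (Num 6) (nat_val (Suc m))) \<le> b"
      using bits_nat_val[of "Suc m"] m b_big by simp
    have bn: "bits (nat_val (Suc (Suc m))) \<le> b" using m b_big by (intro bits_nat_le) linarith
    have c37: "of_int (partial_objective lam k ?x m) + of_int (lam ! m) * of_int (fv (Suc m) ?x) =
        (of_int (partial_objective lam k ?x (Suc m)) :: rat)" by (simp add: partial_objective_def)
    show ?thesis
      apply (rule W_weaken)
       apply (rule W_assign_then[where v = "val.Pair (Num 6) (nat_val (Suc m))"])
           apply (rule f)
          apply simp
         using J apply (simp add: J_def)
        apply (rule bs)
       apply (rule W_block[OF _ refl])
       apply (rule W_eval'[OF _ call_f[OF l c] _ _ _ pr])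
           apply assumption
          apply simp
         using J r apply (simp add: J_def)
        using J apply (simp add: J_def)
       apply (rule W_assign_then[where v = "Num (of_int (partial_objective lam k ?x (Suc m)))"])
           apply assumption
          apply simp
         using J r apply (simp add: J_def c37 fv_def[symmetric])
        apply (rule partial_objective_bits[OF lam k c]) using m apply simp
       apply (rule W_assign_last[where v = "nat_val (Suc (Suc m))"])
           apply assumption
          apply simp
         using J apply (simp add: J_def)
        apply (rule bn)
       using J apply (simp add: J_def)
      apply simp
      done
  qed
  have bs: "bits (val.Pair (Num 7) (nat_val k)) \<le> b"
    using bits_nat_val[of k] k b_big by simp
  have b0: "bits (Num (of_int (partial_objective lam k ?x 0))) \<le> b"
    by (rule partial_objective_bits[OF lam k c]) simp
  have c0: "- (of_nat S * of_int (gv k ?x)) = (of_int (partial_objective lam k ?x 0) :: rat)"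
    by (simp add: partial_objective_def)
  have bV: "bits (nat_val V) \<le> b" using b_big by (intro bits_nat_le) linarith
  show ?thesis unfolding objective_prog_def obj_cost_def
    apply (rule W_weaken)
     apply (rule W_assign_then[where v = "nat_val V"])
         apply (rule s)
        apply simp
       using r apply simp
      apply (rule bV)
     apply (rule W_assign_then[where v = "val.Pair (Num 7) (nat_val k)"])
         apply assumption
        apply simp
       using r apply simp
      apply (rule bs)
     apply (rule W_block[OF _ refl])
     apply (rule W_eval'[OF _ call_g[OF k c] _ _ _ pr])
         apply assumption
        apply simp
       using r apply simp
      apply simp
     apply (rule W_assign_then[where v = "Num (of_int (partial_objective lam k ?x 0))"])
         apply assumption
        apply simp
       using r apply (simp add: c0 gv_def[symmetric])
      apply (rule b0)
     apply (rule W_assign_then[where v = "nat_val 1"])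
         apply assumption
        apply simp
       apply simp
      using mag_le apply simp
     apply (rule W_assign_then[where v = "enc_ints lam"])
         apply assumption
        apply simp
       using r apply simp
      using fitsD[OF s, of 20] r apply simp
     apply simp
     apply (rule W_for_each[where J = J and xs = "map (\<lambda>z. Num (of_int z)) lam" and k = "3 * first + 11"])
          apply assumption
         apply simp
        apply simp
       apply (simp add: J_def)
      using body len apply simp
     using Q apply (simp add: J_def len objective_eq)
    apply (simp add: len algebra_simps)
    done
qed

end

section \<open>Programs for sorting, sweeping and minimizing\<close>

definition clip_prog :: "nat \<Rightarrow> nat \<Rightarrow> prog" where
  "clip_prog r n = Cond (Leq (Reg r) (Const 0)) (Assign r (Const 0))
     (Cond (Leq (Reg n) (Reg r)) (Assign r (Reg n)) (Assign r (Reg r)))"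

text \<open>Both factors of the test are always evaluated, but operations are total and
  \<open>IsPair\<close> yields 0 on an empty list, so default values in the other factor do no harm.
  Larger elements are stacked in register 44 and then moved back.\<close>

definition insert_prog :: prog where
  "insert_prog = block
    [Assign 44 (Const 0),
     Loop (Mul (IsPair (Reg 24)) (Sub (Const 1) (Leq (Snd (Fst (Reg 24))) (Snd (Reg 43)))))
       (block [Assign 44 (MkPair (Fst (Reg 24)) (Reg 44)), Assign 24 (Snd (Reg 24))]),
     Assign 24 (MkPair (Reg 43) (Reg 24)),
     move 44 24]"

definition sweep_prog :: prog where
  "sweep_prog = for_each 30 31 (block
    [bump_prog,
     visit_prog,
     Assign 28 (Sub (Snd (Reg 31)) (Sub (Reg 37) (Reg 27))),
     clip_prog 28 17,
     Assign 29 (MkPair (MkPair (Fst (Reg 31)) (Reg 28)) (Reg 29)),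
     Assign 27 (Reg 37)])"

text \<open>A sweep visits only nonempty prefixes, so the origin is visited before it. The updated
  list in register 29 is reversed, which is the order of insertion prescribed by the right fold in
  \<open>sort_desc\<close>.\<close>

definition descent_prog :: prog where
  "descent_prog = block
    [Assign 26 (Reg 18),
     visit_prog,
     Assign 27 (Reg 37),
     Assign 29 (Const 0),
     Assign 30 (Reg 24),
     sweep_prog,
     Assign 24 (Const 0),
     for_each 29 43 insert_prog]"

definition scan_prog :: prog where
  "scan_prog = block [Assign 24 (Reg 19), for_loop 25 17 descent_prog]"

definition best_prog :: prog where
  "best_prog = block
    [Assign 23 (Const 1),
     Assign 6 (Reg 18),
     objective_prog,
     Assign 32 (Reg 37),
     Assign 33 (Reg 6),
     for_loop 23 2 scan_prog]"

abbreviation enc_pair :: "nat \<times> int \<Rightarrow> val" where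
  "enc_pair e \<equiv> val.Pair (nat_val (fst e)) (Num (of_int (snd e)))"

abbreviation enc_pairs :: "(nat \<times> int) list \<Rightarrow> val" where
  "enc_pairs l \<equiv> enc (map enc_pair l)"

lemma bits_enc_rev_take: "bits (enc (rev (take m l))) \<le> bits (enc l)"
proof -
  have "bits (enc l) = bits (enc (rev (take m l))) + (\<Sum>v\<leftarrow>drop m l. 1 + bits v)"
    unfolding bits_enc by (subst (1) append_take_drop_id[symmetric, of l m])
      (simp only: map_append sum_list_append rev_map[symmetric] sum_list_rev)
  then show ?thesis by simp
qed

context meter
begin

lemma W_clip:
  assumes s: "fits s" and r: "s r = Num (of_int z)" "s n = nat_val k" "r \<noteq> n"
    and Q: "fits (s(r := Num (of_int (clip (int k) z)))) \<Longrightarrow> Q (s(r := Num (of_int (clip (int k) z))))"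
  shows "W (clip_prog r n) 3 Q s"
proof -
  have le: "((of_int z :: rat) \<le> 0) = (z \<le> 0)" "((of_nat k :: rat) \<le> of_int z) = (int k \<le> z)"
    using of_int_le_iff[of "int k" z, where 'a = rat] by simp_all
  have b0: "bits (Num 0) \<le> b" using fitsD[OF s, of 0] bits_ge2[of "s 0"] by simp
  have "W (clip_prog r n) (1 + 2) Q s" unfolding clip_prog_def
  proof (rule W_cond[OF s])
    assume c: "denote (Leq (Reg r) (Const 0)) s \<noteq> Num 0"
    then have "z \<le> 0" using r le by (simp split: if_splits)
    then have cl: "clip (int k) z = 0" by (simp add: clip_def)
    show "W (Assign r (Const 0)) 2 Q s"
      by (rule W_weaken, rule W_assign'[OF s, where v = "Num 0"]) (use Q b0 cl in simp_all)
  next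
    assume c: "denote (Leq (Reg r) (Const 0)) s = Num 0"
    then have z: "0 < z" using r le by (simp split: if_splits)
    have "W (Cond (Leq (Reg n) (Reg r)) (Assign r (Reg n)) (Assign r (Reg r))) (1 + 1) Q s"
    proof (rule W_cond[OF s])
      assume "denote (Leq (Reg n) (Reg r)) s \<noteq> Num 0"
      then have "int k \<le> z" using r le by (simp split: if_splits)
      then have "clip (int k) z = int k" by (simp add: clip_def)
      then show "W (Assign r (Reg n)) 1 Q s"
        by (intro W_assign'[OF s, where v = "nat_val k"]) (use Q r fitsD[OF s, of n] in simp_all)
    next
      assume "denote (Leq (Reg n) (Reg r)) s = Num 0"
      then have "z < int k" using r le by (simp split: if_splits)
      then have "clip (int k) z = z" using z by (simp add: clip_def)
      then show "W (Assign r (Reg r)) 1 Q s"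
        by (intro W_assign'[OF s, where v = "Num (of_int z)"]) (use Q r fitsD[OF s, of r] in simp_all)
    qed simp
    then show "W (Cond (Leq (Reg n) (Reg r)) (Assign r (Reg n)) (Assign r (Reg r))) 2 Q s"
      unfolding one_add_one .
  qed simp
  then show ?thesis by (rule W_weaken) simp
qed

end

context machine_ctx
begin

definition env :: "nat \<Rightarrow> store \<Rightarrow> bool" where
  "env a s \<longleftrightarrow> s 0 = nat_val N \<and> s 1 = nat_val L \<and> s 2 = nat_val K \<and> s 4 = nat_val a \<and>
     s 12 = nat_val H \<and> s 13 = nat_val V \<and> s 14 = nat_val S \<and> s 15 = nat_val Lam \<and>
     s 16 = nat_val T \<and> s 17 = nat_val Z \<and> s 18 = list_val origin \<and> s 19 = enc_pairs l0"

definition stored_best :: "int \<times> rat list \<Rightarrow> store \<Rightarrow> bool" where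
  "stored_best a s \<longleftrightarrow> s 32 = Num (of_int (fst a)) \<and> s 33 = list_val (snd a)"

lemma point_bits: "c \<le> count_fst l0 \<Longrightarrow> bits (list_val (grid_point N H c)) \<le> pb"
  using call_f[of 1 c] pos(2) unfolding callable_def by auto

lemma W_visit:
  assumes s: "fits s" and e: "env a s" and lam: "good_multipliers lam" and k: "k \<in> {1..K}" and c: "c \<le> count_fst l0"
    and r: "s 26 = list_val (grid_point N H c)" "s 20 = enc_ints lam" "s 23 = nat_val k" "stored_best v s"
    and Q: "\<And>s'. fits s' \<Longrightarrow> s' 37 = Num (of_int (objective lam k (grid_point N H c))) \<Longrightarrow>
       stored_best (better (objective lam k) v (grid_point N H c)) s' \<Longrightarrow>
       \<forall>x. x \<notin> {5,6,7,8,9,10,11,32,33,34,35,36,37} \<longrightarrow> s' x = s x \<Longrightarrow> Q s'"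
  shows "W visit_prog (obj_cost + 4) Q s"
proof -
  let ?x = "grid_point N H c"
  have upd: "W (Cond (Leq (Reg 32) (Reg 37)) (Assign 37 (Reg 37))
       (block [Assign 32 (Reg 37), Assign 33 (Reg 6)])) (1 + 2) Q s'"
    if s': "fits s'" "s' 37 = Num (of_int (objective lam k ?x))" "s' 6 = list_val ?x" "stored_best v s'"
      "\<forall>x. x \<notin> {5,6,7,8,9,10,11,34,35,36,37} \<longrightarrow> s' x = s x" for s'
  proof (rule W_cond[OF s'(1)])
    assume "denote (Leq (Reg 32) (Reg 37)) s' \<noteq> Num 0"
    then have "\<not> objective lam k ?x < fst v" using s' by (simp add: stored_best_def split: if_splits)
    then have bt: "better (objective lam k) v ?x = v" by (simp add: better_def)
    show "W (Assign 37 (Reg 37)) 2 Q s'"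
      apply (rule W_weaken, rule W_assign'[OF s'(1) _ refl])
      using fitsD[OF s'(1)] apply simp_all
      by (rule Q) (use s' bt in \<open>auto simp: stored_best_def\<close>)
  next
    assume "denote (Leq (Reg 32) (Reg 37)) s' = Num 0"
    then have "objective lam k ?x < fst v" using s' by (simp add: stored_best_def split: if_splits)
    then have bt: "better (objective lam k) v ?x = (objective lam k ?x, ?x)" by (simp add: better_def)
    show "W (block [Assign 32 (Reg 37), Assign 33 (Reg 6)]) 2 Q s'"
      apply (rule W_weaken)
       apply (rule W_assign_then[OF s'(1) _ refl], simp)
      using fitsD[OF s'(1)] apply simp
       apply (rule W_assign_last[OF _ _ refl], assumption, simp)
      using fitsD[OF s'(1)] apply simp
       apply (rule Q)
      using s' bt apply (auto simp: stored_best_def)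
      done
  qed simp
  show ?thesis unfolding visit_prog_def
    apply (rule W_weaken)
     apply (rule W_assign_then[where v = "list_val ?x"])
         apply (rule s)
        apply simp
       using r apply simp
      using fitsD[OF s, of 26] r apply simp
     apply (rule W_block[OF _ refl])
     apply (rule W_objective[OF _ lam k c])
           apply assumption
          apply simp
         using e apply (simp add: env_def)
        using e apply (simp add: env_def)
       using r apply simp
      using r apply simp
     apply (simp only: block.simps(2))
     apply (rule upd)
         apply assumption
        apply assumption
       apply simp
      using r apply (simp add: stored_best_def)
     apply simp
    apply simp
    done
qed

definition bump_cost :: nat where "bump_cost = 10 * N + 5"

lemma W_bump:
  assumes s: "fits s" and e: "env a s" and i: "i \<in> {1..N}" and c: "c(i := Suc (c i)) \<le> count_fst l0"
    and r: "s 26 = list_val (grid_point N H c)" "s 31 = val.Pair (nat_val i) z"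
    and Q: "\<And>s'. fits s' \<Longrightarrow> s' 26 = list_val (grid_point N H (c(i := Suc (c i)))) \<Longrightarrow>
       \<forall>x. x \<notin> {26,39,40,41} \<longrightarrow> s' x = s x \<Longrightarrow> Q s'"
  shows "W bump_prog bump_cost Q s"
proof -
  define xs where "xs = grid_point N H c"
  define ys where "ys = grid_point N H (c(i := Suc (c i)))"
  let ?body = "block [Cond (Mul (Leq (Reg 40) (Fst (Reg 31))) (Leq (Fst (Reg 31)) (Reg 40)))
          (Assign 39 (Add (Reg 39) (Div (Const 1) (Reg 12)))) (Assign 39 (Reg 39)),
        Assign 41 (MkPair (Reg 39) (Reg 41)),
        Assign 40 (Add (Reg 40) (Const 1))]"
  have len: "length xs = N" "length ys = N" unfolding xs_def ys_def grid_point_def by simp_all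
  have nth: "ys ! m = (if i = Suc m then xs ! m + 1 / of_nat H else xs ! m)" if "m < N" for m
    using that unfolding xs_def ys_def grid_point_def
    by (auto simp: add_divide_distrib simp del: upt_Suc)
  have yb: "bits (enc (map Num ys)) \<le> pb" using point_bits[OF c] unfolding ys_def list_val_enc .
  have tb: "bits (enc (rev (map Num (take m ys)))) \<le> b" for m
    using bits_enc_rev_take[of m "map Num ys"] yb b_big by (simp add: take_map)
  have nb: "bits (Num (ys ! m)) \<le> b" if "m < N" for m
  proof -
    have "1 + bits (Num (ys ! m)) \<in> set (map (\<lambda>x. 1 + bits x) (map Num ys))" using that len by auto
    from member_le_sum_list[OF this]
    have "1 + bits (Num (ys ! m)) \<le> (\<Sum>x\<leftarrow>map Num ys. 1 + bits x)" by simp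
    then show ?thesis using yb b_big unfolding bits_enc by linarith
  qed
  define J where "J = (\<lambda>m s'. s' 41 = enc (rev (map Num (take m ys))) \<and> s' 40 = nat_val (Suc m) \<and>
    (\<forall>x. x \<notin> {26,39,40,41} \<longrightarrow> s' x = s x))"
  have body: "W ?body 4 (\<lambda>s'. s' 26 = enc (drop (Suc m) (map Num xs)) \<and> J (Suc m) s') s1"
    if m: "m < N" and J: "J m s0" and f: "fits s1"
      and s1: "s1 = s0(39 := map Num xs ! m, 26 := enc (drop (Suc m) (map Num xs)))" for m s0 s1
  proof -
    have xm: "map Num xs ! m = Num (xs ! m)" using m len by simp
    have le: "((of_nat (Suc m) :: rat) \<le> of_nat i) = (Suc m \<le> i)" "((of_nat i :: rat) \<le> of_nat (Suc m)) = (i \<le> Suc m)"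
      by (simp_all only: of_nat_le_iff)
    have r1: "s1 39 = Num (xs ! m)" "s1 40 = nat_val (Suc m)" "s1 31 = val.Pair (nat_val i) z" "s1 12 = nat_val H"
      using J r e unfolding s1 J_def env_def xm by simp_all
    have cond: "W (Cond (Mul (Leq (Reg 40) (Fst (Reg 31))) (Leq (Fst (Reg 31)) (Reg 40)))
          (Assign 39 (Add (Reg 39) (Div (Const 1) (Reg 12)))) (Assign 39 (Reg 39))) (1 + 1)
          (\<lambda>s'. s' = s1(39 := Num (ys ! m))) s1"
    proof (rule W_cond[OF f])
      assume "denote (Mul (Leq (Reg 40) (Fst (Reg 31))) (Leq (Fst (Reg 31)) (Reg 40))) s1 \<noteq> Num 0"
      then have "i = Suc m" using r1 le by (simp del: of_nat_Suc split: if_splits)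
      then show "W (Assign 39 (Add (Reg 39) (Div (Const 1) (Reg 12)))) 1 (\<lambda>s'. s' = s1(39 := Num (ys ! m))) s1"
        by (intro W_assign'[OF f, where v = "Num (ys ! m)"]) (use r1 nth[OF m] nb[OF m] in simp_all)
    next
      assume "denote (Mul (Leq (Reg 40) (Fst (Reg 31))) (Leq (Fst (Reg 31)) (Reg 40))) s1 = Num 0"
      then have "i \<noteq> Suc m" using r1 le by (auto simp del: of_nat_Suc split: if_splits)
      then show "W (Assign 39 (Reg 39)) 1 (\<lambda>s'. s' = s1(39 := Num (ys ! m))) s1"
        by (intro W_assign'[OF f, where v = "Num (ys ! m)"]) (use r1 nth[OF m] nb[OF m] in simp_all)
    qed simp
    have tk: "enc (rev (map Num (take (Suc m) ys))) = val.Pair (Num (ys ! m)) (enc (rev (map Num (take m ys))))"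
      using m len by (simp add: take_Suc_conv_app_nth)
    show ?thesis
      apply (rule W_weaken)
       apply (rule W_chain[OF cond])
       apply (rule W_assign_then[where v = "enc (rev (map Num (take (Suc m) ys)))"])
           apply assumption
          apply simp
         using J apply (simp add: J_def s1 tk)
        apply (rule tb)
       apply (rule W_assign_last[where v = "nat_val (Suc (Suc m))"])
           apply assumption
          apply simp
         using J apply (simp add: J_def s1)
        apply (rule bits_nat_le) using m b_big apply linarith
       using J apply (simp add: J_def s1)
      apply simp
      done
  qed
  have final: "W (move 41 26) (3 * N + 1) Q s'"
    if s': "fits s'" "J N s'" "s' 26 = Num 0" for s'
  proof -
    have "W (move 41 26) (3 * length (rev (map Num ys)) + 1) Q s'"
    proof (rule W_move[OF s'(1), where ys = "[]"])
      show "s' 41 = enc (rev (map Num ys))" using s'(2) len by (simp add: J_def)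
      show "bits (enc (rev (rev (map Num ys)) @ [])) \<le> b" using yb b_big by simp
      assume "fits (s'(41 := Num 0, 26 := enc (rev (rev (map Num ys)) @ [])))"
      then show "Q (s'(41 := Num 0, 26 := enc (rev (rev (map Num ys)) @ [])))"
        by (rule Q) (use s'(2) in \<open>simp_all add: J_def ys_def list_val_enc\<close>)
    qed (use s' in simp_all)
    then show ?thesis using len by simp
  qed
  show ?thesis unfolding bump_prog_def bump_cost_def
    apply (rule W_weaken)
     apply (rule W_assign_then[where v = "nat_val 1"])
         apply (rule s)
        apply simp
       apply simp
      using mag_le apply simp
     apply (rule W_assign_then[where v = "Num 0"])
         apply assumption
        apply simp
       apply simp
      using mag_le apply simp
     apply (rule W_chain[where P = "\<lambda>s'. J N s' \<and> s' 26 = Num 0"])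
      apply (rule W_for_each[where J = J and xs = "map Num xs" and k = 4])
           apply assumption
          using r apply (simp add: xs_def list_val_enc)
         apply simp
        apply (simp add: J_def)
       using body len apply simp
      using len apply simp
     apply (simp only: block.simps(2))
     apply (rule final)
       apply assumption
      apply simp
     apply simp
    apply (simp add: len)
    done
qed

end

context machine_ctx
begin

definition ok_pairs :: "(nat \<times> int) list \<Rightarrow> bool" where
  "ok_pairs l \<longleftrightarrow> length l \<le> nb \<and> (\<forall>e\<in>set l. fst e \<in> {1..N} \<and> 0 \<le> snd e \<and> snd e \<le> int Z)"

lemma enc_pair_bits:
  assumes "fst e \<in> {1..N}" "0 \<le> snd e" "snd e \<le> int Z"
  shows "bits (enc_pair e) \<le> N + Z + 7"
proof -
  have "bits (Num (of_int (snd e))) \<le> Z + 3"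
  proof (rule bits_of_int_le)
    have "\<bar>snd e\<bar> \<le> int Z" using assms by simp
    also have "\<dots> \<le> 2 ^ Z" by (simp add: of_nat_less_two_power less_imp_le)
    finally show "\<bar>snd e\<bar> \<le> 2 ^ Z" .
  qed
  then show ?thesis using bits_nat_val[of "fst e"] assms by simp
qed

lemma ok_pairs_bits: "ok_pairs l \<Longrightarrow> bits (enc_pairs l) \<le> b"
proof -
  assume l: "ok_pairs l"
  have "bits (enc (map enc_pair l)) \<le> 2 + nb * (1 + (N + Z + 7))"
    by (rule bits_enc_le) (use l enc_pair_bits in \<open>auto simp: ok_pairs_def\<close>)
  moreover have "nb * (1 + (N + Z + 7)) = nb * (N + Z + 8)" by (simp add: algebra_simps)
  ultimately show ?thesis using b_big by linarith
qed

lemma ok_pairs_subset: "ok_pairs l \<Longrightarrow> set l' \<subseteq> set l \<Longrightarrow> length l' \<le> length l \<Longrightarrow> ok_pairs l'"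
  by (auto simp: ok_pairs_def)

lemma ok_pairs_mset: "ok_pairs l \<Longrightarrow> mset l' = mset l \<Longrightarrow> ok_pairs l'"
  by (metis ok_pairs_subset order_refl set_mset_mset size_mset)

lemma W_insert:
  assumes s: "fits s" and l: "ok_pairs (e # l)" and r: "s 24 = enc_pairs l" "s 43 = enc_pair e"
    and Q: "\<And>s'. fits s' \<Longrightarrow> s' 24 = enc_pairs (insert_desc e l) \<Longrightarrow>
       \<forall>x. x \<notin> {24,44} \<longrightarrow> s' x = s x \<Longrightarrow> Q s'"
  shows "W insert_prog (6 * nb + 4) Q s"
proof -
  let ?P = "\<lambda>f. snd e < snd f"
  define n where "n = length (takeWhile ?P l)"
  have nl: "n \<le> length l" unfolding n_def by (rule length_takeWhile_le)
  have lnb: "length l + 1 \<le> nb" using l by (simp add: ok_pairs_def)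
  let ?c = "Mul (IsPair (Reg 24)) (Sub (Const 1) (Leq (Snd (Fst (Reg 24))) (Snd (Reg 43))))"
  define st where "st m = s(44 := enc_pairs (rev (take m l)), 24 := enc_pairs (drop m l))" for m
  have okr: "ok_pairs (rev (take m l))" for m
    using l by (rule ok_pairs_subset) (auto dest: in_set_takeD)
  have okd: "ok_pairs (drop m l)" for m
    using l by (rule ok_pairs_subset) (auto dest: in_set_dropD)
  have dr: "drop m l = l ! m # drop (Suc m) l" if "m < n" for m
    using that nl by (simp add: Cons_nth_drop_Suc)
  have loop: "W (Loop ?c (block [Assign 44 (MkPair (Fst (Reg 24)) (Reg 44)), Assign 24 (Snd (Reg 24))]))
      (n * (2 + 1) + 1) (\<lambda>s'. s' = st n) (st 0)"
  proof (rule W_loop[where J = "\<lambda>j s'. \<exists>m. j + m = n \<and> s' = st m"])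
    fix j s' assume "\<exists>m. Suc j + m = n \<and> s' = st m" and f: "fits s'"
    then obtain m where m: "Suc j + m = n" and s': "s' = st m" by blast
    have mn: "m < n" using m by simp
    have "takeWhile ?P l ! m \<in> set (takeWhile ?P l)" using mn unfolding n_def by (rule nth_mem)
    then have "?P (takeWhile ?P l ! m)" by (blast dest: set_takeWhileD)
    then have gt: "snd e < snd (l ! m)" using mn unfolding n_def by (simp add: takeWhile_nth)
    have r24: "s' 24 = val.Pair (enc_pair (l ! m)) (enc_pairs (drop (Suc m) l))"
      unfolding s' st_def by (simp add: dr[OF mn])
    have r44: "s' 44 = enc_pairs (rev (take m l))" "s' 43 = enc_pair e" using r unfolding s' st_def by simp_all
    have tk: "val.Pair (enc_pair (l ! m)) (enc_pairs (rev (take m l))) = enc_pairs (rev (take (Suc m) l))"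
      using mn nl by (simp add: take_Suc_conv_app_nth)
    have "W (block [Assign 44 (MkPair (Fst (Reg 24)) (Reg 44)), Assign 24 (Snd (Reg 24))]) 2
        (\<lambda>s'. \<exists>m. j + m = n \<and> s' = st m) s'"
      apply (rule W_weaken)
       apply (rule W_assign_then[where v = "enc_pairs (rev (take (Suc m) l))"])
           apply (rule f)
          apply simp
         apply (simp add: r24 r44 flip: tk)
        apply (rule ok_pairs_bits[OF okr])
       apply (rule W_assign_last[where v = "enc_pairs (drop (Suc m) l)"])
           apply assumption
          apply simp
         apply (simp add: r24)
        apply (rule ok_pairs_bits[OF okd])
       apply (rule exI[of _ "Suc m"])
      using m apply (simp add: s' st_def fun_eq_iff)
      apply simp
      done
    moreover have "denote ?c s' \<noteq> Num 0" using gt r24 r44 by simp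
    ultimately show "denote ?c s' \<noteq> Num 0 \<and>
      W (block [Assign 44 (MkPair (Fst (Reg 24)) (Reg 44)), Assign 24 (Snd (Reg 24))]) 2
        (\<lambda>s'. \<exists>m. j + m = n \<and> s' = st m) s'" by simp
  next
    fix s' assume "\<exists>m. 0 + m = n \<and> s' = st m" "fits s'"
    then have s': "s' = st n" by simp
    have dw: "drop n l = dropWhile ?P l" unfolding n_def by (simp add: dropWhile_eq_drop)
    have "denote ?c s' = Num 0"
    proof (cases "drop n l")
      case Nil
      then show ?thesis unfolding s' st_def by simp
    next
      case (Cons f fs)
      then have "\<not> snd e < snd f" using dw by (metis hd_dropWhile list.discI list.sel(1))
      then show ?thesis using r unfolding s' st_def by (simp add: Cons)
    qed
    then show "denote ?c s' = Num 0 \<and> s' = st n" using s' by simp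
  next
    show "fits (st 0)" unfolding st_def
      by (intro fits_upd s ok_pairs_bits okd) (use mag_le in \<open>simp add: ok_pairs_def\<close>)
  qed auto
  have id: "rev (map enc_pair (rev (take n l))) @ map enc_pair (e # drop n l) = map enc_pair (insert_desc e l)"
    unfolding insert_desc_def n_def by (simp add: rev_map dropWhile_eq_drop flip: takeWhile_eq_take)
  have oki: "ok_pairs (insert_desc e l)" by (rule ok_pairs_mset[OF l]) simp
  have okc: "ok_pairs (e # drop n l)"
    by (rule ok_pairs_subset[OF l]) (auto dest: in_set_dropD)
  have mv: "W (move 44 24) (3 * n + 1) Q s'"
    if s': "fits s'" "s' = (st n)(24 := enc_pairs (e # drop n l))" for s'
  proof -
    have "W (move 44 24) (3 * length (map enc_pair (rev (take n l))) + 1) Q s'"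
    proof (rule W_move[OF s'(1), where ys = "map enc_pair (e # drop n l)"])
      show "bits (enc (rev (map enc_pair (rev (take n l))) @ map enc_pair (e # drop n l))) \<le> b"
        unfolding id by (rule ok_pairs_bits[OF oki])
      assume "fits (s'(44 := Num 0, 24 := enc (rev (map enc_pair (rev (take n l))) @ map enc_pair (e # drop n l))))"
      then show "Q (s'(44 := Num 0, 24 := enc (rev (map enc_pair (rev (take n l))) @ map enc_pair (e # drop n l))))"
        unfolding id by (rule Q) (auto simp: s'(2) st_def)
    qed (simp_all add: s'(2) st_def)
    then show ?thesis using nl by simp
  qed
  have eq0: "s(44 := Num 0) = st 0"
  proof
    fix x show "(s(44 := Num 0)) x = st 0 x" using r(1) by (simp add: st_def)
  qed
  show ?thesis unfolding insert_prog_def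
    apply (rule W_weaken)
     apply (rule W_assign_then[where v = "Num 0"])
         apply (rule s)
        apply simp
       apply simp
      using mag_le apply simp
     apply (simp only: eq0)
     apply (rule W_chain[OF loop])
     apply (rule W_assign_then[where v = "enc_pairs (e # drop n l)"])
         apply assumption
        apply simp
       using r apply (simp add: st_def)
      apply (rule ok_pairs_bits[OF okc])
     apply (simp only: block.simps(2))
     apply (rule mv)
      apply assumption
     apply (simp only:)
    using nl lnb apply simp
    done
qed

text \<open>The invariant behind the bit bounds: the label counts keep all prefixes inside the grid,
  and \<open>ok_pairs\<close> limits length and weights.\<close>

definition ok_list :: "(nat \<times> int) list \<Rightarrow> bool" where
  "ok_list l \<longleftrightarrow> ok_pairs l \<and> count_fst l = count_fst l0"

definition sweep_cost :: nat where "sweep_cost = nb * (bump_cost + obj_cost + 20) + 1"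

lemma prefix_le: "ok_list l \<Longrightarrow> count_fst (take m l) \<le> count_fst l0"
  using count_take_le[of m l] by (simp add: ok_list_def le_fun_def)

lemma ok_pairs_sweep: "ok_list l \<Longrightarrow> ok_pairs (sweep F l)"
  by (auto simp: ok_list_def ok_pairs_def sweep_def clip_bounds)

lemma ok_list_step: "ok_list l \<Longrightarrow> ok_list (sort_desc (sweep F l))"
proof -
  assume l: "ok_list l"
  have "mset (map fst (sort_desc (sweep F l))) = mset (map fst l)"
    by (metis map_fst_sweep mset_map mset_sort_desc)
  then have "count_fst (sort_desc (sweep F l)) = count_fst l" by (metis count_mset)
  then show ?thesis using l ok_pairs_mset[OF ok_pairs_sweep[OF l] mset_sort_desc] by (simp add: ok_list_def)
qed

text \<open>The origin has been visited beforehand, so the running minimum after \<open>m\<close>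
  elements covers \<open>m + 1\<close> points.\<close>

lemma W_sweep:
  fixes F
  assumes s: "fits s" and e: "env a s" and lam: "good_multipliers lam" and k: "k \<in> {1..K}" and l: "ok_list l"
    and F: "F = objective lam k"
    and r: "s 30 = enc_pairs l" "s 26 = list_val origin" "s 27 = Num (of_int (F origin))" "s 29 = Num 0"
      "s 20 = enc_ints lam" "s 23 = nat_val k" "stored_best (better F v origin) s"
    and Q: "\<And>s'. fits s' \<Longrightarrow> s' 29 = enc_pairs (rev (sweep F l)) \<Longrightarrow>
       stored_best (foldl (better F) v (visited l)) s' \<Longrightarrow>
       \<forall>x. x \<notin> {5,6,7,8,9,10,11,26,27,28,29,30,31,32,33,34,35,36,37,39,40,41} \<longrightarrow> s' x = s x \<Longrightarrow> Q s'"
  shows "W sweep_prog sweep_cost Q s"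
proof -
  let ?A = "{5,6,7,8,9,10,11,26,27,28,29,30,31,32,33,34,35,36,37,39,40,41} :: nat set"
  define J where "J = (\<lambda>m s'. s' 26 = list_val (prefix_point l m) \<and> s' 27 = Num (of_int (F (prefix_point l m))) \<and>
     s' 29 = enc_pairs (rev (take m (sweep F l))) \<and>
     stored_best (foldl (better F) v (map (prefix_point l) [0..<Suc m])) s' \<and> (\<forall>x. x \<notin> ?A \<longrightarrow> s' x = s x))"
  have len: "length l \<le> nb" using l by (simp add: ok_list_def ok_pairs_def)
  have body: "W (block
    [bump_prog,
     visit_prog,
     Assign 28 (Sub (Snd (Reg 31)) (Sub (Reg 37) (Reg 27))),
     clip_prog 28 17,
     Assign 29 (MkPair (MkPair (Fst (Reg 31)) (Reg 28)) (Reg 29)),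
     Assign 27 (Reg 37)]) (bump_cost + obj_cost + 15)
     (\<lambda>s'. s' 30 = enc (drop (Suc m) (map enc_pair l)) \<and> J (Suc m) s') s1"
    if m: "m < length l" and J: "J m s0" and f: "fits s1"
      and s1: "s1 = s0(31 := map enc_pair l ! m, 30 := enc (drop (Suc m) (map enc_pair l)))" for m s0 s1
  proof -
    define i where "i = fst (l ! m)"
    define c where "c = count_fst (take m l)"
    have c': "count_fst (take (Suc m) l) = c(i := Suc (c i))" unfolding c_def i_def using count_take_Suc[OF m] .
    have le: "c(i := Suc (c i)) \<le> count_fst l0" using prefix_le[OF l, of "Suc m"] unfolding c' .
    have lec: "c \<le> count_fst l0" using prefix_le[OF l, of m] unfolding c_def .
    have lm: "l ! m \<in> set l" using m by simp
    have i: "i \<in> {1..N}" using l lm unfolding i_def ok_list_def ok_pairs_def by blast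
    have zb: "0 \<le> snd (l ! m)" "snd (l ! m) \<le> int Z" using l lm unfolding ok_list_def ok_pairs_def by auto
    define y where "y = grid_point N H (c(i := Suc (c i)))"
    define z where "z = snd (l ! m) - (F y - F (grid_point N H c))"
    have s31: "s1 31 = val.Pair (nat_val i) (Num (of_int (snd (l ! m))))" using m by (simp add: s1 i_def)
    have s30: "s1 30 = enc (drop (Suc m) (map enc_pair l))" by (simp add: s1)
    have r1: "s1 26 = list_val (grid_point N H c)" "s1 27 = Num (of_int (F (grid_point N H c)))"
      "s1 29 = enc_pairs (rev (take m (sweep F l)))"
      "stored_best (foldl (better F) v (map (prefix_point l) [0..<Suc m])) s1"
      "\<forall>x. x \<notin> ?A \<longrightarrow> s1 x = s x"
      using J by (simp_all add: J_def s1 c_def stored_best_def)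
    have e1: "env a s1" using e r1(5) by (simp add: env_def)
    have Fb: "\<bar>F (grid_point N H d)\<bar> \<le> 2 ^ mag" if "d \<le> count_fst l0" for d
      using partial_objective_bound[OF lam k that order_refl] objective_eq lam F
      by (simp add: good_multipliers_def)
    \<comment> \<open>Before clipping, a weight up to \<open>Z\<close> has been changed by the
      difference of two objectives, each at most \<open>2 ^ mag\<close>.\<close>
    have "bits (Num (of_int z)) \<le> (Z + mag + 2) + 3"
    proof (rule bits_of_int_le)
      have "\<bar>z\<bar> \<le> int Z + 2 ^ mag + 2 ^ mag" unfolding z_def y_def using zb Fb[OF le] Fb[OF lec] by linarith
      also have "\<dots> \<le> 2 ^ (Z + mag) + 2 ^ (Z + mag) + 2 ^ (Z + mag)"
      proof -
        have "int Z \<le> 2 ^ Z" by (simp add: of_nat_less_two_power less_imp_le)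
        also have "(2::int) ^ Z \<le> 2 ^ (Z + mag)" by (rule power_increasing) auto
        finally have "int Z \<le> 2 ^ (Z + mag)" .
        moreover have "(2::int) ^ mag \<le> 2 ^ (Z + mag)" by (rule power_increasing) auto
        ultimately show ?thesis by linarith
      qed
      also have "\<dots> \<le> 2 ^ (Z + mag + 2)" by (simp add: power_add)
      finally show "\<bar>z\<bar> \<le> 2 ^ (Z + mag + 2)" .
    qed
    then have bz: "bits (Num (of_int z)) \<le> b" using mag_le by linarith
    have sw: "sweep F l ! m = (i, clip (int Z) z)"
    proof -
      have "y = prefix_point l (Suc m)" unfolding y_def c' ..
      then show ?thesis using m by (simp add: sweep_def z_def i_def c_def)
    qed
    have tk: "val.Pair (val.Pair (nat_val i) (Num (of_int (clip (int Z) z)))) (enc_pairs (rev (take m (sweep F l))))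
       = enc_pairs (rev (take (Suc m) (sweep F l)))"
      using m sw by (simp add: take_Suc_conv_app_nth)
    have okt: "ok_pairs (rev (take (Suc m) (sweep F l)))"
      using ok_pairs_sweep[OF l] by (rule ok_pairs_subset) (auto dest: in_set_takeD)
    have bst: "better F (foldl (better F) v (map (prefix_point l) [0..<Suc m])) y =
       foldl (better F) v (map (prefix_point l) [0..<Suc (Suc m)])"
      by (simp add: y_def c')
    show ?thesis
      apply (rule W_weaken)
       apply (rule W_block[OF _ refl])
       apply (rule W_bump[OF f e1 i le r1(1) s31])
       apply (rule W_block[OF _ refl])
       apply (rule W_visit[where a = a and lam = lam and k = k and c = "c(i := Suc (c i))" and
             v = "foldl (better F) v (map (prefix_point l) [0..<Suc m])"])
                apply assumption
               using e1 apply (simp add: env_def)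
              apply (rule lam)
             apply (rule k)
            apply (rule le)
           apply assumption
          using r r1 apply simp
         using r r1 apply simp
        using r1 apply (simp add: stored_best_def)
       apply (rule W_assign_then[where v = "Num (of_int z)"])
           apply assumption
          apply simp
         using s31 r1 apply (simp add: z_def y_def F)
        apply (rule bz)
       apply (rule W_block[OF _ refl])
       apply (rule W_clip[where z = z and k = Z])
           apply assumption
          apply simp
         using e1 apply (simp add: env_def)
        apply simp
       apply (rule W_assign_then[where v = "enc_pairs (rev (take (Suc m) (sweep F l)))"])
           apply assumption
          apply simp
         using s31 r1 apply (simp flip: tk)
        apply (rule ok_pairs_bits[OF okt])
       apply (rule W_assign_last[where v = "Num (of_int (F y))"])
           apply assumption
          apply simp
         apply (simp add: F y_def)
        using partial_objective_bits[OF lam k le order_refl] objective_eq lam F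
        apply (simp add: good_multipliers_def y_def)
       using s30 r1 bst apply (simp add: J_def stored_best_def F y_def c' del: upt_Suc)
      apply simp
      done
  qed
  have cz: "count_list [] = (\<lambda>_. 0)" by (rule ext) simp
  have vis: "visited l = map (prefix_point l) [0..<Suc (length l)]" by (simp add: visited_def)
  have l1: "length l * (bump_cost + obj_cost + 15 + 3) + 1 \<le> sweep_cost"
    unfolding sweep_cost_def by (rule add_le_mono[OF mult_le_mono]) (use len in simp_all)
  show ?thesis unfolding sweep_prog_def
    apply (rule W_weaken)
     apply (rule W_for_each[where J = J and xs = "map enc_pair l" and k = "bump_cost + obj_cost + 15"])
          apply (rule s)
         using r apply simp
        apply simp
       using r apply (simp add: J_def origin_def cz)
      using body apply simp
     apply (rule Q)
        apply assumption
       apply (simp add: J_def)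
      apply (simp add: J_def vis del: upt_Suc)
     apply (simp add: J_def)
    apply (simp only: length_map)
    apply (rule l1)
    done
qed

end

section \<open>Programs for one round\<close>

definition ascend_prog :: prog where
  "ascend_prog = block
    [Assign 7 (Reg 13),
     Assign 36 (Const 1),
     Assign 47 (Const 0),
     for_each 20 35 (block
       [Assign 6 (Reg 33),
        Assign 5 (MkPair (Const 6) (Reg 36)),
        eval_prog,
        Assign 37 (Floor (Mul (Reg 13) (Reg 8))),
        Assign 6 (Const 0),
        Assign 5 (MkPair (Const 3) (Reg 36)),
        eval_prog,
        Assign 28 (Add (Reg 35) (Sub (Reg 37) (Floor (Mul (Reg 13) (Reg 8))))),
        clip_prog 28 15,
        Assign 47 (MkPair (Reg 28) (Reg 47)),
        Assign 36 (Add (Reg 36) (Const 1))]),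
     move 47 20]"

text \<open>The requested precision in register 4 is read only here. The maximum starts with the
  value for \<open>k = 1\<close>, which the loop then asks for again.\<close>

definition value_prog :: prog where
  "value_prog = block
    [Assign 6 (Reg 33),
     Assign 7 (Reg 4),
     Assign 5 (MkPair (Const 7) (Const 1)),
     eval_prog,
     Assign 46 (Reg 8),
     for_loop 23 2 (block
       [Assign 5 (MkPair (Const 7) (Reg 23)),
        eval_prog,
        Cond (Leq (Reg 8) (Reg 46)) (Assign 46 (Reg 46)) (Assign 46 (Reg 8))]),
     Assign 21 (Add (Reg 21) (Reg 46))]"

definition round_prog :: prog where
  "round_prog = block [best_prog, value_prog, ascend_prog]"

definition main_loop :: prog where
  "main_loop = block [for_loop 22 16 round_prog, Assign 0 (Div (Reg 21) (Reg 16))]"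

context machine_ctx
begin

definition descent_cost :: nat where
  "descent_cost = obj_cost + sweep_cost + nb * (6 * nb + 7) + 12"

lemma W_descent:
  fixes F
  assumes s: "fits s" and e: "env a s" and lam: "good_multipliers lam" and k: "k \<in> {1..K}" and l: "ok_list l"
    and F: "F = objective lam k"
    and r: "s 24 = enc_pairs l" "s 20 = enc_ints lam" "s 23 = nat_val k" "stored_best v s"
    and Q: "\<And>s'. fits s' \<Longrightarrow> s' 24 = enc_pairs (sort_desc (sweep F l)) \<Longrightarrow>
       stored_best (foldl (better F) v (visited l)) s' \<Longrightarrow>
       \<forall>x. x \<notin> {5,6,7,8,9,10,11,24,26,27,28,29,30,31,32,33,34,35,36,37,39,40,41,43,44} \<longrightarrow> s' x = s x \<Longrightarrow> Q s'"
  shows "W descent_prog descent_cost Q s"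
proof -
  define q where "q = rev (sweep F l)"
  have z: "(\<lambda>_. 0) \<le> count_fst l0" by (simp add: le_fun_def)
  have okq: "ok_pairs q" unfolding q_def
    by (rule ok_pairs_subset[OF ok_pairs_sweep[OF l, of F]]) auto
  have lq: "length q \<le> nb" using okq by (simp add: ok_pairs_def)
  have sort: "W (for_each 29 43 insert_prog) (length (map enc_pair q) * (6 * nb + 4 + 3) + 1) Q s0"
    if s0: "fits s0" "s0 29 = enc_pairs q" "s0 24 = Num 0" "stored_best (foldl (better F) v (visited l)) s0"
      "\<forall>x. x \<notin> {5,6,7,8,9,10,11,24,26,27,28,29,30,31,32,33,34,35,36,37,39,40,41} \<longrightarrow> s0 x = s x" for s0
  proof (rule W_for_each[where J = "\<lambda>m s'. s' 24 = enc_pairs (sort_desc (rev (take m q))) \<and>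
      (\<forall>x. x \<notin> {24,29,43,44} \<longrightarrow> s' x = s0 x)"])
    fix m s1 assume m': "m < length (map enc_pair q)" and J: "s1 24 = enc_pairs (sort_desc (rev (take m q))) \<and>
      (\<forall>x. x \<notin> {24,29,43,44} \<longrightarrow> s1 x = s0 x)"
      and f: "fits (s1(43 := map enc_pair q ! m, 29 := enc (drop (Suc m) (map enc_pair q))))"
    have m: "m < length q" using m' by simp
    have tk: "rev (take (Suc m) q) = q ! m # rev (take m q)" using m by (simp add: take_Suc_conv_app_nth)
    have "mset (q ! m # sort_desc (rev (take m q))) = mset (take (Suc m) q)"
      using m by (simp add: take_Suc_conv_app_nth)
    then have ok: "ok_pairs (q ! m # sort_desc (rev (take m q)))"
    proof (rule ok_pairs_mset[rotated])
      show "ok_pairs (take (Suc m) q)" by (rule ok_pairs_subset[OF okq]) (auto dest: in_set_takeD)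
    qed
    show "W insert_prog (6 * nb + 4)
       (\<lambda>s'. s' 29 = enc (drop (Suc m) (map enc_pair q)) \<and>
          s' 24 = enc_pairs (sort_desc (rev (take (Suc m) q))) \<and> (\<forall>x. x \<notin> {24,29,43,44} \<longrightarrow> s' x = s0 x))
       (s1(43 := map enc_pair q ! m, 29 := enc (drop (Suc m) (map enc_pair q))))"
      apply (rule W_insert[OF f ok])
      using J apply simp
      using m apply simp
      using J apply (simp add: tk)
      done
  next
    fix s' assume "fits s'" and J: "s' 24 = enc_pairs (sort_desc (rev (take (length (map enc_pair q)) q))) \<and>
      (\<forall>x. x \<notin> {24,29,43,44} \<longrightarrow> s' x = s0 x)"
    then show "Q s'"
      by (intro Q) (use s0 in \<open>simp_all add: q_def stored_best_def\<close>)
  qed (use s0 in simp_all)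
  show ?thesis unfolding descent_prog_def
    apply (rule W_weaken)
     apply (rule W_assign_then[where v = "list_val origin"])
         apply (rule s)
        apply simp
       using e apply (simp add: env_def)
      using fitsD[OF s, of 18] e apply (simp add: env_def)
     apply (rule W_block[OF _ refl])
     apply (rule W_visit[where a = a and lam = lam and k = k and c = "\<lambda>_. 0" and v = v])
              apply assumption
             using e apply (simp add: env_def)
            apply (rule lam)
           apply (rule k)
          apply (rule z)
         apply (simp add: origin_def)
        using r apply simp
       using r apply simp
      using r apply (simp add: stored_best_def)
     apply (rule W_assign_then[where v = "Num (of_int (F origin))"])
         apply assumption
        apply simp
       apply (simp add: F origin_def)
      using partial_objective_bits[OF lam k z order_refl] objective_eq lam F
      apply (simp add: good_multipliers_def origin_def)
     apply (rule W_assign_then[where v = "Num 0"])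
         apply assumption
        apply simp
       apply simp
      using mag_le apply simp
     apply (rule W_assign_then[where v = "enc_pairs l"])
         apply assumption
        apply simp
       using r apply simp
      using fitsD[OF s, of 24] r apply simp
     apply (rule W_block[OF _ refl])
     apply (rule W_sweep[where a = a and lam = lam and k = k and l = l and F = F and v = v])
                    apply assumption
                   using e apply (simp add: env_def)
                  apply (rule lam)
                 apply (rule k)
                apply (rule l)
               apply (rule F)
              apply simp
             using e apply (simp add: env_def)
            apply simp
           apply simp
          using r apply simp
         using r apply simp
        apply (simp add: stored_best_def F origin_def)
     apply (rule W_assign_then[where v = "Num 0"])
         apply assumption
        apply simp
       apply simp
      using mag_le apply simp
     apply (simp only: block.simps(2))
     apply (rule sort)
         apply assumption
        apply (simp add: q_def)
       apply simp
      apply (simp add: stored_best_def)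
     apply simp
    apply (simp add: descent_cost_def add.commute)
    apply (rule le_SucI, rule le_SucI, rule mult_le_mono1, rule lq)
    done
qed

definition scan_cost :: nat where "scan_cost = Z * (descent_cost + 2) + 3"

lemma ok_list_l0: "ok_list l0"
proof -
  have "\<forall>e\<in>set l0. snd e = 0"
  proof -
    have "\<forall>e\<in>set (fold (\<lambda>i l. replicate (nat (nsteps i)) (i, 0) @ l) xs l'). snd e = 0"
      if "\<forall>e\<in>set l'. snd e = (0::int)" for xs :: "nat list" and l'
      using that
    proof (induction xs arbitrary: l')
      case (Cons i xs)
      have "\<forall>e\<in>set (replicate (nat (nsteps i)) (i, 0) @ l'). snd e = 0" using Cons.prems by auto
      from Cons.IH[OF this] show ?case by simp
    qed simp
    note * = this
    show ?thesis unfolding l0_def by (rule *) simp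
  qed
  then show ?thesis using length_l0 fst_l0 by (auto simp: ok_list_def ok_pairs_def)
qed

lemma W_scan:
  assumes s: "fits s" and e: "env a s" and lam: "good_multipliers lam" and k: "k \<in> {1..K}"
    and r: "s 20 = enc_ints lam" "s 23 = nat_val k" "stored_best v s"
    and Q: "\<And>s'. fits s' \<Longrightarrow> stored_best (scan lam k v) s' \<Longrightarrow>
       \<forall>x. x \<notin> {5,6,7,8,9,10,11,24,25,26,27,28,29,30,31,32,33,34,35,36,37,39,40,41,43,44} \<longrightarrow> s' x = s x \<Longrightarrow> Q s'"
  shows "W scan_prog scan_cost Q s"
proof -
  let ?A = "{5,6,7,8,9,10,11,24,25,26,27,28,29,30,31,32,33,34,35,36,37,39,40,41,43,44} :: nat set"
  define st where "st = (\<lambda>m. (descent_step (objective lam k) ^^ m) (l0, v))"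
  have ok: "ok_list (fst (st m))" for m
    by (induction m) (simp_all add: st_def ok_list_l0 descent_step_def ok_list_step)
  have bl: "bits (enc_pairs l0) \<le> b" using ok_list_l0 ok_pairs_bits by (simp add: ok_list_def)
  show ?thesis unfolding scan_prog_def scan_cost_def
    apply (rule W_weaken)
     apply (rule W_assign_then[where v = "enc_pairs l0"])
         apply (rule s)
        apply simp
       using e apply (simp add: env_def)
      apply (rule bl)
     apply (simp only: block.simps(2))
     apply (rule W_for[where n = Z and k = descent_cost and
        J = "\<lambda>m s'. s' 24 = enc_pairs (fst (st m)) \<and> stored_best (snd (st m)) s' \<and> (\<forall>x. x \<notin> ?A \<longrightarrow> s' x = s x)"])
           apply assumption
          apply simp
         using e apply (simp add: env_def)
        using mag_le apply simp
       using r apply (simp add: st_def stored_best_def)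
      subgoal for m s2
        apply (rule W_descent[where a = a and lam = lam and k = k and l = "fst (st m)" and v = "snd (st m)", OF _ _ lam k ok refl])
             apply assumption
            using e apply (simp add: env_def)
           apply simp
          using r apply simp
         using r apply simp
        apply simp
        apply (simp add: st_def descent_step_def stored_best_def)
        done
     apply (rule Q)
       apply assumption
      apply (simp add: scan_def st_def)
     apply simp
    apply simp
    done
qed

definition best_cost :: nat where "best_cost = K * (scan_cost + 2) + obj_cost + 6"

lemma W_best:
  assumes s: "fits s" and e: "env a s" and lam: "good_multipliers lam"
    and r: "s 20 = enc_ints lam"
    and Q: "\<And>s'. fits s' \<Longrightarrow> stored_best (best lam K) s' \<Longrightarrow>
       \<forall>x. x \<notin> {5,6,7,8,9,10,11,23,24,25,26,27,28,29,30,31,32,33,34,35,36,37,39,40,41,43,44} \<longrightarrow> s' x = s x \<Longrightarrow> Q s'"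
  shows "W best_prog best_cost Q s"
proof -
  let ?A = "{5,6,7,8,9,10,11,23,24,25,26,27,28,29,30,31,32,33,34,35,36,37,39,40,41,43,44} :: nat set"
  have z: "(\<lambda>_. 0) \<le> count_fst l0" by (simp add: le_fun_def)
  have k1: "1 \<in> {1..K}" using pos by simp
  have b1: "bits (Num (of_int (objective lam 1 origin))) \<le> b"
    using partial_objective_bits[OF lam k1 z order_refl] objective_eq lam
    by (simp add: good_multipliers_def origin_def)
  show ?thesis unfolding best_prog_def best_cost_def
    apply (rule W_weaken)
     apply (rule W_assign_then[where v = "nat_val 1"])
         apply (rule s)
        apply simp
       apply simp
      using mag_le apply simp
     apply (rule W_assign_then[where v = "list_val origin"])
         apply assumption
        apply simp
       using e apply (simp add: env_def)
      using fitsD[OF s, of 18] e apply (simp add: env_def)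
     apply (rule W_block[OF _ refl])
     apply (rule W_objective[OF _ lam k1 z])
           apply assumption
          apply (simp add: origin_def)
         using e apply (simp add: env_def)
        using e apply (simp add: env_def)
       using r apply simp
      apply simp
     apply (rule W_assign_then[where v = "Num (of_int (objective lam 1 origin))"])
         apply assumption
        apply simp
       apply (simp add: origin_def)
      apply (rule b1)
     apply (rule W_assign_then[where v = "list_val origin"])
         apply assumption
        apply simp
       apply simp
      using fitsD[OF s, of 18] e apply (simp add: env_def)
     apply (simp only: block.simps(2))
     apply (rule W_for[where n = K and k = scan_cost and
        J = "\<lambda>m s'. stored_best (best lam m) s' \<and> (\<forall>x. x \<notin> ?A \<longrightarrow> s' x = s x)"])
           apply assumption
          apply simp
         using e apply (simp add: env_def)
        using b_big apply simp
       apply (simp add: best_def stored_best_def)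
      subgoal for _ m s2
        apply (rule W_scan[where a = a and lam = lam and k = "Suc m" and v = "best lam m", OF _ _ lam])
              apply assumption
             using e apply (simp add: env_def)
            apply simp
           using r apply simp
          apply assumption
         apply simp
        apply (simp add: best_Suc stored_best_def)
        done
     apply (rule Q)
       apply assumption
      apply simp
     apply simp
    apply simp
    done
qed

text \<open>Here the precision is \<open>a\<close>, in contrast to \<open>V\<close> in
  \<open>gv\<close>. The points \<open>choice i\<close> come from answers whose precision is
  independent of \<open>a\<close>.\<close>

definition value_of :: "nat \<Rightarrow> rat list \<Rightarrow> rat" where
  "value_of a xs = Max ((\<lambda>k. eval_abs ans (Src_g k) xs a) ` {1..K})"

definition total_value :: "nat \<Rightarrow> nat \<Rightarrow> rat" where
  "total_value a t = (\<Sum>i<t. value_of a (choice i))"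

lemma value_of_bits:
  assumes "a \<le> pr" "c \<le> count_fst l0"
  shows "bits (Num (value_of a (grid_point N H c))) \<le> ot"
proof -
  have "value_of a (grid_point N H c) \<in> (\<lambda>k. eval_abs ans (Src_g k) (grid_point N H c) a) ` {1..K}"
    unfolding value_of_def using pos by (intro Max_in) auto
  then show ?thesis using callable_bits[OF call_g] assms by auto
qed

text \<open>The bit bounds require that recorded points are grid points. This follows from the
  structure of the algorithm alone, without any accuracy of the values.\<close>

lemma grid_best:
  assumes lam: "good_multipliers lam"
  shows "\<exists>c\<le>count_fst l0. snd (best lam m) = grid_point N H c"
proof -
  have vis: "\<exists>c\<le>count_fst l0. y = grid_point N H c" if l: "ok_list l" and y: "y \<in> set (visited l)" for l y
  proof -
    obtain m where "y = prefix_point l m" using y unfolding visited_def by (auto simp del: upt_Suc)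
    then show ?thesis using prefix_le[OF l] by blast
  qed
  have st: "ok_list (fst ((descent_step F ^^ n) (l0, v))) \<and>
     (\<exists>c\<le>count_fst l0. snd (snd ((descent_step F ^^ n) (l0, v))) = grid_point N H c)"
    if "\<exists>c\<le>count_fst l0. snd v = grid_point N H c" for F v n
  proof (induction n)
    case 0
    then show ?case using that ok_list_l0 by simp
  next
    case (Suc n)
    let ?p = "(descent_step F ^^ n) (l0, v)"
    have "snd (foldl (better F) (snd ?p) (visited (fst ?p))) = snd (snd ?p) \<or>
      snd (foldl (better F) (snd ?p) (visited (fst ?p))) \<in> set (visited (fst ?p))"
      using foldl_better_mem[of F "snd ?p" "visited (fst ?p)"] by force
    moreover have step: "(descent_step F ^^ Suc n) (l0, v) =
        (sort_desc (sweep F (fst ?p)), foldl (better F) (snd ?p) (visited (fst ?p)))"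
      by (simp only: funpow.simps o_apply descent_step_def[of F ?p])
    moreover have "ok_list (sort_desc (sweep F (fst ?p)))" using Suc ok_list_step by blast
    ultimately show ?case unfolding step fst_conv snd_conv using Suc vis[of "fst ?p"] by metis
  qed
  show ?thesis
  proof (induction m)
    case 0
    show ?case by (auto simp: best_def origin_def le_fun_def intro!: exI[of _ "\<lambda>_. 0"])
  next
    case (Suc m)
    then show ?case unfolding best_Suc scan_def using st by blast
  qed
qed

lemma grid_choice: "\<exists>c\<le>count_fst l0. choice t = grid_point N H c"
  unfolding choice_def by (rule grid_best[OF good_multipliers_t])

text \<open>Denominators multiply along the sum, but each is at most \<open>2 ^ ot\<close>, so the
  exponent grows only to \<open>T * ot\<close> and remains polynomial.\<close>

lemma total_value_bits:
  assumes a: "a \<le> pr" and t: "t \<le> T"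
  shows "bits (Num (total_value a t)) \<le> b"
    and "\<bar>total_value a t\<bar> \<le> 2 ^ (T + ot)" and "dnm (total_value a t) \<le> 2 ^ (T * ot)"
proof -
  have v: "bits (Num (value_of a (choice i))) \<le> ot" for i
    using value_of_bits[OF a] grid_choice[of i] by auto
  have 1: "\<bar>total_value a t\<bar> \<le> of_nat t * 2 ^ ot" and 2: "dnm (total_value a t) \<le> 2 ^ (t * ot)" for t
  proof -
    show "\<bar>total_value a t\<bar> \<le> of_nat t * 2 ^ ot"
    proof (induction t)
      case (Suc t)
      then show ?case using bits_NumD(1)[OF v[of t]]
        by (simp add: total_value_def distrib_right)
    qed (simp add: total_value_def)
    show "dnm (total_value a t) \<le> 2 ^ (t * ot)"
    proof (induction t)
      case 0
      have "dnm (of_int 0) = 1" by (rule dnm_of_int)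
      then show ?case by (simp add: total_value_def)
    next
      case (Suc t)
      have "dnm (total_value a t + value_of a (choice t)) \<le> dnm (total_value a t) * dnm (value_of a (choice t))"
        by (rule dnm_add)
      also have "\<dots> \<le> 2 ^ (t * ot) * 2 ^ ot"
        using Suc bits_NumD(2)[OF v[of t]] dnm_pos[of "value_of a (choice t)"] by (intro mult_mono) auto
      finally show ?case by (simp add: total_value_def power_add mult.commute)
    qed
  qed
  have "of_nat t * 2 ^ ot \<le> (2 :: rat) ^ T * 2 ^ ot"
  proof (rule mult_right_mono)
    have "(of_nat t :: rat) \<le> of_nat T" using t by simp
    also have "\<dots> \<le> 2 ^ T" by (simp add: of_nat_less_two_power less_imp_le)
    finally show "(of_nat t :: rat) \<le> 2 ^ T" .
  qed simp
  then show m: "\<bar>total_value a t\<bar> \<le> 2 ^ (T + ot)" using 1[of t] unfolding power_add by linarith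
  have "(2::int) ^ (t * ot) \<le> 2 ^ (T * ot)" using t by (intro power_increasing mult_le_mono1) auto
  then show d: "dnm (total_value a t) \<le> 2 ^ (T * ot)" using 2[of t] by linarith
  show "bits (Num (total_value a t)) \<le> b" using bits_Num_le[OF m d] b_big by linarith
qed

definition value_cost :: nat where "value_cost = K * (3 * first + 13) + 3 * first + 16"

lemma W_value:
  assumes s: "fits s" and e: "env a s" and a: "a \<le> pr" and c: "c \<le> count_fst l0" and q: "bits (Num (q + value_of a (grid_point N H c))) \<le> b"
    and r: "s 33 = list_val (grid_point N H c)" "s 21 = Num q"
    and Q: "\<And>s'. fits s' \<Longrightarrow> s' 21 = Num (q + value_of a (grid_point N H c)) \<Longrightarrow>
       \<forall>x. x \<notin> {5,6,7,8,9,10,11,21,23,46} \<longrightarrow> s' x = s x \<Longrightarrow> Q s'"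
  shows "W value_prog value_cost Q s"
proof -
  define ev where "ev = (\<lambda>k. eval_abs ans (Src_g k) (grid_point N H c) a)"
  \<comment> \<open>\<open>max 1 m\<close>, because the value for \<open>k = 1\<close> is in the
    maximum already before the loop.\<close>
  define mx where "mx = (\<lambda>m. Max (ev ` {1..max 1 m}))"
  let ?A = "{5,6,7,8,9,10,11,21,23,46} :: nat set"
  have k1: "1 \<in> {1..K}" using pos by simp
  have mxS: "mx (Suc m) = max (ev (Suc m)) (mx m)" for m
  proof -
    have "{1..max 1 (Suc m)} = insert (Suc m) {1..max 1 m}" by auto
    then show ?thesis unfolding mx_def by simp
  qed
  have mx0: "mx 0 = ev 1" by (simp add: mx_def)
  have mxK: "mx K = value_of a (grid_point N H c)"
    using pos unfolding mx_def value_of_def ev_def by (simp add: max_def)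
  have bs: "bits (val.Pair (Num 7) (nat_val k)) \<le> b" if "k \<le> K" for k
    using bits_nat_val[of k] that b_big by simp
  let ?A1 = "{5,6,7,8,9,10,11,23,46} :: nat set"
  define J where "J = (\<lambda>m s'. s' 46 = Num (mx m) \<and> s' 6 = list_val (grid_point N H c) \<and> s' 7 = nat_val a \<and>
     (\<forall>x. x \<notin> ?A1 \<longrightarrow> s' x = s x))"
  have upd: "W (Cond (Leq (Reg 8) (Reg 46)) (Assign 46 (Reg 46)) (Assign 46 (Reg 8))) (1 + 1)
      (\<lambda>s'. s' = t(46 := Num (mx (Suc m)))) t"
    if t: "fits t" "t 8 = Num (ev (Suc m))" "t 46 = Num (mx m)" for t m
  proof (rule W_cond[OF t(1)])
    assume "denote (Leq (Reg 8) (Reg 46)) t \<noteq> Num 0"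
    then have "mx (Suc m) = mx m" using t mxS by (simp split: if_splits)
    then show "W (Assign 46 (Reg 46)) 1 (\<lambda>s'. s' = t(46 := Num (mx (Suc m)))) t"
      by (intro W_assign'[OF t(1), where v = "Num (mx (Suc m))"]) (use t fitsD[OF t(1), of 46] in simp_all)
  next
    assume "denote (Leq (Reg 8) (Reg 46)) t = Num 0"
    then have "mx (Suc m) = ev (Suc m)" using t mxS by (simp split: if_splits)
    then show "W (Assign 46 (Reg 8)) 1 (\<lambda>s'. s' = t(46 := Num (mx (Suc m)))) t"
      by (intro W_assign'[OF t(1), where v = "Num (mx (Suc m))"]) (use t fitsD[OF t(1), of 8] in simp_all)
  qed simp
  show ?thesis unfolding value_prog_def value_cost_def
    apply (rule W_weaken)
     apply (rule W_assign_then[where v = "list_val (grid_point N H c)"])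
         apply (rule s)
        apply simp
       using r apply simp
      using fitsD[OF s, of 33] r apply simp
     apply (rule W_assign_then[where v = "nat_val a"])
         apply assumption
        apply simp
       using e apply (simp add: env_def)
      using fitsD[OF s, of 4] e apply (simp add: env_def)
     apply (rule W_assign_then[where v = "val.Pair (Num 7) (nat_val 1)"])
         apply assumption
        apply simp
       apply simp
      apply (rule bs) using pos apply simp
     apply (rule W_block[OF _ refl])
     apply (rule W_eval'[OF _ call_g[OF k1 c] _ _ _ a])
         apply assumption
        apply simp
       apply simp
      apply simp
     apply (rule W_assign_then[where v = "Num (mx 0)"])
         apply assumption
        apply simp
       apply (simp add: mx0 ev_def)
      apply (simp only: mx0 ev_def)
      using callable_bits[OF call_g[OF k1 c] a] b_big apply linarith
     apply (rule W_chain[where P = "J K"])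
      apply (rule W_for[where n = K and k = "3 * first + 11" and J = J])
            apply assumption
           apply simp
          using e apply (simp add: env_def)
         using b_big apply simp
        apply (simp add: J_def)
       subgoal for _ m s2
         apply (rule W_weaken)
          apply (rule W_assign_then[where v = "val.Pair (Num 7) (nat_val (Suc m))"])
              apply assumption
             apply simp
            apply simp
           apply (rule bs) apply simp
          apply (rule W_block[OF _ refl])
          apply (rule W_eval'[where h = "Src_g (Suc m)" and xs = "grid_point N H c" and n = a])
                apply assumption
               apply (rule call_g[OF _ c]) apply simp
              apply simp
             apply (simp add: J_def)
            apply (simp add: J_def)
           apply (rule a)
          apply (simp only: block.simps(2))
          apply (rule W_mono[OF upd order.refl])
             apply assumption
            apply (simp add: ev_def)
           apply (simp add: J_def)
          apply (simp add: J_def)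
         apply simp
         done
      apply assumption
     apply (rule W_assign_last[where v = "Num (q + value_of a (grid_point N H c))"])
         apply assumption
        apply simp
       using r apply (simp add: J_def mxK)
      apply (rule q)
     apply (rule Q)
       apply assumption
      apply simp
     apply (simp add: J_def)
    apply (simp add: algebra_simps)
    done
qed

end

section \<open>Initialization: constants, grid and zero multipliers\<close>

definition bound_prog :: prog where
  "bound_prog = block
    [Ask 8 (MkPair (MkPair (Const 2) (Reg 23)) (MkPair (Const 0) (Const 1))),
     Assign 8 (Add (Floor (Add (Reg 8) (Reg 8))) (Const 1)),
     Cond (Leq (Reg 8) (Reg 50)) (Assign 50 (Reg 50)) (Assign 50 (Reg 8))]"

definition coordinate_prog :: prog where
  "coordinate_prog = block
    [Assign 5 (MkPair (Const 2) (Reg 23)),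
     Assign 6 (Const 0),
     Assign 7 (Reg 13),
     eval_prog,
     Assign 52 (Sub (Floor (Mul (Reg 12) (Reg 8))) (Const 1)),
     Cond (Leq (Reg 52) (Const 0)) (Assign 52 (Const 0)) (Assign 52 (Reg 52)),
     for_loop 25 52 (Assign 19 (MkPair (MkPair (Reg 23) (Const 0)) (Reg 19)))]"

text \<open>A relative error of 1/2 is enough. If \<open>q\<close> lies between \<open>y / 2\<close>
  and \<open>3 * y / 2\<close> with \<open>y > 0\<close>, then
  \<open>\<lfloor>2 * q\<rfloor> + 1\<close> exceeds \<open>y\<close> and
  \<open>\<lfloor>2 / q\<rfloor> + 1\<close> exceeds \<open>1 / y\<close>, and both overshoot only
  by constants, which a polynomial time bound tolerates.\<close>

definition query_prog :: prog where
  "query_prog = block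
    [Ask 8 (MkPair (MkPair (Const 0) (Const 0)) (MkPair (Const 0) (Const 1))),
     Assign 48 (Add (Floor (Add (Reg 8) (Reg 8))) (Const 1)),
     Ask 8 (MkPair (MkPair (Const 1) (Const 0)) (MkPair (Const 0) (Const 1))),
     Assign 49 (Add (Floor (Div (Const 2) (Reg 8))) (Const 1)),
     Assign 50 (Const 1),
     for_loop 23 0 bound_prog]"

text \<open>Registers 48 to 50 hold \<open>Mi\<close>, \<open>E\<close> and \<open>Bi\<close>;
  registers 51 to 55 receive \<open>Lr\<close>, \<open>D\<close>, \<open>nb\<close>,
  \<open>U\<close> and \<open>Wb\<close>.\<close>

definition params_prog :: prog where
  "params_prog = block
    [Assign 51 (Mul (Mul (Const 2) (Reg 49)) (Add (Mul (Reg 48) (Reg 50)) (Const 1))),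
     Assign 52 (Add (Mul (Reg 1) (Reg 51)) (Const 1)),
     Assign 12 (Mul (Mul (Mul (Const 12) (Reg 49)) (Reg 52)) (Reg 48)),
     Assign 53 (Mul (Mul (Reg 0) (Reg 50)) (Reg 12)),
     Assign 13 (Mul (Mul (Mul (Const 20) (Reg 49)) (Reg 52)) (Add (Reg 53) (Const 1))),
     Assign 54 (Add (Mul (Reg 13) (Mul (Reg 48) (Reg 50))) (Const 8)),
     Assign 14 (Mul (Mul (Mul (Const 2) (Reg 49)) (Reg 1)) (Add (Const 1) (Mul (Reg 54) (Reg 54)))),
     Assign 15 (Mul (Reg 14) (Reg 51)),
     Assign 16 (Mul (Reg 15) (Reg 15)),
     Assign 55 (Mul (Add (Mul (Reg 1) (Reg 15)) (Reg 14)) (Add (Mul (Reg 13) (Reg 48)) (Const 4))),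
     Assign 17 (Mul (Reg 55) (Reg 55))]"

text \<open>Registers 18 to 20 initially contain \<open>Num 0\<close>, the empty list. The origin
  and the initial multipliers are lists of zeros.\<close>

definition lists_prog :: prog where
  "lists_prog = block
    [for_loop 22 0 (Assign 18 (MkPair (Const 0) (Reg 18))),
     for_loop 22 1 (Assign 20 (MkPair (Const 0) (Reg 20))),
     for_loop 23 0 coordinate_prog]"

definition main_prog :: prog where
  "main_prog = block [query_prog, params_prog, lists_prog, main_loop]"

context machine_ctx
begin

definition ascend_cost :: nat where "ascend_cost = L * (6 * first + 38) + 10"

lemma ints_bits:
  assumes "length lam \<le> L" "\<forall>z\<in>set lam. 0 \<le> z \<and> z \<le> int Lam"
  shows "bits (enc_ints lam) \<le> b"
proof -
  have "bits (Num (of_int z)) \<le> Lam + 3" if "z \<in> set lam" for z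
  proof (rule bits_of_int_le)
    have "\<bar>z\<bar> \<le> int Lam" using assms(2) that by simp
    also have "\<dots> \<le> 2 ^ Lam" by (simp add: of_nat_less_two_power less_imp_le)
    finally show "\<bar>z\<bar> \<le> 2 ^ Lam" .
  qed
  then have "bits (enc_ints lam) \<le> 2 + L * (1 + (Lam + 3))"
    using assms(1) by (intro bits_enc_le) auto
  moreover have "L * (1 + (Lam + 3)) = L * (Lam + 4)" by (simp add: algebra_simps)
  ultimately show ?thesis using b_big by linarith
qed

lemma W_ascend:
  assumes s: "fits s" and e: "env a s" and lam: "good_multipliers lam"
    and c: "c \<le> count_fst l0" "snd (best lam K) = grid_point N H c"
    and r: "s 33 = list_val (grid_point N H c)" "s 20 = enc_ints lam"
    and Q: "\<And>s'. fits s' \<Longrightarrow> s' 20 = enc_ints (ascend lam) \<Longrightarrow>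
       \<forall>x. x \<notin> {5,6,7,8,9,10,11,20,28,35,36,37,47} \<longrightarrow> s' x = s x \<Longrightarrow> Q s'"
  shows "W ascend_prog ascend_cost Q s"
proof -
  let ?A = "{5,6,7,8,9,10,11,20,28,35,36,37,47} :: nat set"
  define new where "new = ascend lam"
  have len: "length lam = L" "length new = L" using lam by (simp_all add: good_multipliers_def new_def ascend_def)
  have newb: "\<forall>z\<in>set new. 0 \<le> z \<and> z \<le> int Lam"
    by (auto simp: new_def ascend_def clip_bounds)
  have tb: "bits (enc_ints (rev (take m new))) \<le> b" for m
    by (rule ints_bits) (use newb len in \<open>auto dest: in_set_takeD\<close>)
  define J where "J = (\<lambda>m s'. s' 47 = enc_ints (rev (take m new)) \<and> s' 36 = nat_val (Suc m) \<and> s' 7 = nat_val V \<and>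
    (\<forall>x. x \<notin> ?A \<longrightarrow> s' x = s x))"
  have body: "W (block
       [Assign 6 (Reg 33),
        Assign 5 (MkPair (Const 6) (Reg 36)),
        eval_prog,
        Assign 37 (Floor (Mul (Reg 13) (Reg 8))),
        Assign 6 (Const 0),
        Assign 5 (MkPair (Const 3) (Reg 36)),
        eval_prog,
        Assign 28 (Add (Reg 35) (Sub (Reg 37) (Floor (Mul (Reg 13) (Reg 8))))),
        clip_prog 28 15,
        Assign 47 (MkPair (Reg 28) (Reg 47)),
        Assign 36 (Add (Reg 36) (Const 1))]) (6 * first + 32)
       (\<lambda>s'. s' 20 = enc (drop (Suc m) (map (\<lambda>z. Num (of_int z)) lam)) \<and> J (Suc m) s')
      (s1(35 := Num (of_int (lam ! m)), 20 := enc (drop (Suc m) (map (\<lambda>z. Num (of_int z)) lam))))"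
    if m: "m < L" and J: "J m s1"
      and f: "fits (s1(35 := Num (of_int (lam ! m)), 20 := enc (drop (Suc m) (map (\<lambda>z. Num (of_int z)) lam))))"
      (is "fits ?s1") for m s1
  proof -
    have l: "Suc m \<in> {1..L}" using m by auto
    let ?x = "grid_point N H c"
    define z where "z = lam ! m + (fv (Suc m) ?x - gam (Suc m))"
    have nz: "new ! m = clip (int Lam) z"
      using m len unfolding new_def ascend_def z_def c(2) by simp
    have tk: "val.Pair (Num (of_int (clip (int Lam) z))) (enc_ints (rev (take m new))) = enc_ints (rev (take (Suc m) new))"
      using m len nz by (simp add: take_Suc_conv_app_nth)
    have bs: "bits (val.Pair (Num 6) (nat_val (Suc m))) \<le> b" "bits (val.Pair (Num 3) (nat_val (Suc m))) \<le> b"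
      using bits_nat_val[of "Suc m"] m b_big by simp_all
    have bn: "bits (nat_val (Suc (Suc m))) \<le> b" using m b_big by (intro bits_nat_le) linarith
    have fb: "bits (Num (of_int (fv (Suc m) ?x))) \<le> b" unfolding fv_def
      by (rule scaled_bits[OF callable_bits[OF call_f[OF l c(1)] pr]])
    let ?e = "2 ^ (V + ot + 1) :: int"
    have "\<bar>fv (Suc m) ?x\<bar> \<le> ?e" "\<bar>gam (Suc m)\<bar> \<le> ?e" unfolding fv_def gam_def
      using floor_scaled callable_bits[OF call_f[OF l c(1)] pr] callable_bits[OF call_gamma[OF l] pr] by blast+
    moreover have "0 \<le> lam ! m \<and> lam ! m \<le> int Lam" using lam m by (simp add: good_multipliers_def)
    ultimately have "\<bar>z\<bar> \<le> int Lam + ?e + ?e" unfolding z_def by linarith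
    also have "\<dots> \<le> 2 ^ (Lam + (V + ot + 1)) + 2 ^ (Lam + (V + ot + 1)) + 2 ^ (Lam + (V + ot + 1))"
    proof -
      have "int Lam \<le> 2 ^ Lam" by (simp add: of_nat_less_two_power less_imp_le)
      also have "(2::int) ^ Lam \<le> 2 ^ (Lam + (V + ot + 1))" by (rule power_increasing) auto
      finally have "int Lam \<le> 2 ^ (Lam + (V + ot + 1))" .
      moreover have "?e \<le> 2 ^ (Lam + (V + ot + 1))" by (rule power_increasing) auto
      ultimately show ?thesis by linarith
    qed
    also have "\<dots> \<le> 2 ^ (Lam + (V + ot + 1) + 2)" by (simp add: power_add)
    finally have bz: "bits (Num (of_int z)) \<le> b"
      using bits_of_int_le[of z "Lam + (V + ot + 1) + 2"] b_big by (simp add: mag_def)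
    show ?thesis
      apply (rule W_weaken)
       apply (rule W_assign_then[where v = "list_val ?x"])
           apply (rule f)
          apply simp
         using J r apply (simp add: J_def)
        using fitsD[OF s, of 33] r apply simp
       apply (rule W_assign_then[where v = "val.Pair (Num 6) (nat_val (Suc m))"])
           apply assumption
          apply simp
         using J apply (simp add: J_def)
        apply (rule bs)
       apply (rule W_block[OF _ refl])
       apply (rule W_eval'[OF _ call_f[OF l c(1)] _ _ _ pr])
           apply assumption
          apply simp
         apply simp
        using J apply (simp add: J_def)
       apply (rule W_assign_then[where v = "Num (of_int (fv (Suc m) ?x))"])
           apply assumption
          apply simp
         using J e apply (simp add: J_def env_def fv_def)
        apply (rule fb)
       apply (rule W_assign_then[where v = "Num 0"])
           apply assumption
          apply simp
         apply simp
        using mag_le apply simp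
       apply (rule W_assign_then[where v = "val.Pair (Num 3) (nat_val (Suc m))"])
           apply assumption
          apply simp
         using J apply (simp add: J_def)
        apply (rule bs)
       apply (rule W_block[OF _ refl])
       apply (rule W_eval'[OF _ call_gamma[OF l] _ _ _ pr])
           apply assumption
          apply simp
         apply (simp add: list_val_def)
        using J apply (simp add: J_def)
       apply (rule W_assign_then[where v = "Num (of_int z)"])
           apply assumption
          apply simp
         using J e apply (simp add: J_def env_def gam_def[symmetric] z_def)
        apply (rule bz)
       apply (rule W_block[OF _ refl])
       apply (rule W_clip[where z = z and k = Lam])
           apply assumption
          apply simp
         using J e apply (simp add: J_def env_def)
        apply simp
       apply (rule W_assign_then[where v = "enc_ints (rev (take (Suc m) new))"])
           apply assumption
          apply simp
         using J apply (simp add: J_def flip: tk)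
        apply (rule tb)
       apply (rule W_assign_last[where v = "nat_val (Suc (Suc m))"])
           apply assumption
          apply simp
         using J apply (simp add: J_def)
        apply (rule bn)
       using J apply (simp add: J_def)
      apply simp
      done
  qed
  have final: "W (move 47 20) (3 * L + 1) Q s'"
    if s': "fits s'" "J L s'" "s' 20 = Num 0" for s'
  proof -
    have "W (move 47 20) (3 * length (map (\<lambda>z. Num (of_int z)) (rev new)) + 1) Q s'"
    proof (rule W_move[OF s'(1), where ys = "[]"])
      show "s' 47 = enc (map (\<lambda>z. Num (of_int z)) (rev new))" using s'(2) len by (simp add: J_def)
      have id: "rev (map (\<lambda>z. Num (of_int z)) (rev new)) @ [] = map (\<lambda>z. Num (of_int z)) new"
        by (simp add: rev_map)
      show "bits (enc (rev (map (\<lambda>z. Num (of_int z)) (rev new)) @ [])) \<le> b"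
        unfolding id by (rule ints_bits) (use newb len in auto)
      assume "fits (s'(47 := Num 0, 20 := enc (rev (map (\<lambda>z. Num (of_int z)) (rev new)) @ [])))"
      then show "Q (s'(47 := Num 0, 20 := enc (rev (map (\<lambda>z. Num (of_int z)) (rev new)) @ [])))"
        unfolding id by (rule Q) (use s'(2) in \<open>simp_all add: J_def new_def\<close>)
    qed (use s' in simp_all)
    then show ?thesis using len by simp
  qed
  show ?thesis unfolding ascend_prog_def ascend_cost_def
    apply (rule W_weaken)
     apply (rule W_assign_then[where v = "nat_val V"])
         apply (rule s)
        apply simp
       using e apply (simp add: env_def)
      using fitsD[OF s, of 13] e apply (simp add: env_def)
     apply (rule W_assign_then[where v = "nat_val 1"])
         apply assumption
        apply simp
       apply simp
      using mag_le apply simp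
     apply (rule W_assign_then[where v = "Num 0"])
         apply assumption
        apply simp
       apply simp
      using mag_le apply simp
     apply (rule W_chain[where P = "\<lambda>s'. J L s' \<and> s' 20 = Num 0"])
      apply (rule W_for_each[where J = J and xs = "map (\<lambda>z. Num (of_int z)) lam" and k = "6 * first + 32"])
           apply assumption
          using r apply simp
         apply simp
        apply (simp add: J_def)
       using body len apply simp
      using len apply simp
     apply (simp only: block.simps(2))
     apply (rule final)
       apply assumption
      apply simp
     apply simp
    apply (simp add: len algebra_simps)
    done
qed

definition round_cost :: nat where "round_cost = best_cost + value_cost + ascend_cost"

lemma W_round:
  assumes s: "fits s" and e: "env a s" and a: "a \<le> pr" and t: "t < T"
    and r: "s 20 = enc_ints (multipliers t)" "s 21 = Num (total_value a t)"
    and Q: "\<And>s'. fits s' \<Longrightarrow> env a s' \<Longrightarrow> s' 20 = enc_ints (multipliers (Suc t)) \<Longrightarrow>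
       s' 21 = Num (total_value a (Suc t)) \<Longrightarrow> s' 22 = s 22 \<Longrightarrow> Q s'"
  shows "W round_prog round_cost Q s"
proof -
  obtain c where c: "c \<le> count_fst l0" "snd (best (multipliers t) K) = grid_point N H c"
    using grid_best[OF good_multipliers_t] by blast
  have tv: "total_value a (Suc t) = total_value a t + value_of a (grid_point N H c)"
    by (simp add: total_value_def choice_def c(2))
  have ms: "multipliers (Suc t) = ascend (multipliers t)" by (simp add: multipliers_def)
  have tb: "bits (Num (total_value a t + value_of a (grid_point N H c))) \<le> b"
    using total_value_bits(1)[OF a, of "Suc t"] t tv by simp
  show ?thesis unfolding round_prog_def
    apply (rule W_weaken)
     apply (rule W_block[OF _ refl])
     apply (rule W_best[OF s e good_multipliers_t r(1)])
     apply (rule W_block[OF _ refl])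
     apply (rule W_value[where a = a and c = c and q = "total_value a t", OF _ _ a c(1) tb])
         apply assumption
        using e apply (simp add: env_def)
       apply (simp add: stored_best_def c(2))
      using r apply simp
     apply (simp only: block.simps(2))
     apply (rule W_ascend[where a = a, OF _ _ good_multipliers_t[of t] c])
         apply assumption
        using e apply (simp add: env_def)
       apply (simp add: stored_best_def c(2))
      using r apply simp
     apply (rule Q)
         apply assumption
        using e apply (simp add: env_def)
       apply (simp add: ms)
      apply (simp add: tv)
     apply simp
    apply (simp add: round_cost_def)
    done
qed

definition answer :: "nat \<Rightarrow> rat" where "answer a = total_value a T / of_nat T"

lemma answer_bits: "a \<le> pr \<Longrightarrow> bits (Num (answer a)) \<le> b"
proof -
  assume a: "a \<le> pr"
  have T1: "(1::rat) \<le> of_nat T" using pos(5) by simp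
  have "\<bar>answer a\<bar> \<le> \<bar>total_value a T\<bar>"
    using T1 unfolding answer_def abs_divide by (simp add: divide_le_eq mult_le_cancel_left1)
  then have m: "\<bar>answer a\<bar> \<le> 2 ^ (T + ot)" using total_value_bits(2)[OF a order_refl] by linarith
  have "dnm (1 / of_nat T) \<le> int T" by (rule dnm_le[of _ 1]) (use pos in auto)
  also have "\<dots> \<le> 2 ^ T" by (simp add: of_nat_less_two_power less_imp_le)
  finally have "dnm (total_value a T) * dnm (1 / of_nat T) \<le> 2 ^ (T * ot) * 2 ^ T"
    using total_value_bits(3)[OF a order_refl] dnm_pos[of "1 / of_nat T"] by (intro mult_mono) auto
  then have "dnm (answer a) \<le> 2 ^ (T * ot + T)"
    using dnm_mult[of "total_value a T" "1 / of_nat T"] by (simp add: answer_def power_add)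
  from bits_Num_le[OF m this] show ?thesis using b_big by simp
qed

lemma W_main_loop:
  assumes s: "fits s" and e: "env a s" and a: "a \<le> pr"
    and r: "s 20 = enc_ints (replicate L 0)" "s 21 = Num 0"
  shows "W main_loop (T * (round_cost + 2) + 3) (\<lambda>s'. s' 0 = Num (answer a)) s"
  unfolding main_loop_def
  apply (rule W_weaken)
   apply (rule W_chain[where P = "\<lambda>s'. env a s' \<and> s' 21 = Num (total_value a T)"])
    apply (rule W_for[where n = T and k = round_cost and J = "\<lambda>t s'. env a s' \<and>
       s' 20 = enc_ints (multipliers t) \<and> s' 21 = Num (total_value a t)"])
          apply (rule s)
         apply simp
        using e apply (simp add: env_def)
       using b_big apply simp
      using e r apply (simp add: env_def multipliers_def total_value_def)
     subgoal for t s2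
       apply (rule W_round[where a = a and t = t])
            apply assumption
           apply simp
          apply (rule a)
         apply assumption
        apply simp
       apply simp
       apply (simp add: env_def)
       done
    apply simp
   apply (rule W_assign_last[where v = "Num (answer a)"])
       apply assumption
      apply simp
     apply (simp add: env_def answer_def)
    apply (rule answer_bits[OF a])
   apply simp
  apply simp
  done

end

definition coord_bound :: "(val \<Rightarrow> rat) \<Rightarrow> nat \<Rightarrow> int" where
  "coord_bound ans i = \<lfloor>2 * ans (query (Src_B i) [] 1)\<rfloor> + 1"

text \<open>Starting at 1 makes the bound positive whatever the oracle answers.\<close>

definition max_bound :: "(val \<Rightarrow> rat) \<Rightarrow> nat \<Rightarrow> int" where
  "max_bound ans m = fold (\<lambda>i b. max b (coord_bound ans i)) [1..<Suc m] 1"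

lemma max_bound_0 [simp]: "max_bound ans 0 = 1"
  and max_bound_Suc: "max_bound ans (Suc m) = max (max_bound ans m) (coord_bound ans (Suc m))"
  by (simp_all add: max_bound_def)

lemma max_bound_mono: "m \<le> n \<Longrightarrow> max_bound ans m \<le> max_bound ans n"
  by (induction n rule: dec_induct) (auto simp: max_bound_Suc)

lemma max_bound_pos: "1 \<le> max_bound ans m"
  using max_bound_mono[of 0 m] by simp

lemma coord_bound_le: "i \<in> {1..m} \<Longrightarrow> coord_bound ans i \<le> max_bound ans m"
  using max_bound_mono[of i m] max_bound_Suc[of _ "i - 1"] by auto

context machine
begin

definition prefix_list :: "nat \<Rightarrow> (nat \<times> int) list" where
  "prefix_list m = fold (\<lambda>i l. replicate (nat (nsteps i)) (i, 0) @ l) [1..<Suc m] []"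

lemma prefix_list_0 [simp]: "prefix_list 0 = []"
  and prefix_list_Suc: "prefix_list (Suc m) = replicate (nat (nsteps (Suc m))) (Suc m, 0) @ prefix_list m"
  by (simp_all add: prefix_list_def)

lemma l0_prefix: "l0 = prefix_list N"
  by (simp add: l0_def prefix_list_def)

lemma length_prefix_list_mono: "m \<le> n \<Longrightarrow> length (prefix_list m) \<le> length (prefix_list n)"
  by (induction n rule: dec_induct) (auto simp: prefix_list_Suc)

lemma set_prefix_list: "e \<in> set (prefix_list m) \<Longrightarrow> fst e \<in> {1..m} \<and> snd e = 0"
  by (induction m) (auto simp: prefix_list_Suc)

lemma count_prefix_list: "count_fst (prefix_list m) i = (if i \<in> {1..m} then nat (nsteps i) else 0)"
proof (induction m)
  case (Suc m)
  have "count_list (map fst (replicate n (Suc m, 0::int))) i = (if i = Suc m then n else 0)" for n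
    by (induction n) auto
  then show ?case using Suc by (auto simp: prefix_list_Suc)
qed simp

end

locale main_ctx = machine_ctx +
  assumes Mi_eq: "int Mi = \<lfloor>2 * ans (query Src_M [] 1)\<rfloor> + 1"
    and E_eq: "int E = \<lfloor>2 / ans (query Src_eps [] 1)\<rfloor> + 1"
    and Bi_eq: "int Bi = max_bound ans N"
    and coord_bound_nonneg: "\<And>i. i \<in> {1..N} \<Longrightarrow> 0 \<le> coord_bound ans i"
    and call_M: "callable Src_M []" and call_eps: "callable Src_eps []"
    and ge1: "1 \<le> E" "1 \<le> Mi"
begin

lemma W_ask':
  assumes "fits s" "callable h xs" "denote e s = query h xs 1" "cost_factor e + 1 \<le> 1000000"
    "fits (s(x := Num (ans (query h xs 1)))) \<Longrightarrow> Q (s(x := Num (ans (query h xs 1))))"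
  shows "W (Ask x e) 1 Q s"
proof -
  obtain D v where o: "poly_time_oracle ans tm T\<^sub>0 d h D v" "xs \<in> D" "bits (list_val xs) \<le> pb"
    using assms(2) unfolding callable_def by blast
  have "tm (query h xs 1) \<le> ot" "bits (Num (ans (query h xs 1))) \<le> b"
    using query_bounds(1,2)[OF o, of 1] b_big by auto
  then show ?thesis by (intro W_ask) (use assms in auto)
qed

lemma small_int_bits: "0 \<le> z \<Longrightarrow> nat z + 5 \<le> b \<Longrightarrow> bits (Num (of_int z)) \<le> b"
  using bits_nat_le[of "nat z"] by simp

lemma W_bound:
  assumes s: "fits s" and m: "m < N" and r: "s 23 = nat_val (Suc m)" "s 50 = Num (of_int (max_bound ans m))"
    and Q: "\<And>s'. fits s' \<Longrightarrow> s' 50 = Num (of_int (max_bound ans (Suc m))) \<Longrightarrow>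
       \<forall>x. x \<notin> {8,50} \<longrightarrow> s' x = s x \<Longrightarrow> Q s'"
  shows "W bound_prog 4 Q s"
proof -
  have cb: "of_int \<lfloor>2 * ans (query (Src_B (Suc m)) [] (Suc 0))\<rfloor> + 1 = (of_int (coord_bound ans (Suc m)) :: rat)"
    by (simp add: coord_bound_def)
  have i: "Suc m \<in> {1..N}" using m by simp
  have bz: "bits (Num (of_int (coord_bound ans (Suc m)))) \<le> b"
    by (rule small_int_bits) (use coord_bound_nonneg[OF i] coord_bound_le[OF i, of ans] Bi_eq b_big in auto)
  have upd: "W (Cond (Leq (Reg 8) (Reg 50)) (Assign 50 (Reg 50)) (Assign 50 (Reg 8))) (1 + 1) Q t"
    if t: "fits t" "t 8 = Num (of_int (coord_bound ans (Suc m)))" "t 50 = Num (of_int (max_bound ans m))"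
      "\<forall>x. x \<notin> {8} \<longrightarrow> t x = s x" for t
  proof (rule W_cond[OF t(1)])
    assume "denote (Leq (Reg 8) (Reg 50)) t \<noteq> Num 0"
    then have "max_bound ans (Suc m) = max_bound ans m" using t by (simp add: max_bound_Suc split: if_splits)
    then show "W (Assign 50 (Reg 50)) 1 Q t"
      by (intro W_assign'[OF t(1), where v = "Num (of_int (max_bound ans (Suc m)))"] Q)
        (use t fitsD[OF t(1), of 50] in simp_all)
  next
    assume "denote (Leq (Reg 8) (Reg 50)) t = Num 0"
    then have "max_bound ans (Suc m) = coord_bound ans (Suc m)" using t by (simp add: max_bound_Suc split: if_splits)
    then show "W (Assign 50 (Reg 8)) 1 Q t"
      by (intro W_assign'[OF t(1), where v = "Num (of_int (max_bound ans (Suc m)))"] Q)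
        (use t bz in simp_all)
  qed simp
  show ?thesis unfolding bound_prog_def
    apply (rule W_weaken)
     apply (rule W_block[OF _ refl])
     apply (rule W_ask'[OF s call_B[OF i]])
       using r apply (simp add: query_def list_val_def)
      apply simp
     apply (rule W_assign_then[where v = "Num (of_int (coord_bound ans (Suc m)))"])
         apply assumption
        apply simp
       apply (simp add: cb)
      apply (rule bz)
     apply (simp only: block.simps(2))
     apply (rule upd)
        apply assumption
       apply simp
      using r apply simp
     apply simp
    apply simp
    done
qed

lemma W_query:
  assumes s: "fits s" and r: "s 0 = nat_val N"
    and Q: "\<And>s'. fits s' \<Longrightarrow> s' 48 = nat_val Mi \<Longrightarrow> s' 49 = nat_val E \<Longrightarrow> s' 50 = nat_val Bi \<Longrightarrow>
       \<forall>x. x \<notin> {8,23,48,49,50} \<longrightarrow> s' x = s x \<Longrightarrow> Q s'"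
  shows "W query_prog (6 * N + 10) Q s"
proof -
  have Mi': "of_int \<lfloor>2 * ans (query Src_M [] (Suc 0))\<rfloor> + 1 = (of_nat Mi :: rat)"
    using arg_cong[OF Mi_eq, of "of_int :: int \<Rightarrow> rat"] by simp
  have E': "of_int \<lfloor>2 / ans (query Src_eps [] (Suc 0))\<rfloor> + 1 = (of_nat E :: rat)"
    using arg_cong[OF E_eq, of "of_int :: int \<Rightarrow> rat"] by simp
  have B': "of_int (max_bound ans N) = (of_nat Bi :: rat)"
    using arg_cong[OF Bi_eq, of "of_int :: int \<Rightarrow> rat"] by simp
  have nv: "bits (nat_val Mi) \<le> b" "bits (nat_val E) \<le> b" using b_big by (auto intro: bits_nat_le)
  show ?thesis unfolding query_prog_def
    apply (rule W_weaken)
     apply (rule W_block[OF _ refl])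
     apply (rule W_ask'[OF s call_M])
       apply (simp add: query_def list_val_def)
      apply simp
     apply (rule W_assign_then[where v = "nat_val Mi"])
         apply assumption
        apply simp
       apply (simp add: Mi')
      apply (rule nv)
     apply (rule W_block[OF _ refl])
     apply (rule W_ask'[OF _ call_eps])
        apply assumption
       apply (simp add: query_def list_val_def)
      apply simp
     apply (rule W_assign_then[where v = "nat_val E"])
         apply assumption
        apply simp
       apply (simp add: E')
      apply (rule nv)
     apply (rule W_assign_then[where v = "nat_val 1"])
         apply assumption
        apply simp
       apply simp
      using mag_le apply simp
     apply (simp only: block.simps(2))
     apply (rule W_for[where n = N and k = 4 and J = "\<lambda>m s'. s' 50 = Num (of_int (max_bound ans m)) \<and>
        s' 48 = nat_val Mi \<and> s' 49 = nat_val E \<and> (\<forall>x. x \<notin> {8,23,48,49,50} \<longrightarrow> s' x = s x)"])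
           apply assumption
          apply simp
         using r apply simp
        using b_big apply simp
       apply simp
      subgoal for m s2
        apply (rule W_bound[where m = m])
            apply assumption
           apply simp
          apply simp
         apply simp
        apply simp
        done
     apply (rule Q)
         apply assumption
        apply simp
       apply simp
      apply (simp add: B')
     apply simp
    apply simp
    done
qed

text \<open>\<open>U\<close>, \<open>Wb\<close> and \<open>nb\<close> are not summands of
  \<open>b_big\<close>; comparing them with summands bounds the registers that hold them.\<close>

lemma squares_le: "U \<le> S" "Wb \<le> Z" "Lam \<le> T" "nb \<le> V"
proof -
  have sq: "n \<le> n\<^sup>2" for n :: nat by (simp add: power2_eq_square)
  have "1 \<le> 2 * E * L" using ge1 pos by (simp add: Suc_le_eq)
  from mult_le_mono1[OF this, of "1 + U\<^sup>2"] have "1 + U\<^sup>2 \<le> S" unfolding S_def mult_1 .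
  moreover have "U \<le> 1 + U\<^sup>2" using sq[of U] by simp
  ultimately show "U \<le> S" by (rule order.trans[rotated])
  show "Wb \<le> Z" "Lam \<le> T" unfolding Z_def T_def by (rule sq)+
  have "1 \<le> 20 * E * D" using ge1 by (simp add: Suc_le_eq D_def)
  from mult_le_mono1[OF this, of "nb + 1"] have "nb + 1 \<le> V" unfolding V_def mult_1 .
  then show "nb \<le> V" by simp
qed

lemma W_params:
  assumes s: "fits s" and r: "s 0 = nat_val N" "s 1 = nat_val L" "s 48 = nat_val Mi" "s 49 = nat_val E" "s 50 = nat_val Bi"
    and Q: "\<And>s'. fits s' \<Longrightarrow> s' 12 = nat_val H \<Longrightarrow> s' 13 = nat_val V \<Longrightarrow> s' 14 = nat_val S \<Longrightarrow>
       s' 15 = nat_val Lam \<Longrightarrow> s' 16 = nat_val T \<Longrightarrow> s' 17 = nat_val Z \<Longrightarrow>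
       \<forall>x. x \<notin> {12,13,14,15,16,17,51,52,53,54,55} \<longrightarrow> s' x = s x \<Longrightarrow> Q s'"
  shows "W params_prog 11 Q s"
proof -
  have nv: "bits (nat_val Lr) \<le> b" "bits (nat_val D) \<le> b" "bits (nat_val H) \<le> b" "bits (nat_val nb) \<le> b"
    "bits (nat_val V) \<le> b" "bits (nat_val U) \<le> b" "bits (nat_val S) \<le> b" "bits (nat_val Lam) \<le> b"
    "bits (nat_val T) \<le> b" "bits (nat_val Wb) \<le> b" "bits (nat_val Z) \<le> b"
    using b_big squares_le by (auto intro!: bits_nat_le)
  show ?thesis unfolding params_prog_def
    apply (rule W_weaken)
     apply (rule W_assign_then[where v = "nat_val Lr"], rule s, simp)
       using r apply (simp add: Lr_def algebra_simps)
      apply (rule nv)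
     apply (rule W_assign_then[where v = "nat_val D"], assumption, simp)
       using r apply (simp add: D_def algebra_simps)
      apply (rule nv)
     apply (rule W_assign_then[where v = "nat_val H"], assumption, simp)
       using r apply (simp add: H_def algebra_simps)
      apply (rule nv)
     apply (rule W_assign_then[where v = "nat_val nb"], assumption, simp)
       using r apply (simp add: nb_def algebra_simps)
      apply (rule nv)
     apply (rule W_assign_then[where v = "nat_val V"], assumption, simp)
       using r apply (simp add: V_def algebra_simps)
      apply (rule nv)
     apply (rule W_assign_then[where v = "nat_val U"], assumption, simp)
       using r apply (simp add: U_def algebra_simps)
      apply (rule nv)
     apply (rule W_assign_then[where v = "nat_val S"], assumption, simp)
       using r apply (simp add: S_def power2_eq_square algebra_simps)
      apply (rule nv)
     apply (rule W_assign_then[where v = "nat_val Lam"], assumption, simp)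
       using r apply (simp add: Lam_def algebra_simps)
      apply (rule nv)
     apply (rule W_assign_then[where v = "nat_val T"], assumption, simp)
       using r apply (simp add: T_def power2_eq_square algebra_simps)
      apply (rule nv)
     apply (rule W_assign_then[where v = "nat_val Wb"], assumption, simp)
       using r apply (simp add: Wb_def algebra_simps)
      apply (rule nv)
     apply (rule W_assign_last[where v = "nat_val Z"], assumption, simp)
       using r apply (simp add: Z_def power2_eq_square algebra_simps)
      apply (rule nv)
     apply (rule Q)
            apply assumption
           apply simp_all
    done
qed

lemma W_fill:
  assumes s: "fits s" and r: "s nr = nat_val n" "s x = Num 0" and ne: "x \<noteq> 22" "nr \<noteq> 22" "x \<noteq> nr" and n: "3 * n + 10 \<le> b"
    and Q: "\<And>s'. fits s' \<Longrightarrow> s' x = enc (replicate n (Num 0)) \<Longrightarrow> \<forall>y. y \<notin> {22, x} \<longrightarrow> s' y = s y \<Longrightarrow> Q s'"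
  shows "W (for_loop 22 nr (Assign x (MkPair (Const 0) (Reg x)))) (3 * n + 2) Q s"
  apply (rule W_weaken)
   apply (rule W_for[where n = n and k = 1 and J = "\<lambda>m s'. s' x = enc (replicate m (Num 0)) \<and>
      (\<forall>y. y \<notin> {22, x} \<longrightarrow> s' y = s y)"])
         apply (rule s)
        using ne apply simp
       apply (rule r)
      using n apply simp
     using r ne apply simp
    subgoal for m s2
      apply (rule W_assign'[where v = "enc (replicate (Suc m) (Num 0))"])
          apply assumption
         apply simp
        apply simp
       using n apply (simp add: bits_enc sum_list_replicate)
      using ne apply auto
      done
   using Q apply simp
  apply simp
  done

definition coord_cost :: nat where "coord_cost = 3 * first + 3 * nb + 20"

lemma W_coordinate:
  assumes s: "fits s" and m: "m < N" and r: "s 23 = nat_val (Suc m)" "s 13 = nat_val V" "s 12 = nat_val H"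
      "s 19 = enc_pairs (prefix_list m)"
    and Q: "\<And>s'. fits s' \<Longrightarrow> s' 19 = enc_pairs (prefix_list (Suc m)) \<Longrightarrow>
       \<forall>x. x \<notin> {5,6,7,8,9,10,11,19,25,52} \<longrightarrow> s' x = s x \<Longrightarrow> Q s'"
  shows "W coordinate_prog coord_cost Q s"
proof -
  let ?A = "{5,6,7,8,9,10,11,19,25,52} :: nat set"
  have i: "Suc m \<in> {1..N}" using m by simp
  define k where "k = nat (nsteps (Suc m))"
  have le: "length (prefix_list (Suc m)) \<le> nb"
    using length_prefix_list_mono[of "Suc m" N] m length_l0 unfolding l0_prefix by simp
  then have knb: "k \<le> nb" unfolding prefix_list_Suc k_def by simp
  have ok: "ok_pairs (replicate j (Suc m, 0) @ prefix_list m)" if "j \<le> k" for j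
  proof -
    have "length (replicate j (Suc m, 0::int) @ prefix_list m) \<le> length (prefix_list (Suc m))"
      using that unfolding prefix_list_Suc k_def by simp
    then show ?thesis using le m set_prefix_list[of _ m] by (fastforce simp: ok_pairs_def)
  qed
  let ?q = "eval_abs ans (Src_B (Suc m)) [] V"
  have qb: "bits (Num ?q) \<le> ot" by (rule callable_bits[OF call_B[OF i] pr])
  have nb1: "bits (Num (of_int (nsteps (Suc m)))) \<le> b"
  proof -
    have "\<bar>of_nat H * ?q\<bar> \<le> 2 ^ H * 2 ^ ot"
      unfolding abs_mult using bits_NumD(1)[OF qb]
      by (intro mult_mono) (auto simp: of_nat_less_two_power less_imp_le)
    then have "\<bar>of_nat H * ?q\<bar> \<le> 2 ^ (H + ot)" by (simp add: power_add)
    moreover have "(1 :: rat) \<le> 2 ^ (H + ot)" by simp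
    ultimately have "of_int \<bar>nsteps (Suc m)\<bar> \<le> (2 :: rat) ^ (H + ot) + 2 ^ (H + ot) + 2 ^ (H + ot)"
      unfolding nsteps_def by linarith
    also have "\<dots> \<le> of_int (2 ^ (H + ot + 2))" by (simp add: power_add)
    finally have "\<bar>nsteps (Suc m)\<bar> \<le> 2 ^ (H + ot + 2)" by (simp only: of_int_le_iff)
    from bits_of_int_le[OF this] show ?thesis using b_big by linarith
  qed
  have bs: "bits (val.Pair (Num 2) (nat_val (Suc m))) \<le> b"
    using bits_nat_val[of "Suc m"] m b_big by simp
  have kb: "bits (nat_val k) \<le> b" using knb b_big squares_le by (intro bits_nat_le) linarith
  have upd: "W (Cond (Leq (Reg 52) (Const 0)) (Assign 52 (Const 0)) (Assign 52 (Reg 52))) (1 + 1)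
      (\<lambda>s'. s' = t(52 := nat_val k)) t"
    if t: "fits t" "t 52 = Num (of_int (nsteps (Suc m)))" for t
  proof (rule W_cond[OF t(1)])
    assume "denote (Leq (Reg 52) (Const 0)) t \<noteq> Num 0"
    then have "k = 0" using t by (simp add: k_def split: if_splits)
    then show "W (Assign 52 (Const 0)) 1 (\<lambda>s'. s' = t(52 := nat_val k)) t"
      by (intro W_assign'[OF t(1), where v = "nat_val k"]) (use kb in simp_all)
  next
    assume "denote (Leq (Reg 52) (Const 0)) t = Num 0"
    then have "int k = nsteps (Suc m)" using t by (simp add: k_def split: if_splits)
    then have "t 52 = nat_val k" using t(2) by (metis of_int_of_nat_eq)
    then show "W (Assign 52 (Reg 52)) 1 (\<lambda>s'. s' = t(52 := nat_val k)) t"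
      by (intro W_assign'[OF t(1), where v = "nat_val k"]) (use kb in simp_all)
  qed simp
  show ?thesis unfolding coordinate_prog_def
    apply (rule W_weaken)
     apply (rule W_assign_then[where v = "val.Pair (Num 2) (nat_val (Suc m))"])
         apply (rule s)
        apply simp
       using r apply simp
      apply (rule bs)
     apply (rule W_assign_then[where v = "Num 0"])
         apply assumption
        apply simp
       apply simp
      using mag_le apply simp
     apply (rule W_assign_then[where v = "nat_val V"])
         apply assumption
        apply simp
       using r apply simp
      using fitsD[OF s, of 13] r apply simp
     apply (rule W_block[OF _ refl])
     apply (rule W_eval'[OF _ call_B[OF i] _ _ _ pr])
         apply assumption
        apply simp
       apply (simp add: list_val_def)
      apply simp
     apply (rule W_assign_then[where v = "Num (of_int (nsteps (Suc m)))"])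
         apply assumption
        apply simp
       using r apply (simp add: nsteps_def)
      apply (rule nb1)
     apply (rule W_chain[OF upd])
       apply assumption
      apply simp
     apply (simp only: block.simps(2))
     apply (rule W_for[where n = k and k = 1 and J = "\<lambda>j s'. s' 19 = enc_pairs (replicate j (Suc m, 0) @ prefix_list m) \<and>
        (\<forall>x. x \<notin> ?A \<longrightarrow> s' x = s x)"])
           apply assumption
          apply simp
         apply simp
        using knb b_big squares_le apply linarith
       using r apply simp
      subgoal for _ _ j s2
        apply (rule W_assign'[where v = "enc_pairs (replicate (Suc j) (Suc m, 0) @ prefix_list m)"])
            apply assumption
           apply simp
          using r apply simp
         apply (rule ok_pairs_bits[OF ok]) apply simp
        apply simp
        done
     apply (rule Q)
       apply assumption
      apply (simp add: prefix_list_Suc k_def)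
     apply simp
    using knb apply (simp add: coord_cost_def)
    done
qed

definition total_steps :: nat where
  "total_steps = N * (coord_cost + 20) + 10 * L + 100 + T * (round_cost + 2)"

lemma W_main:
  assumes s: "fits s" and a: "a \<le> pr"
    and r: "s 0 = nat_val N" "s 1 = nat_val L" "s 2 = nat_val K" "s 4 = nat_val a"
      "s 18 = Num 0" "s 19 = Num 0" "s 20 = Num 0" "s 21 = Num 0"
  shows "W main_prog total_steps (\<lambda>s'. s' 0 = Num (answer a)) s"
proof -
  have org: "list_val origin = enc (replicate N (Num 0))"
    unfolding origin_def grid_point_def list_val_enc by (simp add: map_replicate_const del: upt_Suc)
  have "2 + N * 3 \<le> pb"
    using point_bits[of "\<lambda>_. 0"] org by (auto simp: le_fun_def origin_def bits_enc sum_list_replicate)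
  moreover have "4 * L \<le> L * (Lam + 4)" by (simp add: algebra_simps)
  ultimately have lens: "3 * N + 10 \<le> b" "3 * L + 10 \<le> b" using b_big by linarith+
  have coords: "W (for_loop 23 0 coordinate_prog) (N * (coord_cost + 2) + 2) P s4"
    if f: "fits s4" and r4: "s4 0 = nat_val N" "s4 13 = nat_val V" "s4 12 = nat_val H" "s4 19 = Num 0"
      and P: "\<And>s'. s' 19 = enc_pairs l0 \<Longrightarrow> \<forall>x. x \<notin> {5,6,7,8,9,10,11,19,23,25,52} \<longrightarrow> s' x = s4 x \<Longrightarrow> P s'"
    for s4 P
    apply (rule W_for[where n = N and k = coord_cost and J = "\<lambda>m s'. s' 19 = enc_pairs (prefix_list m) \<and>
       (\<forall>x. x \<notin> {5,6,7,8,9,10,11,19,23,25,52} \<longrightarrow> s' x = s4 x)"])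
          apply (rule f)
         apply simp
        apply (rule r4)
       using b_big apply simp
      using r4 apply simp
     subgoal for m s5
       apply (rule W_coordinate[where m = m])
             apply assumption
            apply assumption
           apply simp
          using r4 apply simp
         using r4 apply simp
        apply simp
       apply simp
       done
    apply (rule P)
     apply (simp add: l0_prefix)
    apply simp
    done
  show ?thesis unfolding main_prog_def
    apply (rule W_weaken)
     apply (rule W_block[OF _ refl])
     apply (rule W_query[OF s r(1)])
     apply (rule W_block[OF _ refl])
     apply (rule W_params)
           apply assumption
          using r apply simp
         using r apply simp
        apply simp
       apply simp
      apply simp
     apply (rule W_chain[where P = "\<lambda>s'. env a s' \<and> s' 20 = enc_ints (replicate L 0) \<and> s' 21 = Num 0"])
      apply (simp only: lists_prog_def)
      apply (rule W_block[OF _ refl])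
      apply (rule W_fill[where n = N])
             apply assumption
            using r apply simp
           using r apply simp
          apply simp
         apply simp
        apply simp
       apply (rule lens)
      apply (rule W_block[OF _ refl])
      apply (rule W_fill[where n = L])
             apply assumption
            using r apply simp
           using r apply simp
          apply simp
         apply simp
        apply simp
       apply (rule lens)
      apply (simp only: block.simps(2))
      apply (rule coords)
                apply assumption
          using r apply simp
         apply simp
        apply simp
       using r apply simp
      using r org apply (simp add: env_def map_replicate_const)
     apply (simp only: block.simps(2))
     apply (rule W_main_loop[OF _ _ a])
        apply assumption
       apply simp
      apply simp
     apply simp
    apply (simp add: total_steps_def algebra_simps)
    done
qed

end

section \<open>Correctness on an instance\<close>

lemma floor_rat_real:
  "real_of_int \<lfloor>x :: rat\<rfloor> \<le> of_rat x" "of_rat x < real_of_int \<lfloor>x\<rfloor> + 1"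
proof -
  have "(of_rat (of_int \<lfloor>x\<rfloor>) :: real) \<le> of_rat x" unfolding of_rat_less_eq by simp
  then show "real_of_int \<lfloor>x\<rfloor> \<le> of_rat x" by simp
  have "(of_rat x :: real) < of_rat (of_int \<lfloor>x\<rfloor> + 1)" unfolding of_rat_less by linarith
  then show "of_rat x < real_of_int \<lfloor>x\<rfloor> + 1" by (simp add: of_rat_add)
qed

lemma abs_average_le:
  fixes e :: "nat \<Rightarrow> real"
  assumes e: "\<And>t. \<bar>e t\<bar> \<le> k" and n: "0 < n"
  shows "\<bar>(\<Sum>t<n. e t) / real n\<bar> \<le> k"
proof -
  have "\<bar>\<Sum>t<n. e t\<bar> \<le> (\<Sum>t<n. \<bar>e t\<bar>)" by (rule sum_abs)
  also have "\<dots> \<le> (\<Sum>t<n. k)" by (intro sum_mono e)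
  finally have "\<bar>\<Sum>t<n. e t\<bar> \<le> k * n" by (simp add: mult.commute)
  then show ?thesis using n by (simp add: abs_divide divide_le_eq)
qed

lemma of_rat_Max:
  assumes "finite A" "A \<noteq> {}"
  shows "(of_rat (Max (q ` A)) :: real) = Max ((\<lambda>x. of_rat (q x)) ` A)"
proof -
  have "mono (of_rat :: rat \<Rightarrow> real)" by (simp add: mono_def of_rat_less_eq)
  from mono_Max_commute[OF this, of "q ` A"] show ?thesis using assms by (simp add: image_image)
qed

lemma number_oracle_half:
  assumes "number_oracle ans tm T d h y" "0 \<le> y"
  shows "y / 2 \<le> of_rat (ans (query h [] 1))" "of_rat (ans (query h [] 1)) \<le> 3 * y / 2"
proof -
  have "\<bar>of_rat (ans (query h [] 1)) - y\<bar> \<le> \<bar>y\<bar> / 2 ^ 1"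
    using assms unfolding number_oracle_def poly_time_oracle_def by blast
  then have "\<bar>of_rat (ans (query h [] 1)) - y\<bar> \<le> y / 2" using assms(2) by simp
  then show "y / 2 \<le> of_rat (ans (query h [] 1))" "of_rat (ans (query h [] 1)) \<le> 3 * y / 2"
    by linarith+
qed

section \<open>Integer bounds on the data of an instance\<close>

locale problem =
  fixes N L K :: nat and M :: real and B :: "nat \<Rightarrow> real" and f :: "nat \<Rightarrow> (nat \<Rightarrow> real) \<Rightarrow> real"
    and \<gamma> :: "nat \<Rightarrow> real" and gs :: "nat \<Rightarrow> (nat \<Rightarrow> real) \<Rightarrow> real" and \<epsilon> :: real
    and ans :: "val \<Rightarrow> rat" and tm :: "val \<Rightarrow> nat" and T\<^sub>0 d :: nat
  assumes ge1: "1 \<le> N" "1 \<le> L" "1 \<le> K" and M: "0 < M" and \<epsilon>: "0 < \<epsilon>"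
    and B: "\<And>i. i \<in> {1..N} \<Longrightarrow> 0 \<le> B i"
    and f: "\<And>l. l \<in> {1..L} \<Longrightarrow> submodular (cuboid N B) (f l) \<and> lipschitz_infnorm N M (cuboid N B) (f l) \<and>
         function_oracle ans tm T\<^sub>0 d (Src_f l) N (cuboid N B) (f l)"
    and gs: "\<And>k. k \<in> {1..K} \<Longrightarrow> supermodular (cuboid N B) (gs k) \<and> lipschitz_infnorm N M (cuboid N B) (gs k) \<and>
         function_oracle ans tm T\<^sub>0 d (Src_g k) N (cuboid N B) (gs k)"
    and oM: "number_oracle ans tm T\<^sub>0 d Src_M M" and oeps: "number_oracle ans tm T\<^sub>0 d Src_eps \<epsilon>"
    and oB: "\<And>i. i \<in> {1..N} \<Longrightarrow> number_oracle ans tm T\<^sub>0 d (Src_B i) (B i)"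
    and ogamma: "\<And>l. l \<in> {1..L} \<Longrightarrow> number_oracle ans tm T\<^sub>0 d (Src_gamma l) (\<gamma> l)"
begin

definition Mi :: nat where "Mi = nat (\<lfloor>2 * ans (query Src_M [] 1)\<rfloor> + 1)"
definition E :: nat where "E = nat (\<lfloor>2 / ans (query Src_eps [] 1)\<rfloor> + 1)"
definition Bi :: nat where "Bi = nat (max_bound ans N)"

lemma Mi: "int Mi = \<lfloor>2 * ans (query Src_M [] 1)\<rfloor> + 1" "1 \<le> Mi" "M \<le> Mi" "Mi \<le> 3 * M + 1"
proof -
  let ?q = "ans (query Src_M [] 1)"
  note h = number_oracle_half[OF oM less_imp_le[OF M]]
  have r: "(of_rat (2 * ?q) :: real) = 2 * of_rat ?q" by (simp add: of_rat_mult)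
  have "(of_rat 0 :: real) \<le> of_rat (2 * ?q)" unfolding r of_rat_0 using h M by linarith
  then have "0 \<le> \<lfloor>2 * ?q\<rfloor>" unfolding of_rat_less_eq by simp
  then show i: "int Mi = \<lfloor>2 * ?q\<rfloor> + 1" "1 \<le> Mi" unfolding Mi_def by linarith+
  have "real Mi = real_of_int \<lfloor>2 * ?q\<rfloor> + 1" using i(1) by linarith
  then show "M \<le> Mi" "Mi \<le> 3 * M + 1" using floor_rat_real[of "2 * ?q"] h unfolding r by linarith+
qed

lemma E: "int E = \<lfloor>2 / ans (query Src_eps [] 1)\<rfloor> + 1" "1 \<le> E" "1 / E \<le> \<epsilon>" "E \<le> 4 / \<epsilon> + 1"
proof -
  let ?q = "ans (query Src_eps [] 1)"
  note h = number_oracle_half[OF oeps less_imp_le[OF \<epsilon>]]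
  have q: "0 < (of_rat ?q :: real)" using h(1) \<epsilon> by linarith
  have r: "(of_rat (2 / ?q) :: real) = 2 / of_rat ?q" by (simp add: of_rat_divide)
  have "(of_rat 0 :: real) \<le> of_rat (2 / ?q)" using q unfolding r by simp
  then have "0 \<le> \<lfloor>2 / ?q\<rfloor>" unfolding of_rat_less_eq by simp
  then show i: "int E = \<lfloor>2 / ?q\<rfloor> + 1" "1 \<le> E" unfolding E_def by linarith+
  have e: "real E = real_of_int \<lfloor>2 / ?q\<rfloor> + 1" using i(1) by linarith
  have "2 / of_rat ?q \<le> 2 / (\<epsilon> / 2)" using h(1) \<epsilon> q by (intro divide_left_mono mult_pos_pos) auto
  then show "E \<le> 4 / \<epsilon> + 1" using floor_rat_real(1)[of "2 / ?q"] e unfolding r by simp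
  have "2 / (3 * \<epsilon> / 2) \<le> 2 / of_rat ?q" using h(2) q \<epsilon> by (intro divide_left_mono mult_pos_pos) auto
  moreover have "1 / \<epsilon> \<le> 2 / (3 * \<epsilon> / 2)" using \<epsilon> by (simp add: field_simps)
  ultimately have "1 / \<epsilon> \<le> E" using floor_rat_real(2)[of "2 / ?q"] e unfolding r by linarith
  then show "1 / E \<le> \<epsilon>" using \<epsilon> i(2) by (simp add: field_simps)
qed

lemma coord_bound:
  assumes "i \<in> {1..N}"
  shows "0 \<le> coord_bound ans i" "B i \<le> real_of_int (coord_bound ans i)" "real_of_int (coord_bound ans i) \<le> 3 * B i + 1"
proof -
  let ?q = "ans (query (Src_B i) [] 1)"
  note h = number_oracle_half[OF oB[OF assms] B[OF assms]]
  have r: "(of_rat (2 * ?q) :: real) = 2 * of_rat ?q" by (simp add: of_rat_mult)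
  have "(of_rat 0 :: real) \<le> of_rat (2 * ?q)" unfolding r of_rat_0 using h B[OF assms] by linarith
  then have "0 \<le> \<lfloor>2 * ?q\<rfloor>" unfolding of_rat_less_eq by simp
  then show "0 \<le> coord_bound ans i" unfolding coord_bound_def by simp
  show "B i \<le> real_of_int (coord_bound ans i)" "real_of_int (coord_bound ans i) \<le> 3 * B i + 1"
    using floor_rat_real[of "2 * ?q"] h unfolding coord_bound_def r by simp_all
qed

lemma Bi: "int Bi = max_bound ans N" "1 \<le> Bi" "i \<in> {1..N} \<Longrightarrow> B i \<le> Bi" "Bi \<le> 3 * Max (B ` {1..N}) + 1"
proof -
  show e: "int Bi = max_bound ans N" "1 \<le> Bi" using max_bound_pos[of ans N] unfolding Bi_def by linarith+
  show "B i \<le> Bi" if i: "i \<in> {1..N}"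
  proof -
    have "real_of_int (coord_bound ans i) \<le> real_of_int (int Bi)"
      unfolding e(1) of_int_le_iff by (rule coord_bound_le[OF i])
    then show ?thesis using coord_bound(2)[OF i] by simp
  qed
  have m0: "0 \<le> Max (B ` {1..N})"
  proof -
    have "0 \<le> B 1" using ge1 by (intro B) simp
    also have "B 1 \<le> Max (B ` {1..N})" using ge1 by (intro Max_ge) auto
    finally show ?thesis .
  qed
  have "real_of_int (max_bound ans m) \<le> 3 * Max (B ` {1..N}) + 1" if "m \<le> N" for m
    using that
  proof (induction m)
    case (Suc m)
    have i: "Suc m \<in> {1..N}" using Suc.prems by simp
    have "B (Suc m) \<le> Max (B ` {1..N})" using i by (intro Max_ge) auto
    then have "real_of_int (coord_bound ans (Suc m)) \<le> 3 * Max (B ` {1..N}) + 1"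
      using coord_bound(3)[OF i] by linarith
    moreover have "real_of_int (max_bound ans m) \<le> 3 * Max (B ` {1..N}) + 1" using Suc by simp
    ultimately show ?case unfolding max_bound_Suc max_def by simp
  qed (use m0 in simp)
  then have "real_of_int (max_bound ans N) \<le> 3 * Max (B ` {1..N}) + 1" by simp
  moreover have "real Bi = real_of_int (max_bound ans N)"
    using arg_cong[OF e(1), of real_of_int] by simp
  ultimately show "Bi \<le> 3 * Max (B ` {1..N}) + 1" by simp
qed

end

section \<open>Explicit bounds on bits and time\<close>

context params
begin

definition pb :: nat where "pb = 2 + N * (1 + (nb + 2 * H + 3))"
text \<open>Serves both precisions in use: \<open>V\<close> for the decisions and \<open>a\<close>
  for the reported values.\<close>

definition prec :: "nat \<Rightarrow> nat" where "prec a = V + a"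
definition first :: "nat \<Rightarrow> nat \<Rightarrow> nat" where "first T\<^sub>0 d = T\<^sub>0 * (2 + pb) ^ d"
definition ot :: "nat \<Rightarrow> nat \<Rightarrow> nat \<Rightarrow> nat" where
  "ot T\<^sub>0 d a = T\<^sub>0 * (4 + prec a + first T\<^sub>0 d + pb) ^ d"
text \<open>The left-hand side of \<open>b_big\<close> with \<open>mag\<close> written out, plus
  \<open>R\<close>, which the initial store holds in register 3.\<close>

definition regbits :: "nat \<Rightarrow> nat \<Rightarrow> nat \<Rightarrow> nat \<Rightarrow> nat" where
  "regbits T\<^sub>0 d R a = (S + L * Lam + V + ot T\<^sub>0 d a + 1) + Z + 2 * (T * ot T\<^sub>0 d a) + 3 * T + ot T\<^sub>0 d a + pb
     + nb * (N + Z + 8) + L * (Lam + 4) + Lam + K + L + N + H + V + S + Mi + Bi + E + Lr + D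
     + prec a + first T\<^sub>0 d + R + 100"
text \<open>The step counts of all subprograms expanded into one expression in the parameters, so
  that its polynomial bound follows from its syntax.\<close>

definition steps :: "nat \<Rightarrow> nat" where
  "steps q = (let obj = L * (3 * q + 14) + 3 * q + 20; sweep = nb * ((10 * N + 5) + obj + 20) + 1;
     descent = obj + sweep + nb * (6 * nb + 7) + 12; scan = Z * (descent + 2) + 3
     in N * ((3 * q + 3 * nb + 20) + 20) + 10 * L + 100 +
       T * ((K * (scan + 2) + obj + 6) + (K * (3 * q + 13) + 3 * q + 16) + (L * (6 * q + 38) + 10) + 2))"
definition time :: "nat \<Rightarrow> nat \<Rightarrow> nat \<Rightarrow> nat \<Rightarrow> nat" where
  "time T\<^sub>0 d R a = steps (first T\<^sub>0 d) * (1000000 * regbits T\<^sub>0 d R a + ot T\<^sub>0 d a)"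

end

section \<open>The algorithm on an instance\<close>

locale problem_at = problem + fixes R a :: nat
begin

abbreviation "X \<equiv> cuboid N B"

sublocale machine ans tm "params.regbits N L K Mi Bi E T\<^sub>0 d R a" "params.ot N L Mi Bi E T\<^sub>0 d a" T\<^sub>0 d
    "params.pb N L Mi Bi E" "params.prec N L Mi Bi E a" "params.first N L Mi Bi E T\<^sub>0 d" N L K Mi Bi E
  by unfold_locales (simp_all add: params.first_def params.ot_def params.regbits_def)

text \<open>\<open>H \<le> V\<close> makes precision \<open>V\<close> sufficient for the box bounds
  too, since \<open>H / 2 ^ V\<close> is then at most 1.\<close>

lemma H_pos: "0 < H" and V_ge: "H \<le> V"
proof -
  have D: "0 < D" by (simp add: D_def)
  show H: "0 < H" unfolding H_def using E(2) Mi(2) D by (intro mult_pos_pos) auto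
  have "1 \<le> N * Bi" using ge1 Bi(2) by (simp add: Suc_le_eq)
  from mult_le_mono1[OF this, of H] have "H \<le> nb" unfolding nb_def mult_1 .
  then have "H \<le> nb + 1" by simp
  moreover have "1 \<le> 20 * E * D" using E(2) D by (simp add: Suc_le_eq)
  from mult_le_mono1[OF this, of "nb + 1"] have "nb + 1 \<le> V" unfolding V_def mult_1 .
  ultimately show "H \<le> V" by (rule order.trans)
qed

lemma number_approx:
  "number_oracle ans tm T\<^sub>0 d h y \<Longrightarrow> \<bar>of_rat (eval_abs ans h [] n) - y\<bar> \<le> 1 / 2 ^ n"
  using eval_abs_error[of ans tm T\<^sub>0 d h "{[]}" "\<lambda>_. y" "[]" n] by (simp add: number_oracle_def)

lemma function_approx:
  "function_oracle ans tm T\<^sub>0 d h N X ff \<Longrightarrow> xs \<in> rat_points N X \<Longrightarrow>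
     \<bar>of_rat (eval_abs ans h xs n) - ff (point N xs)\<bar> \<le> 1 / 2 ^ n"
  using eval_abs_error[of ans tm T\<^sub>0 d h "rat_points N X" "\<lambda>xs. ff (point N xs)" xs n]
  by (simp add: function_oracle_def)

text \<open>The oracle contributes an error of at most 1, because \<open>V / 2 ^ V\<close> is at
  most 1, and the floor contributes another 1.\<close>

lemma scaled_approx:
  fixes y :: real and q :: rat
  assumes "\<bar>of_rat q - y\<bar> \<le> 1 / 2 ^ V" shows "\<bar>real_of_int \<lfloor>of_nat V * q\<rfloor> - V * y\<bar> \<le> 2"
proof -
  have "real V \<le> 2 ^ V" by (simp add: of_nat_less_two_power less_imp_le)
  then have "V * (1 / 2 ^ V) \<le> (1 :: real)" by simp
  moreover have "V * \<bar>of_rat q - y\<bar> \<le> V * (1 / 2 ^ V)" using assms by (intro mult_left_mono) auto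
  moreover have "V * \<bar>of_rat q - y\<bar> = \<bar>V * of_rat q - V * y\<bar>"
    by (simp add: abs_mult flip: right_diff_distrib)
  moreover have "(of_rat (of_nat V * q) :: real) = V * of_rat q" by (simp add: of_rat_mult)
  ultimately show ?thesis using floor_rat_real[of "of_nat V * q"] by linarith
qed

lemma count_l0: "count_fst l0 i = (if i \<in> {1..N} then nat (nsteps i) else 0)"
  unfolding l0_prefix by (rule count_prefix_list)

text \<open>After scaling by \<open>H\<close> the oracle errs by at most 1, so subtracting 1 keeps
  the count below \<open>B i * H\<close>. Oracle, floor and subtraction together lose at most
  3.\<close>

lemma nsteps_bounds:
  assumes i: "i \<in> {1..N}"
  shows "real (nat (nsteps i)) \<le> B i * H" "B i * H \<le> real (nat (nsteps i)) + 3"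
proof -
  let ?q = "eval_abs ans (Src_B i) [] V"
  have HV: "real H \<le> 2 ^ V"
  proof -
    have "real H \<le> real V" using V_ge by simp
    also have "\<dots> \<le> 2 ^ V" by (simp add: of_nat_less_two_power less_imp_le)
    finally show ?thesis .
  qed
  have "H * \<bar>of_rat ?q - B i\<bar> \<le> H * (1 / 2 ^ V)" using number_approx[OF oB[OF i], of V] by (intro mult_left_mono) auto
  moreover have "H * (1 / 2 ^ V) \<le> (1 :: real)" using HV by simp
  moreover have "H * \<bar>of_rat ?q - B i\<bar> = \<bar>H * of_rat ?q - H * B i\<bar>"
    by (simp add: abs_mult flip: right_diff_distrib)
  moreover have "(of_rat (of_nat H * ?q) :: real) = H * of_rat ?q" by (simp add: of_rat_mult)
  ultimately have *: "real_of_int (nsteps i) \<le> H * B i" "H * B i < real_of_int (nsteps i) + 3"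
    using floor_rat_real[of "of_nat H * ?q"] unfolding nsteps_def by (simp_all, linarith+)
  have "0 \<le> H * B i" using B[OF i] by simp
  then show "real (nat (nsteps i)) \<le> B i * H" "B i * H \<le> real (nat (nsteps i)) + 3"
    using * by (simp_all add: mult.commute)
qed

lemma grid_point_in:
  assumes c: "c \<le> count_fst l0" shows "grid_point N H c \<in> rat_points N X"
proof -
  have "point N (grid_point N H c) \<in> X"
    unfolding point_grid cuboid_def
  proof (rule restrict_PiE_iff[THEN iffD2], rule ballI)
    fix i assume i: "i \<in> {1..N}"
    have "real (c i) \<le> B i * H" using le_funD[OF c, of i] nsteps_bounds(1)[OF i] i unfolding count_l0 by simp
    then show "real (c i) / real H \<in> {0..B i}" using H_pos by (simp add: divide_le_eq)
  qed
  then show ?thesis by (simp add: rat_points_def grid_point_def)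
qed

sublocale G: game N L K Mi Bi E l0 fv gv gam B M f gs \<gamma>
proof unfold_locales
  show "\<forall>e\<in>set l0. snd e = 0 \<and> fst e \<in> {1..N}" using set_prefix_list unfolding l0_prefix by blast
  show "real (count_fst l0 i) \<le> B i * real H" "B i * real H \<le> real (count_fst l0 i + 3)" if "i \<in> {1..N}" for i
    using nsteps_bounds[OF that] that unfolding count_l0 by simp_all
  show "\<bar>real_of_int (fv l (grid_point N H c)) - real V * f l (point N (grid_point N H c))\<bar> \<le> 2"
    if "l \<in> {1..L}" "c \<le> count_fst l0" for l c
  proof -
    have "function_oracle ans tm T\<^sub>0 d (Src_f l) N X (f l)" using f[OF that(1)] by blast
    from scaled_approx[OF function_approx[OF this grid_point_in[OF that(2)], of V]]
    show ?thesis unfolding fv_def .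
  qed
  show "\<bar>real_of_int (gv k (grid_point N H c)) - real V * gs k (point N (grid_point N H c))\<bar> \<le> 2"
    if "k \<in> {1..K}" "c \<le> count_fst l0" for k c
  proof -
    have "function_oracle ans tm T\<^sub>0 d (Src_g k) N X (gs k)" using gs[OF that(1)] by blast
    from scaled_approx[OF function_approx[OF this grid_point_in[OF that(2)], of V]]
    show ?thesis unfolding gv_def .
  qed
  show "\<bar>real_of_int (gam l) - real V * \<gamma> l\<bar> \<le> 2" if "l \<in> {1..L}" for l
    unfolding gam_def by (rule scaled_approx[OF number_approx[OF ogamma[OF that]]])
qed (use ge1 M B f gs Mi E Bi in auto)

lemma callable_number: "number_oracle ans tm T\<^sub>0 d h y \<Longrightarrow> callable h []"
  unfolding callable_def number_oracle_def
  by (intro exI[of _ "{[]}"] exI[of _ "\<lambda>_. y"]) (simp add: params.pb_def list_val_def)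

lemma callable_point:
  assumes o: "function_oracle ans tm T\<^sub>0 d h N X ff" and c: "c \<le> count_fst l0"
  shows "callable h (grid_point N H c)"
proof -
  have "bits (enc (map Num (grid_point N H c))) \<le> 2 + N * (1 + (nb + 2 * H + 3))"
  proof (rule bits_enc_le)
    fix v assume "v \<in> set (map Num (grid_point N H c))"
    then obtain i where v: "v = Num (of_nat (c i) / of_nat H)" unfolding grid_point_def by auto
    have "c i \<le> length l0" using le_funD[OF c, of i] count_le_length[of "map fst l0" i] by simp
    then have "c i \<le> nb" using G.length_l0 by linarith
    then show "bits v \<le> nb + 2 * H + 3" unfolding v using H_pos by (rule bits_fraction)
  qed (simp add: grid_point_def)
  then show ?thesis unfolding callable_def using o grid_point_in[OF c]
    unfolding function_oracle_def list_val_enc params.pb_def by blast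
qed

sublocale C: main_ctx ans tm "params.regbits N L K Mi Bi E T\<^sub>0 d R a" "params.ot N L Mi Bi E T\<^sub>0 d a" T\<^sub>0 d
    "params.pb N L Mi Bi E" "params.prec N L Mi Bi E a" "params.first N L Mi Bi E T\<^sub>0 d" N L K Mi Bi E
proof unfold_locales
  show "callable (Src_f l) (grid_point N H c)" if "l \<in> {1..L}" "c \<le> count_fst l0" for l c
    using f[OF that(1)] that(2) by (blast intro: callable_point)
  show "callable (Src_g k) (grid_point N H c)" if "k \<in> {1..K}" "c \<le> count_fst l0" for k c
    using gs[OF that(1)] that(2) by (blast intro: callable_point)
  show "callable (Src_gamma l) []" if "l \<in> {1..L}" for l using ogamma[OF that] by (rule callable_number)
  show "callable (Src_B i) []" if "i \<in> {1..N}" for i using oB[OF that] by (rule callable_number)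
  show "callable Src_M []" using oM by (rule callable_number)
  show "callable Src_eps []" using oeps by (rule callable_number)
  show "length l0 \<le> nb" by (rule G.length_l0)
  show "fst e \<in> {1..N}" if "e \<in> set l0" for e using that set_prefix_list unfolding l0_prefix by blast
  show "0 < T" by (rule G.pos(7))
  show "mag + Z + 2 * (T * params.ot N L Mi Bi E T\<^sub>0 d a) + 3 * T + params.ot N L Mi Bi E T\<^sub>0 d a + params.pb N L Mi Bi E
      + nb * (N + Z + 8) + L * (Lam + 4) + Lam + K + L + N + H + V + S + Mi + Bi + E + Lr + D
      + params.prec N L Mi Bi E a + params.first N L Mi Bi E T\<^sub>0 d + 100 \<le> params.regbits N L K Mi Bi E T\<^sub>0 d R a"
    unfolding params.regbits_def mag_def by simp
qed (use ge1 Mi E Bi coord_bound H_pos in \<open>auto simp: params.prec_def\<close>)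

lemma exec_main:
  "\<exists>t s. exec ans tm main_prog (init_store N L K R a) t s \<and> s 0 = Num (C.answer a) \<and>
     t \<le> params.time N L K Mi Bi E T\<^sub>0 d R a"
proof -
  have n: "bits (nat_val k) \<le> params.regbits N L K Mi Bi E T\<^sub>0 d R a" if "k \<in> {N, L, K, R, a}" for k
    using bits_nat_val[of k] that by (auto simp: params.regbits_def params.prec_def)
  have "bits (Num 0) \<le> params.regbits N L K Mi Bi E T\<^sub>0 d R a" by (simp add: params.regbits_def)
  then have fits: "fits (init_store N L K R a)" using n by (auto simp: fits_def init_store_def)
  have "C.total_steps = params.steps N L K Mi Bi E (params.first N L Mi Bi E T\<^sub>0 d)"
    unfolding C.total_steps_def C.round_cost_def C.best_cost_def C.value_cost_def C.ascend_cost_def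
      C.coord_cost_def C.scan_cost_def C.descent_cost_def C.sweep_cost_def C.bump_cost_def C.obj_cost_def
      params.steps_def Let_def by (rule refl)
  then have steps: "C.total_steps * unit_cost = params.time N L K Mi Bi E T\<^sub>0 d R a"
    by (simp only: params.time_def unit_cost_def)
  have "W main_prog C.total_steps (\<lambda>s'. s' 0 = Num (C.answer a)) (init_store N L K R a)"
    by (rule C.W_main[OF fits]) (simp_all add: init_store_def params.prec_def)
  then show ?thesis unfolding W_def steps by blast
qed

text \<open>Formed with the exact values of \<open>g\<close> and independent of \<open>R\<close> and
  \<open>a\<close>, so that instances of the locale for different precisions share this
  number.\<close>

definition rho :: real where "rho = (\<Sum>t<T. G.g (point N (choice t))) / T"

lemma choice_grid: obtains c where "c \<le> count_fst l0" "choice t = grid_point N H c"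
  using C.grid_choice by blast

lemma choice_in: "point N (choice t) \<in> X"
proof -
  obtain c where c: "c \<le> count_fst l0" "choice t = grid_point N H c" by (rule choice_grid)
  show ?thesis using grid_point_in[OF c(1)] unfolding c(2) rat_points_def by blast
qed

lemma of_rat_answer: "of_rat (C.answer a) = (\<Sum>t<T. (of_rat (C.value_of a (choice t)) :: real)) / T"
  by (simp add: C.answer_def C.total_value_def of_rat_divide of_rat_sum)

text \<open>Maxima and averages do not amplify errors, so the precision of the single values carries
  over to the result.\<close>

lemma answer_approx: "\<bar>of_rat (C.answer a) - rho\<bar> \<le> 1 / 2 ^ a"
proof -
  have v: "\<bar>of_rat (C.value_of a (choice t)) - G.g (point N (choice t))\<bar> \<le> 1 / 2 ^ a" for t
  proof -
    obtain c where c: "c \<le> count_fst l0" "choice t = grid_point N H c" by (rule choice_grid)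
    have "(of_rat (C.value_of a (choice t)) :: real) = Max ((\<lambda>k. of_rat (eval_abs ans (Src_g k) (choice t) a)) ` {1..K})"
      unfolding C.value_of_def by (rule of_rat_Max) (use ge1 in auto)
    then show ?thesis unfolding G.g_def
    proof (simp only:, intro abs_Max_diff_le)
      fix k assume k: "k \<in> {1..K}"
      have "function_oracle ans tm T\<^sub>0 d (Src_g k) N X (gs k)" using gs[OF k] by blast
      from function_approx[OF this grid_point_in[OF c(1)], of a]
      show "\<bar>of_rat (eval_abs ans (Src_g k) (choice t) a) - gs k (point N (choice t))\<bar> \<le> 1 / 2 ^ a"
        unfolding c(2) .
    qed (use ge1 in auto)
  qed
  have "of_rat (C.answer a) - rho = (\<Sum>t<T. of_rat (C.value_of a (choice t)) - G.g (point N (choice t))) / T"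
    unfolding of_rat_answer rho_def by (simp add: sum_subtractf diff_divide_distrib)
  also have "\<bar>\<dots>\<bar> \<le> 1 / 2 ^ a" by (rule abs_average_le[OF v G.pos(7)])
  finally show ?thesis .
qed

lemma answer_exact:
  assumes "\<forall>k\<in>{1..K}. rational_valued N X (gs k)"
  shows "of_rat (C.answer a) = rho"
proof -
  have v: "of_rat (C.value_of a (choice t)) = G.g (point N (choice t))" for t
  proof -
    obtain c where c: "c \<le> count_fst l0" "choice t = grid_point N H c" by (rule choice_grid)
    have e: "of_rat (eval_abs ans (Src_g k) (choice t) a) = gs k (point N (choice t))" if "k \<in> {1..K}" for k
      using eval_abs_exact[of ans tm T\<^sub>0 d "Src_g k" "rat_points N X" "\<lambda>xs. gs k (point N xs)" "choice t" a]
        gs[OF that] assms that grid_point_in[OF c(1)] c(2)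
      unfolding function_oracle_def rational_valued_def by auto
    have "(of_rat (C.value_of a (choice t)) :: real) = Max ((\<lambda>k. of_rat (eval_abs ans (Src_g k) (choice t) a)) ` {1..K})"
      unfolding C.value_of_def by (rule of_rat_Max) (use ge1 in auto)
    also have "\<dots> = Max ((\<lambda>k. gs k (point N (choice t))) ` {1..K})"
      by (rule arg_cong[of _ _ Max], rule image_cong) (use e in auto)
    finally show ?thesis unfolding G.g_def .
  qed
  show ?thesis unfolding of_rat_answer rho_def v ..
qed

end

section \<open>Quality of the mixture of the chosen points\<close>

context problem_at
begin

lemma lipschitz_g: "lipschitz_infnorm N M X G.g"
  unfolding G.g_def by (rule G.lipschitz_Max) (use gs ge1 in auto)

lemma integral_between:
  assumes P: "P \<in> distributions N X" and h: "integrable P h" "\<And>x. x \<in> X \<Longrightarrow> lo \<le> h x \<and> h x \<le> hi"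
  shows "lo \<le> (\<integral>x. h x \<partial>P)" "(\<integral>x. h x \<partial>P) \<le> (hi :: real)"
proof -
  interpret prob_space P using G.distributionsD(1)[OF P] .
  have "AE x in P. lo \<le> h x \<and> h x \<le> hi" using h(2) G.distributionsD(2)[OF P] by (intro AE_I2) auto
  then show "lo \<le> (\<integral>x. h x \<partial>P)" "(\<integral>x. h x \<partial>P) \<le> hi"
    using integral_ge_const[OF h(1)] integral_le_const[OF h(1)] by auto
qed

lemma oscillation:
  assumes "lipschitz_infnorm N M X h" "x \<in> X" "y \<in> X" shows "h x - h y \<le> real (Mi * Bi)"
proof -
  have "\<bar>h x - h y\<bar> \<le> M * Bi" by (rule G.oscillation[OF assms]) (rule Bi(3))
  also have "\<dots> \<le> Mi * Bi" unfolding of_nat_mult using Mi(3) by (intro mult_right_mono) auto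
  finally show ?thesis by simp
qed

text \<open>Weak duality for one \<open>P\<close>: integrating \<open>payoff_optimal\<close> bounds
  the mean Lagrangian under \<open>P\<close> by the Lagrangian at the chosen point. Nonnegative
  multipliers and the constraints satisfied by \<open>P\<close> then allow the means of the
  \<open>f l\<close> to be replaced by \<gamma>, which gives \<open>opt\<close>.\<close>

lemma dual_ascent_at:
  assumes P: "P \<in> ambiguity_set N X L f \<gamma>"
  shows "dual_ascent L E V S Lam U (Mi * Bi) Lr T (\<lambda>t l. multipliers t ! l)
     (\<lambda>t l. fv (Suc l) (choice t) - gam (Suc l)) (\<lambda>t l. f (Suc l) (point N (choice t)))
     (\<lambda>l. \<gamma> (Suc l)) (\<lambda>t. G.g (point N (choice t))) (\<integral>x. G.g x \<partial>P)"
proof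
  have D: "P \<in> distributions N X" using P by (simp add: ambiguity_set_def)
  note int = G.integrable_lipschitz[OF D]
  have fint: "integrable P (f (Suc l))" "(\<integral>x. f (Suc l) x \<partial>P) \<le> \<gamma> (Suc l)"
      "lipschitz_infnorm N M X (f (Suc l))" if "l < L" for l
    using that f[of "Suc l"] int P by (auto simp: ambiguity_set_def)
  show "Lr = 2 * E * (Mi * Bi + 1)" by (rule Lr_def)
  show "20 * E * (L * Lr + 1) \<le> V" by (simp add: V_def D_def)
  show "U = V * (Mi * Bi) + 8" by (rule U_def)
  show "S = 2 * E * L * (1 + U\<^sup>2)" by (rule S_def)
  show "Lam = S * Lr" by (rule Lam_def)
  show "T = Lam\<^sup>2" by (rule T_def)
  show "1 \<le> E" "1 \<le> L" by (rule E ge1)+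
  fix l assume l: "l < L"
  then have l': "Suc l \<in> {1..L}" by auto
  show "multipliers 0 ! l = 0" using l by (simp add: multipliers_def)
  show "multipliers (Suc t) ! l = clip (int Lam) (multipliers t ! l + (fv (Suc l) (choice t) - gam (Suc l)))" for t
  proof -
    have "multipliers (Suc t) = ascend (multipliers t)" by (simp add: multipliers_def)
    then show ?thesis using l by (simp add: ascend_def choice_def)
  qed
  show "\<bar>real_of_int (fv (Suc l) (choice t) - gam (Suc l)) - real V * (f (Suc l) (point N (choice t)) - \<gamma> (Suc l))\<bar> \<le> 4" for t
  proof -
    obtain c where c: "c \<le> count_fst l0" "choice t = grid_point N H c" by (rule choice_grid)
    show ?thesis using G.fv[OF l' c(1)] G.gam[OF l'] unfolding c(2) by (simp add: right_diff_distrib)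
  qed
  show "f (Suc l) (point N (choice t)) - f (Suc l) (point N (choice t')) \<le> real (Mi * Bi)" for t t'
    by (rule oscillation[OF fint(3)[OF l] choice_in choice_in])
  \<comment> \<open>The mean under a feasible \<open>P\<close> is at most \<gamma>, and a function
    exceeds its mean by at most its oscillation.\<close>
  show "f (Suc l) (point N (choice t)) - \<gamma> (Suc l) \<le> real (Mi * Bi)" for t
  proof -
    have "f (Suc l) (point N (choice t)) - real (Mi * Bi) \<le> f (Suc l) x" if "x \<in> X" for x
      using oscillation[OF fint(3)[OF l] choice_in that, of t] by linarith
    moreover have "f (Suc l) x \<le> f (Suc l) (point N (choice t)) + real (Mi * Bi)" if "x \<in> X" for x
      using oscillation[OF fint(3)[OF l] that choice_in, of t] by linarith
    ultimately have "f (Suc l) (point N (choice t)) - real (Mi * Bi) \<le> (\<integral>x. f (Suc l) x \<partial>P)"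
      by (intro integral_between(1)[OF D fint(1)[OF l]]) auto
    then show ?thesis using fint(2)[OF l] by linarith
  qed
next
  have D: "P \<in> distributions N X" using P by (simp add: ambiguity_set_def)
  interpret prob_space P using G.distributionsD(1)[OF D] .
  note int = G.integrable_lipschitz[OF D]
  have fint: "integrable P (f (Suc l))" "(\<integral>x. f (Suc l) x \<partial>P) \<le> \<gamma> (Suc l)" if "l < L" for l
    using that f[of "Suc l"] int P by (auto simp: ambiguity_set_def)
  have gint: "integrable P G.g" by (rule int[OF lipschitz_g])
  fix t
  let ?x = "point N (choice t)"
  have "G.g ?x - real (Mi * Bi) \<le> G.g x \<and> G.g x \<le> G.g ?x + real (Mi * Bi)" if "x \<in> X" for x
    using oscillation[OF lipschitz_g choice_in that, of t] oscillation[OF lipschitz_g that choice_in, of t] by linarith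
  from integral_between(1)[OF D gint this]
  show "G.g ?x \<le> (\<integral>x. G.g x \<partial>P) + real (Mi * Bi)" by linarith
  let ?lam = "multipliers t"
  let ?C = "S * G.g ?x - (\<Sum>i<L. real_of_int (?lam ! i) * f (Suc i) ?x) + S / (2 * E)"
  have le: "S * G.g y - (\<Sum>i<L. real_of_int (?lam ! i) * f (Suc i) y) \<le> ?C" if y: "y \<in> X" for y
  proof -
    have "G.g y \<in> (\<lambda>k. gs k y) ` {1..K}" unfolding G.g_def using ge1 by (intro Max_in) auto
    then obtain k where k: "k \<in> {1..K}" "G.g y = gs k y" by blast
    show ?thesis
      using G.payoff_optimal[OF good_multipliers_t[of t] y k(1)]
      unfolding G.payoff_def k(2) choice_def[symmetric] .
  qed
  have sint: "integrable P (\<lambda>y. \<Sum>i<L. real_of_int (?lam ! i) * f (Suc i) y)"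
    using fint by (intro Bochner_Integration.integrable_sum integrable_mult_right) auto
  have "(\<integral>y. S * G.g y - (\<Sum>i<L. real_of_int (?lam ! i) * f (Suc i) y) \<partial>P) \<le> ?C"
  proof (rule integral_le_const)
    show "integrable P (\<lambda>y. S * G.g y - (\<Sum>i<L. real_of_int (?lam ! i) * f (Suc i) y))"
      using gint sint by (intro Bochner_Integration.integrable_diff integrable_mult_right) auto
    show "AE y in P. S * G.g y - (\<Sum>i<L. real_of_int (?lam ! i) * f (Suc i) y) \<le> ?C"
      using le G.distributionsD(2)[OF D] by (intro AE_I2) auto
  qed
  also have "(\<integral>y. S * G.g y - (\<Sum>i<L. real_of_int (?lam ! i) * f (Suc i) y) \<partial>P) =
      S * (\<integral>y. G.g y \<partial>P) - (\<Sum>i<L. real_of_int (?lam ! i) * (\<integral>y. f (Suc i) y \<partial>P))"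
  proof -
    have "(\<integral>y. (\<Sum>i<L. real_of_int (?lam ! i) * f (Suc i) y) \<partial>P) = (\<Sum>i<L. \<integral>y. real_of_int (?lam ! i) * f (Suc i) y \<partial>P)"
      using fint by (intro Bochner_Integration.integral_sum integrable_mult_right) auto
    then show ?thesis using gint sint by (subst Bochner_Integration.integral_diff) auto
  qed
  finally have 1: "S * (\<integral>y. G.g y \<partial>P) - (\<Sum>i<L. real_of_int (?lam ! i) * (\<integral>y. f (Suc i) y \<partial>P)) \<le> ?C" .
  have 2: "(\<Sum>i<L. real_of_int (?lam ! i) * (\<integral>y. f (Suc i) y \<partial>P)) \<le> (\<Sum>i<L. real_of_int (?lam ! i) * \<gamma> (Suc i))"
    using fint(2) multipliers_bounds(1) by (intro sum_mono mult_left_mono) auto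
  show "S * (\<integral>x. G.g x \<partial>P) + (\<Sum>l<L. real_of_int (?lam ! l) * (f (Suc l) ?x - \<gamma> (Suc l))) - S / real (2 * E) \<le> S * G.g ?x"
    using 1 2 by (simp add: right_diff_distrib sum_subtractf)
qed

text \<open>\<open>rho\<close> does not depend on \<open>P\<close>, so the first bound extends to
  the supremum over all \<open>P\<close>, and a single feasible \<open>P\<close> yields the
  second.\<close>

lemma value_quality:
  assumes "P \<in> ambiguity_set N X L f \<gamma>"
  shows "(\<integral>x. G.g x \<partial>P) - \<epsilon> \<le> rho"
    and "l \<in> {1..L} \<Longrightarrow> (\<Sum>t<T. f l (point N (choice t))) / T \<le> \<gamma> l + \<epsilon>"
proof -
  note eps = E(3)
  interpret dual_ascent L E V S Lam U "Mi * Bi" Lr T "\<lambda>t l. multipliers t ! l"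
     "\<lambda>t l. fv (Suc l) (choice t) - gam (Suc l)" "\<lambda>t l. f (Suc l) (point N (choice t))"
     "\<lambda>l. \<gamma> (Suc l)" "\<lambda>t. G.g (point N (choice t))" "\<integral>x. G.g x \<partial>P"
    by (rule dual_ascent_at[OF assms])
  show "(\<integral>x. G.g x \<partial>P) - \<epsilon> \<le> rho" using value_bound eps unfolding rho_def by linarith
  assume l: "l \<in> {1..L}"
  then obtain l' where l': "l = Suc l'" "l' < L" by (cases l) auto
  show "(\<Sum>t<T. f l (point N (choice t))) / T \<le> \<gamma> l + \<epsilon>"
    using constraint_bound[OF l'(2)] eps unfolding l'(1) by linarith
qed

text \<open>Rounds are counted from 0 but the points of a mixture from 1, hence the shift; a point
  chosen several times receives a multiple of \<open>1 / T\<close>.\<close>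

definition mixture :: "(nat \<Rightarrow> real) measure" where
  "mixture = dirac_mixture N X T (\<lambda>_. 1 / T) (\<lambda>r. point N (choice (r - 1)))"

lemma mixture:
  shows "mixture \<in> distributions N X"
    and "lipschitz_infnorm N M X h \<Longrightarrow> (\<integral>x. h x \<partial>mixture) = (\<Sum>t<T. h (point N (choice t))) / T"
proof -
  have p: "(\<Sum>r\<in>{1..T}. 1 / real T) = 1" using G.pos(7) by simp
  show "mixture \<in> distributions N X"
    unfolding mixture_def by (rule G.dirac_mixture_distribution(1)) (use choice_in p in auto)
  assume h: "lipschitz_infnorm N M X h"
  have "(\<integral>x. h x \<partial>mixture) = (\<Sum>r\<in>{1..T}. 1 / T * h (point N (choice (r - 1))))"
    unfolding mixture_def
    by (rule G.dirac_mixture_distribution(2)) (use choice_in p G.measurable_lipschitz[OF h] in auto)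
  also have "\<dots> = (\<Sum>t<T. 1 / T * h (point N (choice t)))"
    by (simp add: sum.atLeast1_atMost_eq del: One_nat_def, simp add: sum.atLeast1_atMost_eq)
  finally show "(\<integral>x. h x \<partial>mixture) = (\<Sum>t<T. h (point N (choice t))) / T"
    by (simp add: sum_divide_distrib)
qed

end

section \<open>Polynomial bounds\<close>

text \<open>A family is indexed by the vector of the quantities \<open>N\<close>, \<open>L\<close>, \<open>K\<close>, \<open>Mi\<close>, \<open>Bi\<close>, \<open>E\<close>,
  \<open>T\<^sub>0\<close>, \<open>R\<close>, \<open>a\<close>, in this order.\<close>

definition poly_bounded :: "((nat \<Rightarrow> nat) \<Rightarrow> nat) \<Rightarrow> bool" where
  "poly_bounded F \<longleftrightarrow> (\<exists>c m. \<forall>x. F x \<le> c * (1 + (\<Sum>i<9. x i)) ^ m)"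

lemma poly_bounded_const: "poly_bounded (\<lambda>_. k)"
  unfolding poly_bounded_def by (intro exI[of _ k] exI[of _ 0]) simp

lemma poly_bounded_arg: "i < 9 \<Longrightarrow> poly_bounded (\<lambda>x. x i)"
  unfolding poly_bounded_def
  by (intro exI[of _ 1] exI[of _ 1]) (auto intro!: le_SucI member_le_sum)

lemma poly_bounded_add:
  assumes "poly_bounded F" "poly_bounded G" shows "poly_bounded (\<lambda>x. F x + G x)"
proof -
  obtain c m c' m' where F: "\<And>x. F x \<le> c * (1 + (\<Sum>i<9. x i)) ^ m"
    and G: "\<And>x. G x \<le> c' * (1 + (\<Sum>i<9. x i)) ^ m'"
    using assms unfolding poly_bounded_def by blast
  have "F x + G x \<le> (c + c') * (1 + (\<Sum>i<9. x i)) ^ (m + m')" for x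
  proof -
    let ?y = "1 + (\<Sum>i<9. x i)"
    have "?y ^ m \<le> ?y ^ (m + m')" "?y ^ m' \<le> ?y ^ (m + m')" by (intro power_increasing; simp)+
    then have "c * ?y ^ m \<le> c * ?y ^ (m + m')" "c' * ?y ^ m' \<le> c' * ?y ^ (m + m')"
      by (auto intro: mult_le_mono2)
    then have "F x + G x \<le> c * ?y ^ (m + m') + c' * ?y ^ (m + m')"
      using F[of x] G[of x] by (meson add_mono order.trans)
    then show ?thesis by (simp only: add_mult_distrib)
  qed
  then show ?thesis unfolding poly_bounded_def by blast
qed

lemma poly_bounded_mult:
  assumes "poly_bounded F" "poly_bounded G" shows "poly_bounded (\<lambda>x. F x * G x)"
proof -
  obtain c m c' m' where F: "\<And>x. F x \<le> c * (1 + (\<Sum>i<9. x i)) ^ m"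
    and G: "\<And>x. G x \<le> c' * (1 + (\<Sum>i<9. x i)) ^ m'"
    using assms unfolding poly_bounded_def by blast
  have "F x * G x \<le> (c * c') * (1 + (\<Sum>i<9. x i)) ^ (m + m')" for x
    using mult_le_mono[OF F G, of x x] by (simp only: power_add ac_simps)
  then show ?thesis unfolding poly_bounded_def by blast
qed

lemma poly_bounded_power: "poly_bounded F \<Longrightarrow> poly_bounded (\<lambda>x. F x ^ k)"
  by (induction k) (auto intro: poly_bounded_const poly_bounded_mult)

lemmas poly_bounded_intros =
  poly_bounded_add poly_bounded_mult poly_bounded_power poly_bounded_const poly_bounded_arg

lemma poly_bounded_Lr: "poly_bounded (\<lambda>x. params.Lr (x 3) (x 4) (x 5))"
  unfolding params.Lr_def by (intro poly_bounded_intros; simp)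

lemma poly_bounded_D: "poly_bounded (\<lambda>x. params.D (x 1) (x 3) (x 4) (x 5))"
  unfolding params.D_def by (intro poly_bounded_intros poly_bounded_Lr; simp)

lemma poly_bounded_H: "poly_bounded (\<lambda>x. params.H (x 1) (x 3) (x 4) (x 5))"
  unfolding params.H_def by (intro poly_bounded_intros poly_bounded_D; simp)

lemma poly_bounded_nb: "poly_bounded (\<lambda>x. params.nb (x 0) (x 1) (x 3) (x 4) (x 5))"
  unfolding params.nb_def by (intro poly_bounded_intros poly_bounded_H; simp)

lemma poly_bounded_V: "poly_bounded (\<lambda>x. params.V (x 0) (x 1) (x 3) (x 4) (x 5))"
  unfolding params.V_def by (intro poly_bounded_intros poly_bounded_D poly_bounded_nb; simp)

lemma poly_bounded_S: "poly_bounded (\<lambda>x. params.S (x 0) (x 1) (x 3) (x 4) (x 5))"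
  unfolding params.S_def params.U_def by (intro poly_bounded_intros poly_bounded_V; simp)

lemma poly_bounded_Lam: "poly_bounded (\<lambda>x. params.Lam (x 0) (x 1) (x 3) (x 4) (x 5))"
  unfolding params.Lam_def by (intro poly_bounded_intros poly_bounded_S poly_bounded_Lr; simp)

lemma poly_bounded_T: "poly_bounded (\<lambda>x. params.T (x 0) (x 1) (x 3) (x 4) (x 5))"
  unfolding params.T_def by (intro poly_bounded_intros poly_bounded_Lam; simp)

lemma poly_bounded_Z: "poly_bounded (\<lambda>x. params.Z (x 0) (x 1) (x 3) (x 4) (x 5))"
  unfolding params.Z_def params.Wb_def
  by (intro poly_bounded_intros poly_bounded_Lam poly_bounded_S poly_bounded_V; simp)

lemma poly_bounded_pb: "poly_bounded (\<lambda>x. params.pb (x 0) (x 1) (x 3) (x 4) (x 5))"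
  unfolding params.pb_def by (intro poly_bounded_intros poly_bounded_nb poly_bounded_H; simp)

lemma poly_bounded_first: "poly_bounded (\<lambda>x. params.first (x 0) (x 1) (x 3) (x 4) (x 5) (x 6) d)"
  unfolding params.first_def by (intro poly_bounded_intros poly_bounded_pb; simp)

lemma poly_bounded_prec: "poly_bounded (\<lambda>x. params.prec (x 0) (x 1) (x 3) (x 4) (x 5) (x 8))"
  unfolding params.prec_def by (intro poly_bounded_intros poly_bounded_V; simp)

lemma poly_bounded_ot: "poly_bounded (\<lambda>x. params.ot (x 0) (x 1) (x 3) (x 4) (x 5) (x 6) d (x 8))"
  unfolding params.ot_def
  by (intro poly_bounded_intros poly_bounded_pb poly_bounded_prec poly_bounded_first; simp)

lemma poly_bounded_regbits:
  "poly_bounded (\<lambda>x. params.regbits (x 0) (x 1) (x 2) (x 3) (x 4) (x 5) (x 6) d (x 7) (x 8))"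
  unfolding params.regbits_def
  by (intro poly_bounded_intros poly_bounded_Lr poly_bounded_D poly_bounded_H poly_bounded_nb poly_bounded_V
     poly_bounded_S poly_bounded_Lam poly_bounded_T poly_bounded_Z poly_bounded_pb poly_bounded_first
     poly_bounded_prec poly_bounded_ot; simp)

lemma poly_bounded_time:
  "poly_bounded (\<lambda>x. params.time (x 0) (x 1) (x 2) (x 3) (x 4) (x 5) (x 6) d (x 7) (x 8))"
  unfolding params.time_def params.steps_def Let_def
  by (intro poly_bounded_intros poly_bounded_nb poly_bounded_T poly_bounded_Z poly_bounded_first
     poly_bounded_regbits poly_bounded_ot; simp)

theorem theorem5p1:
  shows "\<exists>c :: prog. \<forall>d :: nat. \<exists>\<pi> :: real poly.
    \<forall>(N :: nat) (L :: nat) (K :: nat) (R :: nat) (M :: real)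
     (B :: nat \<Rightarrow> real) (f :: nat \<Rightarrow> (nat \<Rightarrow> real) \<Rightarrow> real) (\<gamma> :: nat \<Rightarrow> real)
     (p :: nat \<Rightarrow> real) (\<xi> :: nat \<Rightarrow> nat \<Rightarrow> real) (gs :: nat \<Rightarrow> (nat \<Rightarrow> real) \<Rightarrow> real)
     (g :: (nat \<Rightarrow> real) \<Rightarrow> real) (\<epsilon> :: real)
     (X :: (nat \<Rightarrow> real) set) (P_sub :: (nat \<Rightarrow> real) measure set) (\<rho>_star :: real)
     (ans :: val \<Rightarrow> rat) (tm :: val \<Rightarrow> nat) (T :: nat).
      N \<ge> 1 \<longrightarrow> L \<ge> 1 \<longrightarrow> K \<ge> 1 \<longrightarrow> R \<ge> 1 \<longrightarrow> M > 0 \<longrightarrow> \<epsilon> > 0 \<longrightarrow>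
      (\<forall>i\<in>{1..N}. 0 \<le> B i) \<longrightarrow>
      X = cuboid N B \<longrightarrow>
      (\<forall>l\<in>{1..L}. submodular X (f l) \<and> lipschitz_infnorm N M X (f l) \<and>
         function_oracle ans tm T d (Src_f l) N X (f l)) \<longrightarrow>
      P_sub = ambiguity_set N X L f \<gamma> \<longrightarrow>
      (\<forall>r\<in>{1..R}. \<xi> r \<in> X \<and> 0 \<le> p r) \<longrightarrow>
      (\<Sum>r\<in>{1..R}. p r) = 1 \<longrightarrow>
      dirac_mixture N X R p \<xi> \<in> P_sub \<longrightarrow>
      (\<forall>k\<in>{1..K}. supermodular X (gs k) \<and> lipschitz_infnorm N M X (gs k) \<and>
         function_oracle ans tm T d (Src_g k) N X (gs k)) \<longrightarrow>
      g = (\<lambda>x. Max ((\<lambda>k. gs k x) ` {1..K})) \<longrightarrow>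
      number_oracle ans tm T d Src_M M \<longrightarrow>
      number_oracle ans tm T d Src_eps \<epsilon> \<longrightarrow>
      (\<forall>i\<in>{1..N}. number_oracle ans tm T d (Src_B i) (B i)) \<longrightarrow>
      (\<forall>l\<in>{1..L}. number_oracle ans tm T d (Src_gamma l) (\<gamma> l)) \<longrightarrow>
      (\<forall>r\<in>{1..R}. number_oracle ans tm T d (Src_p r) (p r)) \<longrightarrow>
      (\<forall>r\<in>{1..R}. \<forall>i\<in>{1..N}. number_oracle ans tm T d (Src_xi r i) (\<xi> r i)) \<longrightarrow>
      \<rho>_star = (SUP P\<in>P_sub. \<integral>x. g x \<partial>P) \<longrightarrow>
      (\<exists>\<rho>. finds_value ans tm c N L K R \<rho> (\<forall>k\<in>{1..K}. rational_valued N X (gs k))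
              (\<lambda>a. poly_in \<pi> [real N, real L, real K, Max (B ` {1..N}), real R, M, 1 / \<epsilon>,
                               real T, real a]) \<and>
           \<rho> \<ge> \<rho>_star - \<epsilon> \<and>
           (\<exists>P\<in>distributions N X. \<rho> = (\<integral>x. g x \<partial>P) \<and>
              (\<forall>l\<in>{1..L}. (\<integral>x. f l x \<partial>P) \<le> \<gamma> l + \<epsilon>)))"
proof -
  \<comment> \<open>The degree \<open>d\<close> of the oracle times precedes the polynomial in the
    quantifier order, so the constant and the exponent may depend on it.\<close>
  have "\<forall>d. \<exists>c m. \<forall>x :: nat \<Rightarrow> nat. params.time (x 0) (x 1) (x 2) (x 3) (x 4) (x 5) (x 6) d (x 7) (x 8)
      \<le> c * (1 + (\<Sum>i<9. x i)) ^ m"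
    using poly_bounded_time unfolding poly_bounded_def by blast
  then obtain c m where time: "\<And>d (x :: nat \<Rightarrow> nat).
      params.time (x 0) (x 1) (x 2) (x 3) (x 4) (x 5) (x 6) d (x 7) (x 8) \<le> c d * (1 + (\<Sum>i<9. x i)) ^ m d"
    by metis
  show ?thesis
  proof (rule exI[of _ main_prog], rule allI, rule_tac x = "smult (real (c d)) ([:4, 4:] ^ m d)" in exI,
      intro allI impI)
    fix d :: nat
    \<comment> \<open>\<open>Mi\<close>, \<open>Bi\<close> and \<open>E\<close> exceed
      \<open>M\<close>, the largest \<open>B i\<close> and \<open>1 / \<epsilon>\<close> by a factor
      of at most 4 and a summand 1 each. With the 1 in the polynomial bound, the base is therefore
      at most 4 plus 4 times the sum of the given quantities.\<close>
    let ?pol = "smult (real (c d)) ([:4, 4:] ^ m d)"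
    fix N L K R :: nat and M :: real and B :: "nat \<Rightarrow> real" and f :: "nat \<Rightarrow> (nat \<Rightarrow> real) \<Rightarrow> real"
      and \<gamma> p :: "nat \<Rightarrow> real" and \<xi> :: "nat \<Rightarrow> nat \<Rightarrow> real" and gs :: "nat \<Rightarrow> (nat \<Rightarrow> real) \<Rightarrow> real"
      and g :: "(nat \<Rightarrow> real) \<Rightarrow> real" and \<epsilon> :: real and X :: "(nat \<Rightarrow> real) set"
      and P_sub :: "(nat \<Rightarrow> real) measure set" and \<rho>_star :: real
      and ans :: "val \<Rightarrow> rat" and tm :: "val \<Rightarrow> nat" and T :: nat
    assume ge1: "N \<ge> 1" "L \<ge> 1" "K \<ge> 1" "R \<ge> 1" "M > 0" "\<epsilon> > 0" and B: "\<forall>i\<in>{1..N}. 0 \<le> B i"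
      and X: "X = cuboid N B"
      and f: "\<forall>l\<in>{1..L}. submodular X (f l) \<and> lipschitz_infnorm N M X (f l) \<and>
         function_oracle ans tm T d (Src_f l) N X (f l)"
      and P_sub: "P_sub = ambiguity_set N X L f \<gamma>"
      and \<xi>: "\<forall>r\<in>{1..R}. \<xi> r \<in> X \<and> 0 \<le> p r" and p: "(\<Sum>r\<in>{1..R}. p r) = 1"
      and feasible: "dirac_mixture N X R p \<xi> \<in> P_sub"
      and gs: "\<forall>k\<in>{1..K}. supermodular X (gs k) \<and> lipschitz_infnorm N M X (gs k) \<and>
         function_oracle ans tm T d (Src_g k) N X (gs k)"
      and g: "g = (\<lambda>x. Max ((\<lambda>k. gs k x) ` {1..K}))"
      and oracles: "number_oracle ans tm T d Src_M M" "number_oracle ans tm T d Src_eps \<epsilon>"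
        "\<forall>i\<in>{1..N}. number_oracle ans tm T d (Src_B i) (B i)"
        "\<forall>l\<in>{1..L}. number_oracle ans tm T d (Src_gamma l) (\<gamma> l)"
      and \<rho>_star: "\<rho>_star = (SUP P\<in>P_sub. \<integral>x. g x \<partial>P)"
    have prob: "problem N L K M B f \<gamma> gs \<epsilon> ans tm T d"
      by unfold_locales (use ge1 B f gs oracles in \<open>simp_all add: X\<close>)
    \<comment> \<open>Any precision would define the same \<open>rho\<close> and the same mixture; 0
      fixes one instance.\<close>
    interpret A: problem_at N L K M B f \<gamma> gs \<epsilon> ans tm T d R 0
      using prob by (rule problem_at.intro)
    have gG: "g = A.G.g" unfolding g A.G.g_def ..
    have val: "finds_value ans tm main_prog N L K R A.rho (\<forall>k\<in>{1..K}. rational_valued N X (gs k))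
       (\<lambda>a. poly_in ?pol [real N, real L, real K, Max (B ` {1..N}), real R, M, 1 / \<epsilon>, real T, real a])"
      unfolding finds_value_def
    proof
      fix a
      \<comment> \<open>The run with precision \<open>a\<close>. Only its answer varies with
        \<open>a\<close>; \<open>Aa.rho\<close> is the same term as \<open>A.rho\<close>.\<close>
      interpret Aa: problem_at N L K M B f \<gamma> gs \<epsilon> ans tm T d R a
        using prob by (rule problem_at.intro)
      obtain t s where t: "exec ans tm main_prog (init_store N L K R a) t s" "s 0 = Num (Aa.C.answer a)"
        "t \<le> params.time N L K A.Mi A.Bi A.E T d R a"
        using Aa.exec_main by blast
      let ?x = "\<lambda>i. [N, L, K, A.Mi, A.Bi, A.E, T, R, a] ! i"
      let ?\<sigma> = "sum_list [real N, real L, real K, Max (B ` {1..N}), real R, M, 1 / \<epsilon>, real T, real a]"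
      have B0: "0 \<le> Max (B ` {1..N})"
      proof -
        have "0 \<le> B 1" using B ge1 by simp
        also have "B 1 \<le> Max (B ` {1..N})" using ge1 by (intro Max_ge) auto
        finally show ?thesis .
      qed
      have sum: "(\<Sum>i<9. ?x i) = N + L + K + A.Mi + A.Bi + A.E + T + R + a"
        by (simp add: eval_nat_numeral)
      have le: "real (1 + (\<Sum>i<9. ?x i)) \<le> 4 + 4 * ?\<sigma>"
      proof -
        have "0 \<le> 1 / \<epsilon>" "4 / \<epsilon> = 4 * (1 / \<epsilon>)" using ge1 by simp_all
        then show ?thesis unfolding sum using A.Mi(4) A.E(4) A.Bi(4) B0 ge1(5) by simp
      qed
      have "real (c d) * real (1 + (\<Sum>i<9. ?x i)) ^ m d \<le> real (c d) * (4 + 4 * ?\<sigma>) ^ m d"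
        by (rule mult_left_mono[OF power_mono[OF le of_nat_0_le_iff] of_nat_0_le_iff])
      moreover have "real t \<le> real (c d) * real (1 + (\<Sum>i<9. ?x i)) ^ m d"
      proof -
        have "params.time N L K A.Mi A.Bi A.E T d R a \<le> c d * (1 + (\<Sum>i<9. ?x i)) ^ m d"
          using time[of ?x d] by (simp add: eval_nat_numeral)
        then have "t \<le> c d * (1 + (\<Sum>i<9. ?x i)) ^ m d" using t(3) by (rule order.trans[rotated])
        then have "real t \<le> real (c d * (1 + (\<Sum>i<9. ?x i)) ^ m d)" by (simp only: of_nat_le_iff)
        then show ?thesis by (simp only: of_nat_mult of_nat_power)
      qed
      ultimately have "real t \<le> poly_in ?pol [real N, real L, real K, Max (B ` {1..N}), real R, M, 1 / \<epsilon>, real T, real a]"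
        unfolding poly_in_def by (simp add: poly_power mult.commute)
      then show "\<exists>t s q. exec ans tm main_prog (init_store N L K R a) t s \<and> s 0 = Num q \<and>
        \<bar>of_rat q - A.rho\<bar> \<le> 1 / 2 ^ a \<and> ((\<forall>k\<in>{1..K}. rational_valued N X (gs k)) \<longrightarrow> of_rat q = A.rho) \<and>
        real t \<le> poly_in ?pol [real N, real L, real K, Max (B ` {1..N}), real R, M, 1 / \<epsilon>, real T, real a]"
        using t(1,2) Aa.answer_approx Aa.answer_exact unfolding X by blast
    qed
    have "\<rho>_star \<le> A.rho + \<epsilon>"
      unfolding \<rho>_star
    proof (rule cSUP_least)
      show "P_sub \<noteq> {}" using feasible by blast
      fix P assume "P \<in> P_sub"
      then have "P \<in> ambiguity_set N (cuboid N B) L f \<gamma>" using P_sub X by simp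
      from A.value_quality(1)[OF this] show "(\<integral>x. g x \<partial>P) \<le> A.rho + \<epsilon>" unfolding gG by linarith
    qed
    moreover have "A.mixture \<in> distributions N X" unfolding X by (rule A.mixture(1))
    moreover have "A.rho = (\<integral>x. g x \<partial>A.mixture)"
      unfolding gG A.mixture(2)[OF A.lipschitz_g] A.rho_def ..
    moreover have "(\<integral>x. f l x \<partial>A.mixture) \<le> \<gamma> l + \<epsilon>" if l: "l \<in> {1..L}" for l
    proof -
      have "lipschitz_infnorm N M (cuboid N B) (f l)" using f l X by blast
      then show ?thesis
        using A.value_quality(2)[OF _ l] feasible P_sub X by (simp add: A.mixture(2))
    qed
    ultimately show "\<exists>\<rho>. finds_value ans tm main_prog N L K R \<rho> (\<forall>k\<in>{1..K}. rational_valued N X (gs k))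
              (\<lambda>a. poly_in ?pol [real N, real L, real K, Max (B ` {1..N}), real R, M, 1 / \<epsilon>,
                               real T, real a]) \<and>
           \<rho> \<ge> \<rho>_star - \<epsilon> \<and>
           (\<exists>P\<in>distributions N X. \<rho> = (\<integral>x. g x \<partial>P) \<and>
              (\<forall>l\<in>{1..L}. (\<integral>x. f l x \<partial>P) \<le> \<gamma> l + \<epsilon>))"
      using val by (intro exI[of _ A.rho]) auto
  qed
qed

end
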